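(* Let $(W,S)$ be a Coxeter system with $S$ finite, let $L$ be the set of low elements of $W$, let $\nu_L$ be the voracious projection with respect to the Garside shadow $L$, and for $g\in W$ let $p(g)$ be the (Osajda–Przytycki) voracious projection of $g$. Then $p(g)=\nu_L(g)$ for every $g\in W$.
   Context: **Coxeter systems, walls.** $(W,S)$ is a Coxeter system with $S$ finite and length function $\ell$. $X^1$ is the Cayley graph of $W$ with respect to $S$ (vertex set $W$, an edge of length 1 joining $g$ to $gs$ for $g\in W$, $s\in S$), with $W$ acting by left multiplication. A reflection is an element of $R=\bigcup_{g\in W}gSg^{-1}$; the wall $\mathcal{W}_r$ of $r\in R$ is the fixed point set of $r$ in $X^1$. The complement of each wall in $X^1$ has two components, called half-spaces. A wall $\mathcal{W}$ separates two objects (elements of $W$, or walls) if they are contained in different half-spaces of $\mathcal{W}$. For $m\in\mathbb{N}$, a wall $\mathcal{W}$ is $m$-close to $g\in W$ if at most $m$ walls separate $g$ from $\mathcal{W}$. **Weak order.** $g\preceq h$ iff $g$ lies on a geodesic in $X^1$ from $\mathrm{id}$ to $h$ (right weak order). Every subset of $W$ bounded above has a join $\bigvee$ (least upper bound). **Low elements.** A wall is elementary if it is $0$-close to $\mathrm{id}$. Let $\Sigma$ be the set of elementary walls. The Shi parts are the sets $Y\cap W$ where $Y$ is a connected component of $X^1$ with the walls in $\Sigma$ removed; they partition $W$. It is known that each Shi part has a smallest element with respect to $\preceq$, called its gate; $L$ is the set of all gates of Shi parts. It is known that $L$ is a finite Garside shadow, i.e. $S\subseteq L$, $L$ contains the join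 of each of its subsets whose join exists, and $L$ is closed under suffixes ($w$ is a suffix of $g$ if $g=uw$ with $\ell(g)=\ell(u)+\ell(w)$). **Voracious projection with respect to $L$.** $\pi_L(g)=\bigvee\{b\in L: b\preceq g\}$ and $\nu_L(g)=g\,\pi_L(g^{-1})$. **Osajda–Przytycki voracious projection.** For $g\in W$ let $\mathcal{W}(g)$ be the set of walls in $X^1$ that separate $g$ from $\mathrm{id}$ and are $0$-close to $g$. Let $P(g)$ be the set of elements $p\in W$ such that $p\preceq g$ and $p$ is not separated from $\mathrm{id}$ by any wall in $\mathcal{W}(g)$. It is known (Osajda–Przytycki) that $P(g)$ has a largest element with respect to $\preceq$; this element is denoted $p(g)$. *)

theory Defs
  imports "HOL-Algebra.Algebra" "HOL-Analysis.Analysis"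
begin

section \<open>Coxeter systems\<close>

text \<open>
  A word in the generators is a list. One rewriting step deletes a relator \<open>(s t)^m\<close>, where \<open>m\<close>
  is the order of \<open>s t\<close> in the group. \<open>group.ord\<close> is \<open>0\<close> for elements of infinite order, so that
  such pairs contribute only the empty relator.
\<close>

inductive coxeter_step :: "('a, 'b) monoid_scheme \<Rightarrow> 'a set \<Rightarrow> 'a list \<Rightarrow> 'a list \<Rightarrow> bool"
  for W S where
  "\<lbrakk>u \<in> lists S; v \<in> lists S; s \<in> S; t \<in> S\<rbrakk> \<Longrightarrow>
     coxeter_step W S
       (u @ concat (replicate (group.ord W (s \<otimes>\<^bsub>W\<^esub> t)) [s, t]) @ v) (u @ v)"

definition word_prod :: "('a, 'b) monoid_scheme \<Rightarrow> 'a list \<Rightarrow> 'a" where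
  "word_prod W u = foldr (\<lambda>s g. s \<otimes>\<^bsub>W\<^esub> g) u \<one>\<^bsub>W\<^esub>"

text \<open>
  Bourbaki's definition: \<open>S\<close> is a generating set of elements of order 2, and the relations
  \<open>(s t)^m = 1\<close>, with \<open>m\<close> the (finite) order of \<open>s t\<close>, form a presentation of \<open>W\<close>. For \<open>s = t\<close>
  the relator is \<open>s s\<close>, so words without formal inverses suffice: the monoid with this
  presentation is already the group with this presentation.
\<close>

locale coxeter_system = group W for W (structure) +
  fixes S :: "'a set"
  assumes gens_closed: "S \<subseteq> carrier W"
    and gens_order_two: "s \<in> S \<Longrightarrow> ord s = 2"
    and gens_generate: "generate W S = carrier W"
    and presentation:
      "\<lbrakk>u \<in> lists S; v \<in> lists S; word_prod W u = word_prod W v\<rbrakk> \<Longrightarrow>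
         equivclp (coxeter_step W S) u v"

definition reflections :: "('a, 'b) monoid_scheme \<Rightarrow> 'a set \<Rightarrow> 'a set" where
  "reflections W S = {g \<otimes>\<^bsub>W\<^esub> s \<otimes>\<^bsub>W\<^esub> inv\<^bsub>W\<^esub> g | g s. g \<in> carrier W \<and> s \<in> S}"


section \<open>The Cayley graph and its walls\<close>

text \<open>
  Points of the geometric realization of the Cayley graph are given by their barycentric
  coordinates, that is, by functions from the vertices to the reals. If \<open>S\<close> is finite, the graph is
  locally finite, and the topology of pointwise convergence that the function type carries induces
  the usual topology of the graph.
\<close>

definition vertex :: "'a \<Rightarrow> 'a \<Rightarrow> real" where
  "vertex g = (\<lambda>h. if h = g then 1 else 0)"

definition cayley_edge :: "'a \<Rightarrow> 'a \<Rightarrow> ('a \<Rightarrow> real) set" where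
  "cayley_edge g h = {(\<lambda>k. (1 - t) * vertex g k + t * vertex h k) | t. 0 \<le> t \<and> t \<le> 1}"

definition cayley_graph :: "('a, 'b) monoid_scheme \<Rightarrow> 'a set \<Rightarrow> ('a \<Rightarrow> real) set" where
  "cayley_graph W S =
     vertex ` carrier W \<union> (\<Union>g \<in> carrier W. \<Union>s \<in> S. cayley_edge g (g \<otimes>\<^bsub>W\<^esub> s))"

text \<open>Left multiplication, extended affinely to the edges; it maps \<^term>\<open>vertex h\<close> to the vertex
  of the product of \<open>g\<close> and \<open>h\<close>.\<close>

definition translate :: "('a, 'b) monoid_scheme \<Rightarrow> 'a \<Rightarrow> ('a \<Rightarrow> real) \<Rightarrow> ('a \<Rightarrow> real)" where
  "translate W g x = (\<lambda>k. if k \<in> carrier W then x (inv\<^bsub>W\<^esub> g \<otimes>\<^bsub>W\<^esub> k) else 0)"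

definition wall :: "('a, 'b) monoid_scheme \<Rightarrow> 'a set \<Rightarrow> 'a \<Rightarrow> ('a \<Rightarrow> real) set" where
  "wall W S r = {x \<in> cayley_graph W S. translate W r x = x}"

definition walls :: "('a, 'b) monoid_scheme \<Rightarrow> 'a set \<Rightarrow> ('a \<Rightarrow> real) set set" where
  "walls W S = wall W S ` reflections W S"

definition half_spaces ::
  "('a, 'b) monoid_scheme \<Rightarrow> 'a set \<Rightarrow> ('a \<Rightarrow> real) set \<Rightarrow> ('a \<Rightarrow> real) set set" where
  "half_spaces W S V = components (cayley_graph W S - V)"

text \<open>The separated objects are sets of points: a wall, or \<^term>\<open>{vertex g}\<close> for a group
  element \<open>g\<close>. A wall meeting \<open>V\<close> lies in no half-space of \<open>V\<close>.\<close>

definition separates ::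
  "('a, 'b) monoid_scheme \<Rightarrow> 'a set \<Rightarrow> ('a \<Rightarrow> real) set \<Rightarrow> ('a \<Rightarrow> real) set \<Rightarrow> ('a \<Rightarrow> real) set
     \<Rightarrow> bool" where
  "separates W S V A B \<longleftrightarrow>
     (\<exists>H \<in> half_spaces W S V. \<exists>K \<in> half_spaces W S V. H \<noteq> K \<and> A \<subseteq> H \<and> B \<subseteq> K)"

definition close_to ::
  "('a, 'b) monoid_scheme \<Rightarrow> 'a set \<Rightarrow> nat \<Rightarrow> ('a \<Rightarrow> real) set \<Rightarrow> 'a \<Rightarrow> bool" where
  "close_to W S m V g \<longleftrightarrow>
     finite {V' \<in> walls W S. separates W S V' {vertex g} V} \<and>
     card {V' \<in> walls W S. separates W S V' {vertex g} V} \<le> m"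


section \<open>The weak order\<close>

text \<open>Geodesics in the graph between vertices are the edge paths of minimal length, given here by
  their lists of vertices.\<close>

definition edge_path :: "('a, 'b) monoid_scheme \<Rightarrow> 'a set \<Rightarrow> 'a \<Rightarrow> 'a \<Rightarrow> 'a list \<Rightarrow> bool" where
  "edge_path W S g h p \<longleftrightarrow>
     p \<noteq> [] \<and> hd p = g \<and> last p = h \<and> set p \<subseteq> carrier W \<and>
     successively (\<lambda>a b. \<exists>s \<in> S. b = a \<otimes>\<^bsub>W\<^esub> s) p"

definition geodesic :: "('a, 'b) monoid_scheme \<Rightarrow> 'a set \<Rightarrow> 'a \<Rightarrow> 'a \<Rightarrow> 'a list \<Rightarrow> bool" where
  "geodesic W S g h p \<longleftrightarrow>
     edge_path W S g h p \<and> (\<forall>q. edge_path W S g h q \<longrightarrow> length p \<le> length q)"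

definition weak_order :: "('a, 'b) monoid_scheme \<Rightarrow> 'a set \<Rightarrow> 'a gorder" where
  "weak_order W S =
     \<lparr>carrier = carrier W, eq = (=), le = (\<lambda>g h. \<exists>p. geodesic W S \<one>\<^bsub>W\<^esub> h p \<and> g \<in> set p)\<rparr>"


section \<open>Low elements\<close>

definition elementary_walls :: "('a, 'b) monoid_scheme \<Rightarrow> 'a set \<Rightarrow> ('a \<Rightarrow> real) set set" where
  "elementary_walls W S = {V \<in> walls W S. close_to W S 0 V \<one>\<^bsub>W\<^esub>}"

definition shi_parts :: "('a, 'b) monoid_scheme \<Rightarrow> 'a set \<Rightarrow> 'a set set" where
  "shi_parts W S =
     (\<lambda>Y. {g \<in> carrier W. vertex g \<in> Y}) ` components (cayley_graph W S - \<Union> (elementary_walls W S))"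

definition low_elements :: "('a, 'b) monoid_scheme \<Rightarrow> 'a set \<Rightarrow> 'a set" where
  "low_elements W S = {g. \<exists>Y \<in> shi_parts W S. least (weak_order W S) g Y}"


section \<open>Voracious projections\<close>

definition garside_proj :: "('a, 'b) monoid_scheme \<Rightarrow> 'a set \<Rightarrow> 'a set \<Rightarrow> 'a \<Rightarrow> 'a" where
  "garside_proj W S L g = \<Squnion>\<^bsub>weak_order W S\<^esub> {b \<in> L. b \<sqsubseteq>\<^bsub>weak_order W S\<^esub> g}"

definition voracious_proj :: "('a, 'b) monoid_scheme \<Rightarrow> 'a set \<Rightarrow> 'a set \<Rightarrow> 'a \<Rightarrow> 'a" where
  "voracious_proj W S L g = g \<otimes>\<^bsub>W\<^esub> garside_proj W S L (inv\<^bsub>W\<^esub> g)"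

definition op_walls :: "('a, 'b) monoid_scheme \<Rightarrow> 'a set \<Rightarrow> 'a \<Rightarrow> ('a \<Rightarrow> real) set set" where
  "op_walls W S g =
     {V \<in> walls W S. separates W S V {vertex g} {vertex \<one>\<^bsub>W\<^esub>} \<and> close_to W S 0 V g}"

definition op_candidates :: "('a, 'b) monoid_scheme \<Rightarrow> 'a set \<Rightarrow> 'a \<Rightarrow> 'a set" where
  "op_candidates W S g =
     {p \<in> carrier W. p \<sqsubseteq>\<^bsub>weak_order W S\<^esub> g \<and>
        (\<forall>V \<in> op_walls W S g. \<not> separates W S V {vertex p} {vertex \<one>\<^bsub>W\<^esub>})}"

definition op_voracious_proj :: "('a, 'b) monoid_scheme \<Rightarrow> 'a set \<Rightarrow> 'a \<Rightarrow> 'a" where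
  "op_voracious_proj W S g = (THE p. greatest (weak_order W S) p (op_candidates W S g))"

end

theory Submission
  imports Defs
begin

text \<open>
  Write \<open>N(g)\<close> for the set of reflections whose wall separates \<open>g\<close> from \<open>1\<close> (\<open>inversions\<close>
  below). The length of \<open>g\<close> is the cardinality of \<open>N(g)\<close>, and \<open>g\<close> lies below \<open>h\<close> in the weak
  order iff \<open>N(g) \<subseteq> N(h)\<close>. A reflection \<open>r\<close> has an elementary wall iff no reflection \<open>q \<noteq> r\<close>
  satisfies \<open>r \<in> N(g) \<longrightarrow> q \<in> N(g)\<close> for all \<open>g\<close>, and a Shi part consists of the elements \<open>g\<close> that
  agree on which elementary reflections lie in \<open>N(g)\<close>.

  Left multiplication by \<open>g\<^sup>-\<^sup>1\<close> sends the walls that separate \<open>g\<close> from \<open>1\<close> and are \<open>0\<close>-close to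
  \<open>g\<close> to the elementary walls that separate \<open>h = g\<^sup>-\<^sup>1\<close> from \<open>1\<close>, and \<open>p\<close> is a candidate for the
  Osajda--Przytycki projection of \<open>g\<close> iff \<open>q = g\<^sup>-\<^sup>1 p\<close> lies below \<open>h\<close> and in the Shi part of
  \<open>h\<close>. A larger \<open>p\<close> corresponds to a smaller \<open>q\<close>. So the projection is \<open>g m\<close>, where \<open>m\<close> is the
  gate of the Shi part of \<open>h\<close>; this needs that the gate exists (\<open>gate_exists\<close>). The projection
  with respect to the low elements is \<open>g\<close> times the join of the low elements below \<open>h\<close>. The gate
  \<open>m\<close> is one of them, and it lies above all others by \<open>gate_mono\<close>. So the join is \<open>m\<close> as well.

  Both facts about gates follow from a property of rank two residues (\<open>bipodal\<close>). Let \<open>s\<close> and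
  \<open>t\<close> be two right descents of \<open>w\<close>. The reflections that cross the residue \<open>w \<langle>s, t\<rangle>\<close> are \<open>w s
  w\<^sup>-\<^sup>1 = q\<^sub>0, q\<^sub>1, \<dots>, q\<^sub>n\<^sub>-\<^sub>1 = w t w\<^sup>-\<^sup>1\<close>, in the order in which they are met on the way down
  from \<open>w\<close>. The property says that if \<open>q\<^sub>0\<close> is not elementary, then neither is any \<open>q\<^sub>i\<close> with \<open>i
  \<le> n - 2\<close>. It makes the descending paths inside a Shi part locally confluent, hence yields a
  unique minimal element; and it shows that a right descent of an element above a low element
  \<open>b\<close> crosses either an elementary wall or a wall outside \<open>N(b)\<close>.

  The property is proved with roots. In the geometric representation a non-elementary positive
  root is one that dominates another positive root, and dominance amounts to a value at least
  \<open>1\<close> of the bilinear form. If \<open>\<gamma>\<close> is non-elementary, \<open>\<tau>\<close> is a positive root, and the form is \<open>\<le>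
  0\<close> on \<open>\<tau>\<close> and \<open>\<gamma>\<close>, then the image of \<open>\<gamma>\<close> under the reflection of \<open>\<tau>\<close> is non-elementary
  (\<open>nonelementary_reflect\<close>). Applied inside the residue, this settles all \<open>q\<^sub>i\<close> once \<open>q\<^sub>1\<close> is
  settled, and it settles \<open>q\<^sub>1\<close> for odd \<open>n\<close>. For even \<open>n\<close> the root of \<open>q\<^sub>1\<close> is not conjugate to
  that of \<open>q\<^sub>0\<close> in the residue. Then let \<open>\<delta>\<close> be a root dominated by the root of \<open>q\<^sub>0\<close>, and let
  \<open>\<mu>\<close> be the root of the residue that is orthogonal to the root of \<open>q\<^sub>0\<close>. Some root in the plane
  of \<open>\<delta>\<close> and \<open>\<mu>\<close>, or one obtained by a reflection in \<open>\<delta>\<close>, is dominated by the root of \<open>q\<^sub>1\<close>: the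
  roots of that plane form a regular grid of angles, and an estimate of cosines (\<open>angle_grid\<close>)
  finds a suitable angle.
\<close>

section \<open>Crossed reflections and length\<close>

context coxeter_system
begin

abbreviation wprod :: "'a list \<Rightarrow> 'a" where "wprod \<equiv> word_prod W"

text \<open>
  Conjugation. If \<open>r\<close> is a reflection, then so is \<open>cj g r\<close>, and its wall is the translate by \<open>g\<close>
  of the wall of \<open>r\<close>.
\<close>

definition cj :: "'a \<Rightarrow> 'a \<Rightarrow> 'a" where "cj g r = g \<otimes> r \<otimes> inv g"

lemma gen_closed [simp, intro]: "s \<in> S \<Longrightarrow> s \<in> carrier W"
  using gens_closed by auto

lemma gen_sq [simp]: "s \<in> S \<Longrightarrow> s \<otimes> s = \<one>"
  using gens_order_two[of s] pow_ord_eq_1[of s] by (simp add: numeral_2_eq_2)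

lemma gen_inv [simp]: "s \<in> S \<Longrightarrow> inv s = s"
  by (rule inv_equality) auto

lemma gen_neq_one: "s \<in> S \<Longrightarrow> s \<noteq> \<one>"
  using gens_order_two[of s] ord_eq_1[of s] by auto

lemma gen_cancel [simp]:
  assumes "s \<in> S" "g \<in> carrier W"
  shows "g \<otimes> s \<otimes> s = g" "s \<otimes> (s \<otimes> g) = g"
  using assms by (simp_all add: m_assoc) (simp add: m_assoc[symmetric])

lemma wprod_Nil [simp]: "wprod [] = \<one>"
  by (simp add: word_prod_def)

lemma wprod_Cons [simp]: "wprod (s # u) = s \<otimes> wprod u"
  by (simp add: word_prod_def)

lemma wprod_closed [simp, intro]: "set u \<subseteq> S \<Longrightarrow> wprod u \<in> carrier W"
  by (induction u) auto

lemma wprod_append [simp]: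
  "set u \<subseteq> S \<Longrightarrow> set v \<subseteq> S \<Longrightarrow> wprod (u @ v) = wprod u \<otimes> wprod v"
  by (induction u) (auto simp: m_assoc)

lemma ex_word: 
  assumes "g \<in> carrier W"
  obtains u where "set u \<subseteq> S" "wprod u = g"
proof -
  have "g \<in> generate W S" using assms gens_generate by simp
  then have "\<exists>u. set u \<subseteq> S \<and> wprod u = g"
  proof (induction rule: generate.induct)
    case one
    then show ?case by (intro exI[of _ "[]"]) auto
  next
    case (incl h)
    then show ?case by (intro exI[of _ "[h]"]) auto
  next
    case (inv h)
    then show ?case by (intro exI[of _ "[h]"]) auto
  next
    case (eng h1 h2)
    then obtain u v where "set u \<subseteq> S" "wprod u = h1" "set v \<subseteq> S" "wprod v = h2" by blast
    then show ?case by (intro exI[of _ "u @ v"]) auto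
  qed
  then show thesis using that by blast
qed

lemma cj_closed [simp, intro]: "g \<in> carrier W \<Longrightarrow> r \<in> carrier W \<Longrightarrow> cj g r \<in> carrier W"
  by (simp add: cj_def)

lemma cj_one [simp]: "r \<in> carrier W \<Longrightarrow> cj \<one> r = r"
  by (simp add: cj_def)

lemma cj_cj: "g \<in> carrier W \<Longrightarrow> h \<in> carrier W \<Longrightarrow> r \<in> carrier W \<Longrightarrow> cj g (cj h r) = cj (g \<otimes> h) r"
  by (simp add: cj_def m_assoc inv_mult_group)

lemma cj_inv_cj [simp]:
  assumes "g \<in> carrier W" "r \<in> carrier W"
  shows "cj (inv g) (cj g r) = r" "cj g (cj (inv g) r) = r"
  using assms by (simp_all add: cj_cj)

lemma cj_eq_iff:
  "g \<in> carrier W \<Longrightarrow> r \<in> carrier W \<Longrightarrow> q \<in> carrier W \<Longrightarrow> cj g r = q \<longleftrightarrow> r = cj (inv g) q"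
  by (metis cj_inv_cj)

text \<open>
  The reflections whose walls are crossed, in order, by the edge path that starts at \<open>1\<close> and is
  spelled by the word.
\<close>

primrec crossings :: "'a list \<Rightarrow> 'a list" where
  "crossings [] = []"
| "crossings (s # u) = s # map (cj s) (crossings u)"

lemma length_crossings [simp]: "length (crossings u) = length u"
  by (induction u) auto

lemma crossings_closed: "set u \<subseteq> S \<Longrightarrow> set (crossings u) \<subseteq> carrier W"
  by (induction u) auto

lemma crossings_append:
  "set u \<subseteq> S \<Longrightarrow> set v \<subseteq> S \<Longrightarrow> crossings (u @ v) = crossings u @ map (cj (wprod u)) (crossings v)"
proof (induction u)
  case Nil
  then show ?case using crossings_closed[of v] by (auto intro!: map_idI[symmetric])
next
  case (Cons s u)
  then show ?case using crossings_closed[of v] by (auto simp: cj_cj subset_iff)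
qed

lemma count_map_cj:
  "g \<in> carrier W \<Longrightarrow> set l \<subseteq> carrier W \<Longrightarrow> r \<in> carrier W \<Longrightarrow>
    count_list (map (cj g) l) r = count_list l (cj (inv g) r)"
  by (induction l) (auto simp: cj_eq_iff)

text \<open>
  The path along a relator \<open>(s t)\<^sup>m\<close> crosses \<open>2 m\<close> walls, with period \<open>m\<close>. So it crosses each
  wall an even number of times, and the parity of the number of crossings depends only on the
  end point.
\<close>

lemma crossings_alternating:
  assumes "s \<in> S" "t \<in> S"
  shows "crossings (concat (replicate k [s, t])) = map (\<lambda>i. (s \<otimes> t) [^] i \<otimes> s) [0..<2*k]"
proof (induction k)
  case (Suc k)
  let ?x = "s \<otimes> t"
  have x: "?x \<in> carrier W" using assms by auto
  have sx: "s \<otimes> inv ?x = ?x \<otimes> s"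
    using assms by (simp add: inv_mult_group m_assoc)
  have st: "cj s (cj t q) = cj ?x q" if "q \<in> carrier W" for q
    using assms that by (simp add: cj_cj)
  have cx: "cj ?x (?x [^] i \<otimes> s) = ?x [^] (Suc (Suc i)) \<otimes> s" for i
  proof -
    have "cj ?x (?x [^] i \<otimes> s) = ?x \<otimes> ?x [^] i \<otimes> (s \<otimes> inv ?x)"
      using x assms by (simp add: cj_def m_assoc del: nat_pow_Suc)
    also have "\<dots> = ?x [^] (Suc i) \<otimes> (?x \<otimes> s)"
      unfolding sx using x nat_pow_Suc2[OF x, of i] by simp
    also have "\<dots> = ?x [^] (Suc (Suc i)) \<otimes> s"
      using x assms by (simp add: m_assoc)
    finally show ?thesis .
  qed
  have l: "[0..<2 * Suc k] = 0 # 1 # map (\<lambda>i. Suc (Suc i)) [0..<2*k]"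
    by (simp add: upt_conv_Cons map_Suc_upt[symmetric] comp_def del: upt_Suc)
  have "crossings (concat (replicate (Suc k) [s, t]))
      = s # cj s t # map (cj s \<circ> cj t) (map (\<lambda>i. ?x [^] i \<otimes> s) [0..<2*k])"
    using Suc by simp
  also have "map (cj s \<circ> cj t) (map (\<lambda>i. ?x [^] i \<otimes> s) [0..<2*k])
      = map (\<lambda>i. ?x [^] (Suc (Suc i)) \<otimes> s) [0..<2*k]"
    using x assms st cx by (simp del: nat_pow_Suc)
  finally show ?case
    unfolding l using assms x by (simp add: cj_def comp_def)
qed auto

lemma even_count_relator:
  assumes "s \<in> S" "t \<in> S"
  shows "even (count_list (crossings (concat (replicate (ord (s \<otimes> t)) [s, t]))) r)"
proof -
  let ?x = "s \<otimes> t" and ?m = "ord (s \<otimes> t)"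
  let ?f = "\<lambda>i. ?x [^] i \<otimes> s"
  have x: "?x \<in> carrier W" using assms by auto
  have "?f (i + ?m) = ?f i" for i :: nat
    using x by (simp add: nat_pow_mult[symmetric])
  then have 1: "map ?f (map (\<lambda>i. i + ?m) [0..<?m]) = map ?f [0..<?m]"
    by simp
  have 2: "[0..<2 * ?m] = [0..<?m] @ map (\<lambda>i. i + ?m) [0..<?m]"
    by (simp add: map_add_upt upt_add_eq_append[of 0 ?m ?m, simplified] mult_2)
  show ?thesis
    unfolding crossings_alternating[OF assms] 2 map_append 1 by simp
qed

lemma relator_in_lists: "s \<in> S \<Longrightarrow> t \<in> S \<Longrightarrow> set (concat (replicate k [s, t])) \<subseteq> S"
  by (induction k) auto

lemma wprod_relator:
  assumes "s \<in> S" "t \<in> S"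
  shows "wprod (concat (replicate k [s, t])) = (s \<otimes> t) [^] k"
proof (induction k)
  case (Suc k)
  have "wprod (concat (replicate (Suc k) [s, t])) = (s \<otimes> t) \<otimes> (s \<otimes> t) [^] k"
    using Suc assms by (simp add: m_assoc)
  also have "\<dots> = (s \<otimes> t) [^] (Suc k)" 
    using nat_pow_Suc2[of "s \<otimes> t" k] assms by (simp del: nat_pow_Suc)
  finally show ?case .
qed simp

lemma coxeter_step_parity:
  assumes "coxeter_step W S u v" "r \<in> carrier W"
  shows "even (count_list (crossings u) r) = even (count_list (crossings v) r)"
  using assms(1)
proof cases
  case (1 a b s t)
  define z where "z = concat (replicate (ord (s \<otimes> t)) [s, t])"
  have z: "set z \<subseteq> S" unfolding z_def using 1 by (intro relator_in_lists)
  have ab: "set a \<subseteq> S" "set b \<subseteq> S" using 1 by auto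
  have zp: "wprod z = \<one>" using 1 by (simp add: z_def wprod_relator)
  have "set (crossings b) \<subseteq> carrier W" using ab by (intro crossings_closed) auto
  then have m: "map (cj \<one>) (crossings b) = crossings b" by (auto intro!: map_idI)
  have "even (count_list (crossings z) q)" for q
    unfolding z_def by (rule even_count_relator[OF 1(5,6)])
  then have "even (count_list (map (cj (wprod a)) (crossings z)) r)"
    using ab crossings_closed[OF z] assms by (simp add: count_map_cj)
  moreover have "crossings (a @ z @ b) = crossings a @ map (cj (wprod a)) (crossings z @ crossings b)"
    using ab z by (simp add: crossings_append zp m)
  moreover have "crossings (a @ b) = crossings a @ map (cj (wprod a)) (crossings b)"
    using ab by (simp add: crossings_append)
  ultimately show ?thesis using 1 by (simp add: z_def)
qed

lemma word_parity:
  assumes "set u \<subseteq> S" "set v \<subseteq> S" "wprod u = wprod v" "r \<in> carrier W"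
  shows "even (count_list (crossings u) r) = even (count_list (crossings v) r)"
proof -
  have "equivclp (coxeter_step W S) u v" using presentation[of u v] assms by auto
  then show ?thesis
    by (induction rule: equivclp_induct) (auto simp: coxeter_step_parity[OF _ assms(4)])
qed

text \<open>
  The reflections that every path from \<open>1\<close> to \<open>g\<close> crosses an odd number of times, that is, those
  whose walls separate \<open>g\<close> from \<open>1\<close>.
\<close>

definition inversions :: "'a \<Rightarrow> 'a set" where
  "inversions g = {r \<in> carrier W. \<exists>u. set u \<subseteq> S \<and> wprod u = g \<and> odd (count_list (crossings u) r)}"

lemma inversions_wprod:
  "set u \<subseteq> S \<Longrightarrow> r \<in> carrier W \<Longrightarrow> r \<in> inversions (wprod u) \<longleftrightarrow> odd (count_list (crossings u) r)"
  using word_parity unfolding inversions_def by blast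

lemma inversions_carrier: "inversions g \<subseteq> carrier W"
  by (auto simp: inversions_def)

lemma inversions_sub_crossings: "set u \<subseteq> S \<Longrightarrow> inversions (wprod u) \<subseteq> set (crossings u)"
  by (metis (no_types, lifting) inversions_wprod count_notin even_zero inversions_carrier subset_iff)

lemma finite_inversions [simp, intro]: "g \<in> carrier W \<Longrightarrow> finite (inversions g)"
  by (metis ex_word inversions_sub_crossings finite_set finite_subset)

lemma inversions_one [simp]: "inversions \<one> = {}"
  using inversions_sub_crossings[of "[]"] by simp

lemma inversions_gen [simp]: "s \<in> S \<Longrightarrow> inversions s = {s}"
  using inversions_sub_crossings[of "[s]"] inversions_wprod[of "[s]" s] by auto

lemma inversions_mult:
  assumes "g \<in> carrier W" "h \<in> carrier W" "r \<in> carrier W"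
  shows "r \<in> inversions (g \<otimes> h) \<longleftrightarrow> (r \<in> inversions g) \<noteq> (cj (inv g) r \<in> inversions h)"
proof -
  obtain u where u: "set u \<subseteq> S" "wprod u = g" using ex_word assms by blast
  obtain v where v: "set v \<subseteq> S" "wprod v = h" using ex_word assms by blast
  have "wprod (u @ v) = g \<otimes> h" using u v by simp
  then have "r \<in> inversions (g \<otimes> h) \<longleftrightarrow> odd (count_list (crossings (u @ v)) r)"
    using inversions_wprod[of "u @ v" r] u v assms by simp
  also have "\<dots> \<longleftrightarrow> odd (count_list (crossings u) r + count_list (crossings v) (cj (inv g) r))"
    using u v assms crossings_closed by (simp add: crossings_append count_map_cj)
  also have "\<dots> \<longleftrightarrow> (r \<in> inversions g) \<noteq> (cj (inv g) r \<in> inversions h)"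
    using inversions_wprod[OF u(1) assms(3)] inversions_wprod[OF v(1), of "cj (inv g) r"] u v assms
    by (auto simp: even_add)
  finally show ?thesis .
qed

lemma inversions_mult_gen:
  assumes "g \<in> carrier W" "s \<in> S" "r \<in> carrier W"
  shows "r \<in> inversions (g \<otimes> s) \<longleftrightarrow> (r \<in> inversions g) \<noteq> (r = cj g s)"
  using assms by (auto simp: inversions_mult cj_eq_iff)

lemma inversions_inv:
  assumes "g \<in> carrier W" "r \<in> carrier W"
  shows "r \<in> inversions (inv g) \<longleftrightarrow> cj g r \<in> inversions g"
  using inversions_mult[of "inv g" g r] assms by auto

lemma inversions_diff:
  assumes "g \<in> carrier W" "h \<in> carrier W" "r \<in> carrier W"
  shows "r \<in> inversions (inv g \<otimes> h) \<longleftrightarrow> (cj g r \<in> inversions g) \<noteq> (cj g r \<in> inversions h)"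
  using assms by (simp add: inversions_mult inversions_inv)

lemma reflections_cj: "r \<in> reflections W S \<longleftrightarrow> (\<exists>g \<in> carrier W. \<exists>s \<in> S. r = cj g s)"
  by (auto simp: reflections_def cj_def)

lemma reflectionE:
  assumes "r \<in> reflections W S"
  obtains g s where "g \<in> carrier W" "s \<in> S" "r = cj g s"
  using assms by (auto simp: reflections_cj)

lemma cj_reflection [intro]: "g \<in> carrier W \<Longrightarrow> s \<in> S \<Longrightarrow> cj g s \<in> reflections W S"
  by (auto simp: reflections_cj)

lemma reflection_closed [simp, intro]: "r \<in> reflections W S \<Longrightarrow> r \<in> carrier W"
  by (auto elim!: reflectionE)

lemma reflections_cj_closed [intro]: 
  "g \<in> carrier W \<Longrightarrow> r \<in> reflections W S \<Longrightarrow> cj g r \<in> reflections W S"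
proof (elim reflectionE)
  fix h s assume "g \<in> carrier W" "h \<in> carrier W" "s \<in> S" "r = cj h s"
  then show "cj g r \<in> reflections W S" using cj_reflection[of "g \<otimes> h" s] by (simp add: cj_cj)
qed

lemma reflection_sq: "r \<in> reflections W S \<Longrightarrow> r \<otimes> r = \<one>"
  by (auto elim!: reflectionE simp: cj_def m_assoc) (simp add: m_assoc[symmetric])

lemma reflection_inv: "r \<in> reflections W S \<Longrightarrow> inv r = r"
  by (rule inv_equality) (auto simp: reflection_sq)

lemma crossings_reflections: "set u \<subseteq> S \<Longrightarrow> set (crossings u) \<subseteq> reflections W S"
proof (induction u)
  case (Cons s u)
  then show ?case using cj_reflection[of "\<one>" s] by (auto dest!: subsetD)
qed auto

lemma inversions_reflections: "inversions g \<subseteq> reflections W S"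
proof
  fix r assume r: "r \<in> inversions g"
  then obtain u where "set u \<subseteq> S" "g = wprod u" by (auto simp: inversions_def)
  then show "r \<in> reflections W S" 
    using r inversions_sub_crossings crossings_reflections by blast
qed

lemma crossings_nth:
  "set u \<subseteq> S \<Longrightarrow> i < length u \<Longrightarrow> crossings u ! i = cj (wprod (take i u)) (u ! i)"
proof (induction u arbitrary: i)
  case (Cons s u)
  show ?case
  proof (cases i)
    case (Suc j)
    have "set u \<subseteq> S" "set (take j u) \<subseteq> S" using Cons.prems by (auto dest: in_set_takeD)
    moreover have "u ! j \<in> S" using \<open>set u \<subseteq> S\<close> Cons.prems Suc by auto
    ultimately show ?thesis using Cons Suc by (auto simp: cj_cj)
  qed (use Cons in auto)
qed auto

text \<open>
  If a path crosses a wall twice, then the two letters responsible can be deleted.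
\<close>

lemma deletion:
  assumes u: "set u \<subseteq> S" and nd: "\<not> distinct (crossings u)"
  obtains v where "set v \<subseteq> S" "wprod v = wprod u" "length v < length u"
proof -
  obtain i j where ij: "i < j" "j < length u" "crossings u ! i = crossings u ! j"
    using nd by (auto simp: distinct_conv_nth) (metis nat_neq_iff)
  define a s where "a = take i u" and "s = u ! i"
  define b t where "b = take (j - Suc i) (drop (Suc i) u)" and "t = u ! j"
  define c where "c = drop (Suc j) u"
  have d1: "u = a @ s # drop (Suc i) u"
    unfolding a_def s_def using ij by (simp add: id_take_nth_drop)
  have "drop (Suc i) u = b @ t # drop (Suc (j - Suc i)) (drop (Suc i) u)"
    unfolding b_def t_def using ij id_take_nth_drop[of "j - Suc i" "drop (Suc i) u"] by simp
  then have d2: "u = a @ s # b @ t # c" using d1 ij by (simp add: c_def)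
  have la: "length a = i" "length b = j - Suc i" using ij by (auto simp: a_def b_def)
  have S: "set a \<subseteq> S" "set b \<subseteq> S" "set c \<subseteq> S" "s \<in> S" "t \<in> S"
    using u unfolding d2 by auto
  have "j = length (a @ s # b)" using la ij by simp
  then have tj: "take j u = a @ s # b" using d2 by simp
  have "cj (wprod a) s = cj (wprod (a @ s # b)) t"
    using ij u by (simp add: crossings_nth a_def[symmetric] s_def[symmetric] tj t_def[symmetric])
  then have e: "cj (wprod a) s = cj (wprod a \<otimes> s \<otimes> wprod b) t"
    using S by (simp add: m_assoc)
  define x y where "x = wprod a" and "y = wprod b"
  have xy: "x \<in> carrier W" "y \<in> carrier W" using S by (auto simp: x_def y_def)
  have "x \<otimes> s \<otimes> y \<otimes> t = cj (x \<otimes> s \<otimes> y) t \<otimes> (x \<otimes> s \<otimes> y)"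
    using S xy by (simp add: cj_def m_assoc)
  also have "\<dots> = (x \<otimes> s \<otimes> inv x) \<otimes> (x \<otimes> s \<otimes> y)"
    unfolding e[folded x_def y_def, symmetric] by (simp add: cj_def)
  also have "\<dots> = x \<otimes> s \<otimes> (inv x \<otimes> x) \<otimes> s \<otimes> y"
    using S xy by (simp only: m_assoc m_closed inv_closed gen_closed)
  also have "\<dots> = x \<otimes> y" using S xy by simp
  finally have "wprod a \<otimes> s \<otimes> wprod b \<otimes> t = wprod a \<otimes> wprod b" by (simp add: x_def y_def)
  then have "wprod (a @ b @ c) = wprod u"
    unfolding d2 using S by (simp add: m_assoc[symmetric])
  then show thesis using that[of "a @ b @ c"] S d2 by auto
qed

text \<open>
  The length function; \<open>len_le_length\<close> and \<open>reduced_word\<close> show that \<open>len g\<close> is the minimal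
  length of a word for \<open>g\<close>.
\<close>

definition len :: "'a \<Rightarrow> nat" where "len g = card (inversions g)"

lemma len_le_length: "set u \<subseteq> S \<Longrightarrow> len (wprod u) \<le> length u"
  unfolding len_def
  by (metis card_length card_mono finite_set inversions_sub_crossings le_trans length_crossings)

lemma count_list_distinct: "distinct l \<Longrightarrow> x \<in> set l \<Longrightarrow> count_list l x = 1"
  by (induction l) auto

lemma inversions_distinct: 
  "set u \<subseteq> S \<Longrightarrow> distinct (crossings u) \<Longrightarrow> inversions (wprod u) = set (crossings u)"
  using inversions_sub_crossings[of u] crossings_closed[of u]
  by (fastforce simp: inversions_wprod count_list_distinct)

lemma reduced_word:
  assumes "g \<in> carrier W"
  obtains u where "set u \<subseteq> S" "wprod u = g" "length u = len g" "distinct (crossings u)"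
    "set (crossings u) = inversions g"
proof -
  let ?P = "\<lambda>n. \<exists>u. set u \<subseteq> S \<and> wprod u = g \<and> length u = n"
  have "\<exists>n. ?P n" using ex_word assms by metis
  then have "?P (LEAST n. ?P n)" by (rule LeastI_ex)
  then obtain u where u: "set u \<subseteq> S" "wprod u = g" "length u = (LEAST n. ?P n)" by blast
  have "distinct (crossings u)"
  proof (rule ccontr)
    assume "\<not> ?thesis"
    then obtain v where "set v \<subseteq> S" "wprod v = g" "length v < length u"
      using deletion u by metis
    then show False using not_less_Least[of "length v" ?P] u by auto
  qed
  moreover from this have "set (crossings u) = inversions g"
    using inversions_distinct[of u] u by simp
  ultimately show thesis
    using that u distinct_card[of "crossings u"] by (simp add: len_def)
qed

lemma reduced_iff:
  assumes "set u \<subseteq> S" "length u = len (wprod u)"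
  shows "distinct (crossings u)" "set (crossings u) = inversions (wprod u)"
proof -
  have "card (inversions (wprod u)) \<le> card (set (crossings u))"
    using inversions_sub_crossings assms by (intro card_mono) auto
  then have "card (set (crossings u)) = length (crossings u)"
    using assms card_length[of "crossings u"] by (simp add: len_def)
  then show "distinct (crossings u)" by (rule card_distinct)
  then show "set (crossings u) = inversions (wprod u)" using inversions_distinct assms by simp
qed

lemma inversions_empty_iff:
  assumes "g \<in> carrier W" shows "inversions g = {} \<longleftrightarrow> g = \<one>"
proof
  assume "inversions g = {}"
  then show "g = \<one>" using reduced_word[OF assms] by (metis card.empty len_def length_0_conv wprod_Nil)
qed simp

lemma inversions_inj:
  assumes "g \<in> carrier W" "h \<in> carrier W" "inversions g = inversions h"
  shows "g = h"
proof -
  have "inversions (inv g \<otimes> h) = {}"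
    using assms inversions_carrier[of "inv g \<otimes> h"] by (auto simp: inversions_diff)
  then have "inv g \<otimes> h = \<one>" using assms by (simp add: inversions_empty_iff)
  then show ?thesis using assms by (metis inv_closed inv_equality inv_inv)
qed

lemma up_gen:
  assumes "g \<in> carrier W" "s \<in> S" "cj g s \<notin> inversions g"
  shows "inversions (g \<otimes> s) = insert (cj g s) (inversions g)" "len (g \<otimes> s) = Suc (len g)"
proof -
  show e: "inversions (g \<otimes> s) = insert (cj g s) (inversions g)"
    using assms inversions_carrier[of g] inversions_carrier[of "g \<otimes> s"] 
      inversions_mult_gen[OF assms(1,2)] by blast
  show "len (g \<otimes> s) = Suc (len g)" 
    unfolding len_def e using assms by simp
qed

text \<open>
  The reflection that maps \<open>g\<close> to \<open>g s\<close> is \<open>cj g s\<close>. So \<open>s\<close> is a right descent of \<open>g\<close> iff \<open>cj g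
  s\<close> is an inversion of \<open>g\<close>.
\<close>

lemma down_gen:
  assumes "g \<in> carrier W" "s \<in> S" "cj g s \<in> inversions g"
  shows "inversions (g \<otimes> s) = inversions g - {cj g s}" "len g = Suc (len (g \<otimes> s))"
proof -
  show e: "inversions (g \<otimes> s) = inversions g - {cj g s}"
    using assms inversions_carrier[of g] inversions_carrier[of "g \<otimes> s"] 
      inversions_mult_gen[OF assms(1,2)] by blast
  show "len g = Suc (len (g \<otimes> s))" 
    unfolding len_def e using assms by (metis card_Suc_Diff1 finite_inversions)
qed

lemma down_step:
  assumes g: "g \<in> carrier W" and h: "h \<in> carrier W"
    and sub: "inversions g \<subset> inversions h"
  obtains s where "s \<in> S" "cj h s \<in> inversions h" "cj h s \<notin> inversions g"
proof -
  let ?x = "inv h \<otimes> g"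
  have "?x \<in> carrier W" using g h by simp
  then obtain u where u: "set u \<subseteq> S" "wprod u = ?x" "length u = len ?x"
    "distinct (crossings u)" "set (crossings u) = inversions ?x"
    by (rule reduced_word)
  have "u \<noteq> []"
  proof
    assume "u = []"
    then have "inversions ?x = {}" using u by auto
    then have "?x = \<one>" using g h by (simp add: inversions_empty_iff)
    then have "g = h" using g h by (metis inv_closed inv_equality inv_inv)
    then show False using sub by simp
  qed
  then obtain s v where su: "u = s # v" by (cases u) auto
  then have s: "s \<in> S" "s \<in> inversions ?x" using u by auto
  then have "(cj h s \<in> inversions h) \<noteq> (cj h s \<in> inversions g)"
    using g h by (simp add: inversions_diff)
  then show thesis using that s sub by blast
qed

lemma len_mult_of_subset:
  assumes g: "g \<in> carrier W" and h: "h \<in> carrier W"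
    and sub: "inversions g \<subseteq> inversions h"
  shows "len h = len g + len (inv g \<otimes> h)"
proof -
  let ?x = "inv g \<otimes> h"
  have x: "inversions ?x \<subseteq> carrier W" by (rule inversions_carrier)
  have "cj g ` inversions ?x = inversions h - inversions g"
  proof (intro equalityI subsetI)
    fix r assume "r \<in> inversions h - inversions g"
    then have r: "r \<in> carrier W" "r \<in> inversions h" "r \<notin> inversions g" 
      using inversions_carrier by blast+
    then have "cj (inv g) r \<in> inversions ?x" using g h by (simp add: inversions_diff)
    then show "r \<in> cj g ` inversions ?x" using r g by (intro image_eqI[of _ _ "cj (inv g) r"]) auto
  next
    fix r assume "r \<in> cj g ` inversions ?x"
    then obtain q where q: "q \<in> inversions ?x" "r = cj g q" by blast
    then show "r \<in> inversions h - inversions g"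
      using inversions_diff[OF g h, of q] x sub by auto
  qed
  moreover have "inj_on (cj g) (inversions ?x)"
    using x g by (intro inj_on_inverseI[of _ "cj (inv g)"]) auto
  ultimately have "len ?x = card (inversions h - inversions g)"
    unfolding len_def by (metis card_image)
  then show ?thesis
    using sub h g card_mono[of "inversions h" "inversions g"] by (simp add: len_def card_Diff_subset)
qed

lemma reflection_in_own_inversions:
  assumes "r \<in> reflections W S" shows "r \<in> inversions r"
proof -
  obtain g s where gs: "g \<in> carrier W" "s \<in> S" "r = cj g s" using assms by (rule reflectionE)
  have "r \<in> inversions (g \<otimes> (s \<otimes> inv g)) \<longleftrightarrow> (r \<in> inversions g) \<noteq> (s \<in> inversions (s \<otimes> inv g))"
    using gs by (simp add: inversions_mult)
  moreover have "s \<in> inversions (s \<otimes> inv g) \<longleftrightarrow> r \<notin> inversions g"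
    using gs by (simp add: inversions_mult inversions_inv) (simp add: cj_def)
  moreover have "r = g \<otimes> (s \<otimes> inv g)" using gs by (simp add: cj_def m_assoc)
  ultimately show ?thesis by auto
qed

lemma reflection_neq_one: "r \<in> reflections W S \<Longrightarrow> r \<noteq> \<one>"
  using reflection_in_own_inversions by fastforce

end

section \<open>The geometric representation\<close>

text \<open>
  Chebyshev polynomials of the second kind at \<open>q\<close>, shifted by one: \<open>sin (k a) / sin a\<close> at \<open>q =
  cos a\<close>, and \<open>k\<close> at \<open>q = 1\<close>.
\<close>

fun chebyshev :: "real \<Rightarrow> nat \<Rightarrow> real" where
  "chebyshev q 0 = 0"
| "chebyshev q (Suc 0) = 1"
| "chebyshev q (Suc (Suc k)) = 2 * q * chebyshev q (Suc k) - chebyshev q k"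

lemma chebyshev_one: "chebyshev 1 k = real k"
  by (induction "1::real" k rule: chebyshev.induct) auto

lemma chebyshev_cos: "sin a * chebyshev (cos a) k = sin (real k * a)"
proof (induction "cos a" k rule: chebyshev.induct)
  case (3 k)
  have "sin (real (Suc (Suc k)) * a) + sin (real k * a) = 2 * cos a * sin (real (Suc k) * a)"
  proof -
    have "real (Suc (Suc k)) * a = real (Suc k) * a + a" "real k * a = real (Suc k) * a - a"
      by (auto simp: algebra_simps)
    then show ?thesis by (simp only: sin_add sin_diff) (simp add: algebra_simps)
  qed
  then show ?case using 3 by (simp add: algebra_simps)
qed auto

locale coxeter_finite_rank = coxeter_system +
  assumes finS [simp, intro]: "finite S"
begin

text \<open>
  The Gram matrix of the simple roots. The order of \<open>s t\<close> is \<open>0\<close> if it is infinite; then the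
  entry is \<open>- 1\<close>.
\<close>

definition gram :: "'a \<Rightarrow> 'a \<Rightarrow> real" where
  "gram s t = (if s = t then 1 else if ord (s \<otimes> t) = 0 then - 1
     else - cos (pi / real (ord (s \<otimes> t))))"

text \<open>
  Vectors are functions on the group, read as coordinates with respect to the simple roots \<open>\<alpha>
  s\<close>. The form \<open>B\<close> and the function \<open>ht\<close> use only the coordinates in \<open>S\<close>.
\<close>

definition B :: "('a \<Rightarrow> real) \<Rightarrow> ('a \<Rightarrow> real) \<Rightarrow> real" where
  "B u v = (\<Sum>s\<in>S. \<Sum>t\<in>S. gram s t * u s * v t)"

definition \<alpha> :: "'a \<Rightarrow> 'a \<Rightarrow> real" where
  "\<alpha> s = (\<lambda>x. if x = s then 1 else 0)"

text \<open>
  The orthogonal reflection in the hyperplane of a vector \<open>\<beta>\<close> with \<open>B \<beta> \<beta> = 1\<close>.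
\<close>

definition reflect :: "('a \<Rightarrow> real) \<Rightarrow> ('a \<Rightarrow> real) \<Rightarrow> 'a \<Rightarrow> real" where
  "reflect \<beta> v = (\<lambda>x. v x - 2 * B \<beta> v * \<beta> x)"

text \<open>
  The sum of the coordinates. It is positive on positive roots and negative on negative roots.
\<close>

definition ht :: "('a \<Rightarrow> real) \<Rightarrow> real" where
  "ht v = (\<Sum>s\<in>S. v s)"

lemma gram_sym: "s \<in> S \<Longrightarrow> t \<in> S \<Longrightarrow> gram s t = gram t s"
  using ord_inv[of "s \<otimes> t"] by (simp add: gram_def inv_mult_group)

lemma B_sym: "B u v = B v u"
  unfolding B_def by (subst sum.swap, intro sum.cong refl) (simp add: gram_sym)

lemma B_left [simp]:
  "B (\<lambda>x. u x + v x) w = B u w + B v w"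
  "B (\<lambda>x. u x - v x) w = B u w - B v w"
  "B (\<lambda>x. - u x) w = - B u w"
  "B (\<lambda>x. c * u x) w = c * B u w"
  "B (\<lambda>x. u x / c) w = B u w / c"
  unfolding B_def
  by (simp_all add: algebra_simps sum.distrib sum_subtractf sum_distrib_left sum_negf sum_divide_distrib)

lemma B_right [simp]:
  "B w (\<lambda>x. u x + v x) = B w u + B w v"
  "B w (\<lambda>x. u x - v x) = B w u - B w v"
  "B w (\<lambda>x. - u x) = - B w u"
  "B w (\<lambda>x. c * u x) = c * B w u"
  "B w (\<lambda>x. u x / c) = B w u / c"
  by (simp_all add: B_sym[of w])

lemma ht_lin [simp]:
  "ht (\<lambda>x. u x + v x) = ht u + ht v"
  "ht (\<lambda>x. u x - v x) = ht u - ht v"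
  "ht (\<lambda>x. - u x) = - ht u"
  "ht (\<lambda>x. c * u x) = c * ht u"
  "ht (\<lambda>x. u x / c) = ht u / c"
  unfolding ht_def by (simp_all add: sum.distrib sum_subtractf sum_distrib_left sum_negf sum_divide_distrib)

lemma reflect_lin [simp]:
  "reflect \<beta> (\<lambda>x. u x + v x) = (\<lambda>x. reflect \<beta> u x + reflect \<beta> v x)"
  "reflect \<beta> (\<lambda>x. u x - v x) = (\<lambda>x. reflect \<beta> u x - reflect \<beta> v x)"
  "reflect \<beta> (\<lambda>x. - u x) = (\<lambda>x. - reflect \<beta> u x)"
  "reflect \<beta> (\<lambda>x. c * u x) = (\<lambda>x. c * reflect \<beta> u x)"
  "reflect \<beta> (\<lambda>x. u x / c) = (\<lambda>x. reflect \<beta> u x / c)"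
  unfolding reflect_def by (auto simp: algebra_simps add_divide_distrib diff_divide_distrib)

lemma reflect_self: "B \<beta> \<beta> = 1 \<Longrightarrow> reflect \<beta> \<beta> = (\<lambda>x. - \<beta> x)"
  by (auto simp: reflect_def)

lemma reflect_reflect: "B \<beta> \<beta> = 1 \<Longrightarrow> reflect \<beta> (reflect \<beta> v) = v"
  by (auto simp: reflect_def)

lemma B_reflect_reflect: "B \<beta> \<beta> = 1 \<Longrightarrow> B (reflect \<beta> u) (reflect \<beta> v) = B u v"
  unfolding reflect_def B_left B_right by (simp add: B_sym[of u \<beta>] algebra_simps)

lemma reflect_uminus [simp]: "reflect (\<lambda>x. - \<beta> x) v = reflect \<beta> v"
  by (simp add: reflect_def)

lemma B_\<alpha> [simp]:
  assumes "s \<in> S" "t \<in> S" shows "B (\<alpha> s) (\<alpha> t) = gram s t"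
proof -
  have "B (\<alpha> s) (\<alpha> t) = (\<Sum>s'\<in>S. if s' = s then gram s' t else 0)"
    unfolding B_def \<alpha>_def using assms by (intro sum.cong refl) (simp add: if_distrib cong: if_cong)
  then show ?thesis using assms by simp
qed

lemma gram_self [simp]: "gram s s = 1"
  by (simp add: gram_def)

lemma ht_\<alpha> [simp]: "s \<in> S \<Longrightarrow> ht (\<alpha> s) = 1"
  by (simp add: ht_def \<alpha>_def)

text \<open>
  The vector at angle \<open>\<theta>\<close> on the unit circle of the plane with orthonormal basis \<open>e\<close>, \<open>f\<close>.
\<close>

definition circ :: "('a \<Rightarrow> real) \<Rightarrow> ('a \<Rightarrow> real) \<Rightarrow> real \<Rightarrow> 'a \<Rightarrow> real" where
  "circ e f \<theta> = (\<lambda>x. cos \<theta> * e x + sin \<theta> * f x)"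

definition orthonormal :: "('a \<Rightarrow> real) \<Rightarrow> ('a \<Rightarrow> real) \<Rightarrow> bool" where
  "orthonormal e f \<longleftrightarrow> B e e = 1 \<and> B f f = 1 \<and> B e f = 0"

lemma B_circ:
  assumes "orthonormal e f"
  shows "B (circ e f \<theta>) (circ e f \<phi>) = cos (\<theta> - \<phi>)"
  using assms by (simp add: circ_def orthonormal_def B_sym[of f e] cos_diff)

lemma circ_add_pi: "circ e f (\<theta> + pi) = (\<lambda>x. - circ e f \<theta> x)"
  by (auto simp: circ_def)

lemma circ_pi_add: "circ e f (pi + \<theta>) = (\<lambda>x. - circ e f \<theta> x)"
  by (auto simp: circ_def)

lemma circ_add_2pi: "circ e f (\<theta> + 2 * pi) = circ e f \<theta>"
  by (auto simp: circ_def)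

lemma reflect_circ:
  assumes "orthonormal e f"
  shows "reflect (circ e f \<theta>) (circ e f \<phi>) = (\<lambda>x. - circ e f (2 * \<theta> - \<phi>) x)"
proof
  fix x
  have 1: "cos \<phi> - 2 * cos (\<theta> - \<phi>) * cos \<theta> = - cos (2 * \<theta> - \<phi>)"
  proof -
    have "cos \<phi> = cos (\<theta> - (\<theta> - \<phi>))" "cos (2 * \<theta> - \<phi>) = cos (\<theta> + (\<theta> - \<phi>))"
      by (simp_all add: algebra_simps)
    then show ?thesis by (simp only: cos_add cos_diff[of \<theta> "\<theta> - \<phi>"]) (simp add: algebra_simps)
  qed
  have 2: "sin \<phi> - 2 * cos (\<theta> - \<phi>) * sin \<theta> = - sin (2 * \<theta> - \<phi>)"
  proof -
    have "sin \<phi> = sin (\<theta> - (\<theta> - \<phi>))" "sin (2 * \<theta> - \<phi>) = sin (\<theta> + (\<theta> - \<phi>))"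
      by (simp_all add: algebra_simps)
    then show ?thesis by (simp only: sin_add sin_diff[of \<theta> "\<theta> - \<phi>"]) (simp add: algebra_simps)
  qed
  have "reflect (circ e f \<theta>) (circ e f \<phi>) x = (cos \<phi> - 2 * cos (\<theta> - \<phi>) * cos \<theta>) * e x
      + (sin \<phi> - 2 * cos (\<theta> - \<phi>) * sin \<theta>) * f x"
    unfolding reflect_def B_circ[OF assms] by (simp add: circ_def algebra_simps)
  then show "reflect (circ e f \<theta>) (circ e f \<phi>) x = - circ e f (2 * \<theta> - \<phi>) x"
    unfolding 1 2 by (simp add: circ_def)
qed

text \<open>
  If \<open>\<beta>\<close> and \<open>\<gamma>\<close> are unit vectors with \<open>B \<beta> \<gamma> = - cos a\<close>, then this vector completes \<open>\<beta>\<close> to an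
  orthonormal basis of their plane, so that \<open>\<beta>\<close> is at angle \<open>0\<close> and \<open>\<gamma>\<close> at angle \<open>\<pi> - a\<close>.
\<close>

definition perp_vec :: "real \<Rightarrow> ('a \<Rightarrow> real) \<Rightarrow> ('a \<Rightarrow> real) \<Rightarrow> 'a \<Rightarrow> real" where
  "perp_vec a \<beta> \<gamma> = (\<lambda>x. (\<gamma> x + cos a * \<beta> x) / sin a)"

lemma plane_of_pair:
  assumes "B \<beta> \<beta> = 1" "B \<gamma> \<gamma> = 1" "B \<beta> \<gamma> = - cos a" "sin a \<noteq> 0"
  shows "orthonormal \<beta> (perp_vec a \<beta> \<gamma>)" "circ \<beta> (perp_vec a \<beta> \<gamma>) 0 = \<beta>" "circ \<beta> (perp_vec a \<beta> \<gamma>) (pi - a) = \<gamma>"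
proof -
  have "1 - cos a * cos a = sin a * sin a"
    using sin_cos_squared_add[of a] by (simp add: power2_eq_square)
  then show "orthonormal \<beta> (perp_vec a \<beta> \<gamma>)"
    using assms B_sym[of \<gamma> \<beta>] by (simp add: orthonormal_def perp_vec_def)
qed (use assms in \<open>auto simp: circ_def perp_vec_def\<close>)

lemma rotation_power:
  assumes on: "orthonormal e f" and v: "B e v = 0" "B f v = 0"
    and \<beta>: "\<beta> = circ e f 0" and \<gamma>: "\<gamma> = circ e f (pi - a)"
  shows "((\<lambda>w. reflect \<beta> (reflect \<gamma> w)) ^^ k) (\<lambda>x. v x + R * circ e f \<phi> x)
    = (\<lambda>x. v x + R * circ e f (\<phi> + 2 * real k * a) x)"
proof (induction k)
  case (Suc k)
  have fx: "reflect (circ e f \<theta>) v = v" for \<theta>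
    using v by (simp add: reflect_def) (simp add: circ_def)
  have "circ e f (2 * 0 - (2 * (pi - a) - \<psi>)) = circ e f (\<psi> + 2 * a)" for \<psi>
    using circ_add_2pi[of e f "2 * 0 - (2 * (pi - a) - \<psi>)"] by (simp add: algebra_simps)
  then have "reflect \<beta> (reflect \<gamma> (\<lambda>x. v x + R * circ e f \<psi> x)) = (\<lambda>x. v x + R * circ e f (\<psi> + 2 * a) x)" for \<psi>
    unfolding \<beta> \<gamma> by (simp add: fx reflect_circ[OF on])
  then show ?case using Suc by (simp add: algebra_simps)
qed simp

text \<open>
  The product of the reflections in two vectors at angle \<open>\<pi> - \<pi>/m\<close> rotates their plane by \<open>2
  \<pi>/m\<close> and fixes its orthogonal complement. This is the relation \<open>(s t)\<^sup>m = 1\<close>.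
\<close>

lemma rotation_order:
  assumes "B \<beta> \<beta> = 1" "B \<gamma> \<gamma> = 1" "B \<beta> \<gamma> = - cos (pi / real m)" "m \<ge> 2"
  shows "((\<lambda>w. reflect \<beta> (reflect \<gamma> w)) ^^ m) v = v"
proof -
  define a where "a = pi / real m"
  have "0 < a" "a < pi" using assms(4) by (auto simp: a_def field_simps)
  then have "sin a \<noteq> 0" using sin_gt_zero by force
  define f where "f = perp_vec a \<beta> \<gamma>"
  have p: "orthonormal \<beta> f" "circ \<beta> f 0 = \<beta>" "circ \<beta> f (pi - a) = \<gamma>"
    unfolding f_def using plane_of_pair[of \<beta> \<gamma> a] assms \<open>sin a \<noteq> 0\<close> by (auto simp: a_def)
  obtain R \<phi> where R: "B \<beta> v = R * cos \<phi>" "B f v = R * sin \<phi>" using polar_Ex by metis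
  define v0 where "v0 = (\<lambda>x. v x - R * circ \<beta> f \<phi> x)"
  have v0: "B \<beta> v0 = 0" "B f v0 = 0" 
    using R p(1) by (simp_all add: v0_def circ_def orthonormal_def B_sym[of f \<beta>])
  have v: "v = (\<lambda>x. v0 x + R * circ \<beta> f \<phi> x)" by (simp add: v0_def)
  have e: "\<phi> + 2 * real m * a = \<phi> + 2 * pi" using assms(4) by (simp add: a_def)
  show ?thesis
    using rotation_power[OF p(1) v0 p(2)[symmetric] p(3)[symmetric], of m R \<phi>]
    unfolding e circ_add_2pi v[symmetric] .
qed

text \<open>
  The composition of the simple reflections along a word.
\<close>

definition word_action :: "'a list \<Rightarrow> ('a \<Rightarrow> real) \<Rightarrow> 'a \<Rightarrow> real" where
  "word_action u = foldr (\<lambda>s. reflect (\<alpha> s)) u"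

lemma word_action_simps [simp]:
  "word_action [] = id" "word_action (s # u) v = reflect (\<alpha> s) (word_action u v)" "word_action (u @ w) v = word_action u (word_action w v)"
  by (auto simp: word_action_def)

lemma ord_gens_ge_2:
  assumes "s \<in> S" "t \<in> S" "s \<noteq> t" "ord (s \<otimes> t) \<noteq> 0"
  shows "ord (s \<otimes> t) \<ge> 2"
proof -
  have "ord (s \<otimes> t) \<noteq> 1"
    using assms by (metis gen_inv gen_closed inv_equality inv_inv m_closed ord_eq_1)
  then show ?thesis using assms by linarith
qed

lemma word_action_relator:
  assumes "s \<in> S" "t \<in> S"
  shows "word_action (concat (replicate (ord (s \<otimes> t)) [s, t])) v = v"
proof -
  have k: "word_action (concat (replicate k [s, t])) v = ((\<lambda>w. reflect (\<alpha> s) (reflect (\<alpha> t) w)) ^^ k) v" for k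
    by (induction k) auto
  show ?thesis
  proof (cases "s = t")
    case True
    have "((\<lambda>w. reflect (\<alpha> s) (reflect (\<alpha> s) w)) ^^ k) v = v" for k
      using assms by (induction k) (auto simp: reflect_reflect)
    then show ?thesis using k True by simp
  next
    case False
    show ?thesis
    proof (cases "ord (s \<otimes> t) = 0")
      case F: False
      then show ?thesis
        unfolding k using assms False ord_gens_ge_2 by (intro rotation_order) (auto simp: gram_def)
    qed simp
  qed
qed

lemma word_action_step: "coxeter_step W S u v \<Longrightarrow> word_action u = word_action v"
  by (erule coxeter_step.cases) (auto simp: word_action_relator fun_eq_iff)

lemma word_action_cong:
  assumes "set u \<subseteq> S" "set v \<subseteq> S" "wprod u = wprod v"
  shows "word_action u = word_action v"
proof -
  have "equivclp (coxeter_step W S) u v" using presentation[of u v] assms by auto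
  then show ?thesis
    by (induction rule: equivclp_induct) (auto dest: word_action_step)
qed

text \<open>
  The action of \<open>W\<close>: any word for \<open>g\<close> gives the same linear map, by \<open>word_action_cong\<close>.
\<close>

definition act :: "'a \<Rightarrow> ('a \<Rightarrow> real) \<Rightarrow> 'a \<Rightarrow> real" where
  "act g = word_action (SOME u. set u \<subseteq> S \<and> wprod u = g)"

lemma act_wprod:
  assumes "set u \<subseteq> S" shows "act (wprod u) = word_action u"
proof -
  let ?P = "\<lambda>v. set v \<subseteq> S \<and> wprod v = wprod u"
  have "?P (SOME v. ?P v)" using assms by (intro someI[of ?P u]) auto
  then show ?thesis unfolding act_def by (intro word_action_cong assms) blast+
qed

lemma act_one [simp]: "act \<one> v = v"
  using act_wprod[of "[]"] by simp

lemma act_gen [simp]: "s \<in> S \<Longrightarrow> act s v = reflect (\<alpha> s) v"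
  using act_wprod[of "[s]"] by simp

lemma act_mult:
  assumes "g \<in> carrier W" "h \<in> carrier W"
  shows "act (g \<otimes> h) v = act g (act h v)"
proof -
  obtain u where u: "set u \<subseteq> S" "wprod u = g" using ex_word assms by blast
  obtain w where w: "set w \<subseteq> S" "wprod w = h" using ex_word assms by blast
  show ?thesis using act_wprod[of u] act_wprod[of w] act_wprod[of "u @ w"] u w by simp
qed

lemma act_inv [simp]:
  assumes "g \<in> carrier W" shows "act (inv g) (act g v) = v" "act g (act (inv g) v) = v"
  using assms by (simp_all add: act_mult[symmetric])

lemma word_action_lin:
  "word_action w (\<lambda>x. u x + v x) = (\<lambda>x. word_action w u x + word_action w v x)"
  "word_action w (\<lambda>x. u x - v x) = (\<lambda>x. word_action w u x - word_action w v x)"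
  "word_action w (\<lambda>x. - u x) = (\<lambda>x. - word_action w u x)"
  "word_action w (\<lambda>x. c * u x) = (\<lambda>x. c * word_action w u x)"
  "word_action w (\<lambda>x. u x / c) = (\<lambda>x. word_action w u x / c)"
  by (induction w) auto

lemma act_lin [simp]:
  "act g (\<lambda>x. u x + v x) = (\<lambda>x. act g u x + act g v x)"
  "act g (\<lambda>x. u x - v x) = (\<lambda>x. act g u x - act g v x)"
  "act g (\<lambda>x. - u x) = (\<lambda>x. - act g u x)"
  "act g (\<lambda>x. c * u x) = (\<lambda>x. c * act g u x)"
  "act g (\<lambda>x. u x / c) = (\<lambda>x. act g u x / c)"
  by (simp_all add: act_def word_action_lin)

lemma B_word_action: "set w \<subseteq> S \<Longrightarrow> B (word_action w u) (word_action w v) = B u v"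
  by (induction w) (auto simp: B_reflect_reflect)

lemma B_act [simp]: "g \<in> carrier W \<Longrightarrow> B (act g u) (act g v) = B u v"
  by (metis B_word_action act_wprod ex_word)

lemma act_reflect: "g \<in> carrier W \<Longrightarrow> act g (reflect \<beta> v) = reflect (act g \<beta>) (act g v)"
  unfolding reflect_def by simp

section \<open>Positivity of roots\<close>

text \<open>
  The product \<open>s t s \<cdots>\<close> with \<open>k\<close> factors.
\<close>

primrec alt_prod :: "'a \<Rightarrow> 'a \<Rightarrow> nat \<Rightarrow> 'a" where
  "alt_prod s t 0 = \<one>"
| "alt_prod s t (Suc k) = alt_prod s t k \<otimes> (if even k then s else t)"

lemma alt_prod_closed [simp, intro]: "s \<in> S \<Longrightarrow> t \<in> S \<Longrightarrow> alt_prod s t k \<in> carrier W"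
  by (induction k) auto

lemma gen_inv_pow:
  assumes "s \<in> S" "t \<in> S"
  shows "s \<otimes> inv ((s \<otimes> t) [^] (j::nat)) = (s \<otimes> t) [^] j \<otimes> s"
proof (induction j)
  case (Suc j)
  let ?x = "s \<otimes> t"
  have x: "?x \<in> carrier W" using assms by auto
  have "s \<otimes> inv (?x [^] Suc j) = s \<otimes> inv ?x \<otimes> inv (?x [^] j)"
    using assms x by (simp add: inv_mult_group m_assoc)
  also have "s \<otimes> inv ?x = ?x \<otimes> s" using assms by (simp add: inv_mult_group m_assoc)
  also have "?x \<otimes> s \<otimes> inv (?x [^] j) = ?x \<otimes> (?x [^] j \<otimes> s)"
    using x assms by (simp add: m_assoc Suc)
  also have "\<dots> = ?x [^] Suc j \<otimes> s"
    using x assms nat_pow_Suc2[OF x, of j] by (simp add: m_assoc)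
  finally show ?case .
qed (use assms in simp)

lemma alt_prod_eq:
  assumes "s \<in> S" "t \<in> S"
  shows "alt_prod s t k = (s \<otimes> t) [^] (k div 2) \<otimes> (if even k then \<one> else s)"
  using assms by (induction k) (auto simp: m_assoc)

lemma cj_alt_prod:
  assumes "s \<in> S" "t \<in> S"
  shows "cj (alt_prod s t k) (if even k then s else t) = (s \<otimes> t) [^] k \<otimes> s"
proof (cases "even k")
  case True
  then obtain j where k: "k = 2 * j" by (auto elim: evenE)
  have "cj (alt_prod s t k) s = (s \<otimes> t) [^] j \<otimes> (s \<otimes> inv ((s \<otimes> t) [^] j))"
    using assms k by (simp add: alt_prod_eq cj_def m_assoc)
  also have "\<dots> = (s \<otimes> t) [^] k \<otimes> s"
    using assms unfolding gen_inv_pow[OF assms] by (simp add: m_assoc[symmetric] nat_pow_mult k mult_2)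
  finally show ?thesis using True by simp
next
  case False
  then obtain j where k: "k = Suc (2 * j)" by (auto elim: oddE)
  have "cj (alt_prod s t k) t = (s \<otimes> t) [^] j \<otimes> s \<otimes> t \<otimes> (s \<otimes> inv ((s \<otimes> t) [^] j))"
    using assms k by (simp add: alt_prod_eq cj_def m_assoc inv_mult_group)
  also have "\<dots> = (s \<otimes> t) [^] j \<otimes> (s \<otimes> t) \<otimes> (s \<otimes> t) [^] j \<otimes> s"
    using assms unfolding gen_inv_pow[OF assms] by (simp add: m_assoc)
  also have "\<dots> = (s \<otimes> t) [^] (Suc j + j) \<otimes> s"
    using assms nat_pow_mult[of "s \<otimes> t" "Suc j" j] by simp
  finally show ?thesis using False k by (simp add: mult_2)
qed

lemma pow_ord_minus_one:
  assumes "s \<in> S" "t \<in> S" "ord (s \<otimes> t) > 0"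
  shows "(s \<otimes> t) [^] (ord (s \<otimes> t) - 1) \<otimes> s = t"
proof -
  let ?x = "s \<otimes> t" and ?m = "ord (s \<otimes> t)"
  have x: "?x \<in> carrier W" using assms by auto
  have "?x [^] (?m - 1) \<otimes> ?x = ?x [^] (Suc (?m - 1))" by simp
  also have "\<dots> = \<one>" using assms x by (simp del: nat_pow_Suc)
  finally have "?x [^] (?m - 1) \<otimes> ?x \<otimes> t = t" using assms by simp
  then show ?thesis using assms by (simp add: m_assoc)
qed

text \<open>
  The coordinates of the image of a simple root under an alternating product of two simple
  reflections.
\<close>

lemma act_alt_prod_\<alpha>:
  assumes "s \<in> S" "t \<in> S"
  shows "act (inv (alt_prod t s k)) (\<alpha> s) = (\<lambda>x. chebyshev (- gram s t) (Suc k) * \<alpha> (if even k then s else t) x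
     + chebyshev (- gram s t) k * \<alpha> (if even k then t else s) x)"
proof (induction k)
  case (Suc k)
  let ?y = "if even k then t else s"
  have "act (inv (alt_prod t s (Suc k))) (\<alpha> s) = reflect (\<alpha> ?y) (act (inv (alt_prod t s k)) (\<alpha> s))"
    using assms by (auto simp: inv_mult_group act_mult)
  then show ?case
    unfolding Suc using assms gram_sym[of s t] by (auto simp: reflect_def algebra_simps)
qed simp

text \<open>
  The theorem of Tits that \<open>g \<alpha>\<^sub>s\<close> is a positive root if \<open>s\<close> is not a right descent of \<open>g\<close>.
  Split off from \<open>g\<close> on the right the longest possible alternating product in \<open>s\<close> and some right
  descent \<open>t\<close>, so that \<open>g = h d\<close> with \<open>h\<close> shorter than \<open>g\<close> and neither \<open>s\<close> nor \<open>t\<close> a right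
  descent of \<open>h\<close>. Then \<open>d \<alpha>\<^sub>s\<close> is a non-negative combination of \<open>\<alpha>\<^sub>s\<close> and \<open>\<alpha>\<^sub>t\<close>, and induction
  applies to \<open>h\<close>.
\<close>

lemma ht_up:
  assumes "g \<in> carrier W" "s \<in> S" "cj g s \<notin> inversions g"
  shows "ht (act g (\<alpha> s)) > 0"
  using assms
proof (induction "len g" arbitrary: g s rule: less_induct)
  case less
  show ?case
  proof (cases "g = \<one>")
    case False
    then have "inversions \<one> \<subset> inversions g" 
      using inversions_empty_iff[OF less.prems(1)] by auto
    then obtain t where t: "t \<in> S" "cj g t \<in> inversions g" 
      using down_step[OF one_closed less.prems(1)] by blast
    then have "t \<noteq> s" using less.prems by auto
    let ?a = "alt_prod t s"
    let ?P = "\<lambda>k. \<forall>i\<le>k. len (g \<otimes> ?a i) + i = len g"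
    define z where "z = (\<lambda>k::nat. if even k then t else s)"
    have z: "z k \<in> S" for k using t less.prems by (simp add: z_def)
    have step: "?a (Suc k) = ?a k \<otimes> z k" for k by (simp add: z_def)
    have ga: "g \<otimes> ?a k \<in> carrier W" for k using t less.prems by auto
    have ac: "?a k \<in> carrier W" for k using t less.prems by auto
    have gs: "g \<otimes> ?a (Suc k) = g \<otimes> ?a k \<otimes> z k" for k
      unfolding step using ac z less.prems by (simp add: m_assoc)
    have P0: "?P 0" using less.prems by simp
    have P1: "?P (Suc 0)"
      using t less.prems down_gen(2)[of g t] by (auto simp: le_Suc_eq)
    have bd: "k \<le> len g" if "?P k" for k using that by force
    define k where "k = Greatest ?P"
    have k: "?P k" unfolding k_def using P0 bd by (rule GreatestI_nat)
    have lk: "len (g \<otimes> ?a i) + i = len g" if "i \<le> k" for i using k that by blast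
    have kmax: "j \<le> k" if "?P j" for j
      unfolding k_def using that bd by (rule Greatest_le_nat)
    have "k \<ge> 1" using kmax[OF P1] by simp
    define h where "h = g \<otimes> ?a k"
    have h: "h \<in> carrier W" using ga h_def by simp
    have lh: "len h + k = len g" using k h_def by auto
    have up1: "cj h (z k) \<notin> inversions h"
    proof
      assume "cj h (z k) \<in> inversions h"
      then have "len h = Suc (len (g \<otimes> ?a (Suc k)))"
        unfolding gs h_def[symmetric] using down_gen(2)[OF h z] by simp
      then have "?P (Suc k)" using k lh by (auto simp: le_Suc_eq)
      from kmax[OF this] show False by simp
    qed
    obtain k' where k': "k = Suc k'" using \<open>k \<ge> 1\<close> by (cases k) auto
    have hz: "h \<otimes> z k' = g \<otimes> ?a k'"
      unfolding h_def k' gs using ga z by simp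
    have "len (h \<otimes> z k') + k' = len g" unfolding hz using k k' by auto
    then have up2: "cj h (z k') \<notin> inversions h"
      using down_gen(2)[OF h z, of k'] lh k' by auto
    have zz: "{z k, z k'} = {s, t}" by (auto simp: z_def k')
    then have up: "cj h s \<notin> inversions h" "cj h t \<notin> inversions h"
      using up1 up2 by (metis insert_iff singletonD)+
    have "len h < len g" using lh \<open>k \<ge> 1\<close> by simp
    then have pos: "ht (act h (\<alpha> s)) > 0" "ht (act h (\<alpha> t)) > 0"
      using less.hyps h up t less.prems by auto
    let ?q = "- gram s t"
    \<comment> \<open>If \<open>k\<close> were at least the order \<open>m\<close> of \<open>t s\<close>, the \<open>m\<close>-th step down would cross the wall of
      \<open>g s g\<^sup>-\<^sup>1\<close>, and \<open>s\<close> would be a right descent.\<close>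
    have km: "k < ord (t \<otimes> s)" if m0: "ord (t \<otimes> s) > 0"
    proof (rule ccontr)
      assume nk: "\<not> k < ord (t \<otimes> s)"
      define i where "i = ord (t \<otimes> s) - 1"
      have i: "Suc i \<le> k" using nk m0 by (simp add: i_def)
      have "len (g \<otimes> ?a i) + i = len g" "len (g \<otimes> ?a (Suc i)) + Suc i = len g"
        using i k by auto
      then have dn: "cj (g \<otimes> ?a i) (z i) \<in> inversions (g \<otimes> ?a i)"
        using up_gen(2)[OF ga z, of i i] unfolding gs by auto
      have "cj (?a i) (z i) = s"
        unfolding z_def cj_alt_prod[OF t(1) less.prems(2)] i_def
        using pow_ord_minus_one[OF t(1) less.prems(2)] m0 by simp
      then have e: "cj (g \<otimes> ?a i) (z i) = cj g s"
        using cj_cj[of g "?a i" "z i"] ac z less.prems by simp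
      have sub: "j \<le> Suc i \<Longrightarrow> inversions (g \<otimes> ?a j) \<subseteq> inversions g" for j
      proof (induction j)
        case (Suc j)
        have "len (g \<otimes> ?a j) + j = len g" "len (g \<otimes> ?a (Suc j)) + Suc j = len g"
          using Suc.prems i by (intro lk; linarith)+
        then have "cj (g \<otimes> ?a j) (z j) \<in> inversions (g \<otimes> ?a j)"
          using up_gen(2)[OF ga z, of j j] unfolding gs by auto
        then have "inversions (g \<otimes> ?a (Suc j)) \<subseteq> inversions (g \<otimes> ?a j)"
          unfolding gs using down_gen(1)[OF ga z] by blast
        then show ?case using Suc by auto
      qed (use less.prems in simp)
      have "cj g s \<in> inversions g" using dn sub[of i] unfolding e by auto
      then show False using less.prems by simp
    qed
    have nonneg: "chebyshev ?q (Suc k) \<ge> 0 \<and> chebyshev ?q k > 0"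
    proof (cases "ord (t \<otimes> s) = 0")
      case True
      then have "gram s t = - 1"
        using \<open>t \<noteq> s\<close> gram_sym[of s t] t less.prems by (simp add: gram_def)
      then show ?thesis using \<open>k \<ge> 1\<close> by (simp add: chebyshev_one)
    next
      case F: False
      let ?m = "ord (t \<otimes> s)"
      let ?x = "pi / real ?m"
      have "?m \<ge> 2" using ord_gens_ge_2[of t s] t less.prems \<open>t \<noteq> s\<close> F by simp
      have q: "?q = cos ?x"
        using \<open>t \<noteq> s\<close> gram_sym[of s t] t less.prems F by (simp add: gram_def)
      have km': "real (Suc k) \<le> real ?m" using km F by linarith
      have "sin ?x > 0" using \<open>?m \<ge> 2\<close> by (intro sin_gt_zero) (auto simp: field_simps)
      moreover have "sin (real k * ?x) > 0"
        using km' \<open>?m \<ge> 2\<close> \<open>k \<ge> 1\<close> by (intro sin_gt_zero) (auto simp: field_simps)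
      moreover have "real (Suc k) * ?x \<le> real ?m * ?x" 
        using km' by (intro mult_right_mono) auto
      then have "sin (real (Suc k) * ?x) \<ge> 0"
        using \<open>?m \<ge> 2\<close> by (intro sin_ge_zero) auto
      ultimately show ?thesis
        unfolding q using chebyshev_cos[of ?x k] chebyshev_cos[of ?x "Suc k"] 
        by (metis zero_less_mult_pos zero_le_mult_iff less_le_not_le not_less)
    qed
    have "g = h \<otimes> inv (?a k)" unfolding h_def using ac less.prems by (simp add: m_assoc)
    then have "act g (\<alpha> s) = act h (act (inv (?a k)) (\<alpha> s))"
      using h ac by (metis act_mult inv_closed)
    then have "ht (act g (\<alpha> s)) = chebyshev ?q (Suc k) * ht (act h (\<alpha> (if even k then s else t)))
        + chebyshev ?q k * ht (act h (\<alpha> (if even k then t else s)))"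
      unfolding act_alt_prod_\<alpha>[OF less.prems(2) t(1)] by simp
    then show ?thesis using nonneg pos by (auto intro!: add_nonneg_pos)
  qed (use less in simp)
qed

lemma ht_sign:
  assumes "g \<in> carrier W" "s \<in> S"
  shows "ht (act g (\<alpha> s)) \<noteq> 0" "ht (act g (\<alpha> s)) < 0 \<longleftrightarrow> cj g s \<in> inversions g"
proof -
  have "ht (act g (\<alpha> s)) < 0" if d: "cj g s \<in> inversions g"
  proof -
    have e: "cj (g \<otimes> s) s = cj g s"
      using assms by (simp add: cj_def inv_mult_group m_assoc)
    have "cj (g \<otimes> s) s \<notin> inversions (g \<otimes> s)"
      using down_gen(1)[OF assms d] e by simp
    then have "ht (act (g \<otimes> s) (\<alpha> s)) > 0" using ht_up assms by simp
    then show ?thesis using assms by (simp add: act_mult reflect_self)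
  qed
  then show "ht (act g (\<alpha> s)) \<noteq> 0" "ht (act g (\<alpha> s)) < 0 \<longleftrightarrow> cj g s \<in> inversions g"
    using ht_up[OF assms] by fastforce+
qed

text \<open>
  \<open>is_root r \<beta>\<close> states that \<open>\<beta>\<close> is one of the two roots of the reflection \<open>r\<close>.
\<close>

definition is_root :: "'a \<Rightarrow> ('a \<Rightarrow> real) \<Rightarrow> bool" where
  "is_root r \<beta> \<longleftrightarrow> (\<exists>u \<in> carrier W. \<exists>s \<in> S. r = cj u s \<and> \<beta> = act u (\<alpha> s))"

text \<open>
  For a root \<open>\<beta>\<close>, the number \<open>val \<beta> g\<close> is positive or negative according to whether \<open>g\<^sup>-\<^sup>1 \<beta>\<close> is
  a positive or a negative root, that is, according to the side of the wall of \<open>\<beta>\<close> on which \<open>g\<close>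
  lies; it is linear in \<open>\<beta>\<close>.
\<close>

definition val :: "('a \<Rightarrow> real) \<Rightarrow> 'a \<Rightarrow> real" where
  "val \<beta> g = ht (act (inv g) \<beta>)"

lemma val_lin [simp]:
  "val (\<lambda>x. u x + v x) g = val u g + val v g"
  "val (\<lambda>x. u x - v x) g = val u g - val v g"
  "val (\<lambda>x. - u x) g = - val u g"
  "val (\<lambda>x. c * u x) g = c * val u g"
  "val (\<lambda>x. u x / c) g = val u g / c"
  by (simp_all add: val_def)

lemma val_reflect: "val (reflect \<beta> v) g = val v g - 2 * B \<beta> v * val \<beta> g"
  by (simp add: reflect_def)

lemma root_reflection: "is_root r \<beta> \<Longrightarrow> r \<in> reflections W S"
  by (auto simp: is_root_def)

lemma root_closed [simp]: "is_root r \<beta> \<Longrightarrow> r \<in> carrier W"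
  using root_reflection by auto

lemma reflection_root: "r \<in> reflections W S \<Longrightarrow> \<exists>\<beta>. is_root r \<beta>"
  by (auto simp: is_root_def elim!: reflectionE)

lemma root_norm [simp]: "is_root r \<beta> \<Longrightarrow> B \<beta> \<beta> = 1"
  by (auto simp: is_root_def)

lemma root_act: "is_root r \<beta> \<Longrightarrow> g \<in> carrier W \<Longrightarrow> is_root (cj g r) (act g \<beta>)"
  unfolding is_root_def by (metis (no_types, lifting) act_mult cj_cj gen_closed m_closed)

lemma root_uminus: 
  assumes "is_root r \<beta>" shows "is_root r (\<lambda>x. - \<beta> x)"
proof -
  obtain u s where u: "u \<in> carrier W" "s \<in> S" "r = cj u s" "\<beta> = act u (\<alpha> s)"
    using assms by (auto simp: is_root_def)
  have "r = cj (u \<otimes> s) s" using u by (simp add: cj_def inv_mult_group m_assoc)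
  moreover have "(\<lambda>x. - \<beta> x) = act (u \<otimes> s) (\<alpha> s)" using u by (simp add: act_mult reflect_self)
  ultimately show ?thesis unfolding is_root_def using u by (metis gen_closed m_closed)
qed

lemma act_reflection:
  assumes "is_root r \<beta>" shows "act r v = reflect \<beta> v"
proof -
  obtain u s where u: "u \<in> carrier W" "s \<in> S" "r = cj u s" "\<beta> = act u (\<alpha> s)"
    using assms by (auto simp: is_root_def)
  then have "act r v = act u (reflect (\<alpha> s) (act (inv u) v))" by (simp add: cj_def act_mult)
  then show ?thesis using u by (simp add: act_reflect)
qed

lemma root_reflect: "is_root r \<beta> \<Longrightarrow> is_root q \<delta> \<Longrightarrow> is_root (cj r q) (reflect \<beta> \<delta>)"
  using root_act[of q \<delta> r] act_reflection[of r \<beta>] by simp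

lemma val_reflect_eq: 
  assumes "is_root r \<beta>" "g \<in> carrier W" shows "val (reflect \<beta> v) g = val v (r \<otimes> g)"
proof -
  have r: "r \<in> carrier W" "inv r = r" using assms root_reflection reflection_inv by auto
  have "inv (r \<otimes> g) = inv g \<otimes> r" using r assms by (simp add: inv_mult_group)
  then show ?thesis using r assms by (simp add: val_def act_reflection[symmetric] act_mult)
qed

lemma val_sign:
  assumes "is_root r \<beta>" "g \<in> carrier W"
  shows "val \<beta> g \<noteq> 0" "r \<in> inversions g \<longleftrightarrow> (val \<beta> g < 0) \<noteq> (val \<beta> \<one> < 0)"
proof -
  obtain u s where u: "u \<in> carrier W" "s \<in> S" "r = cj u s" "\<beta> = act u (\<alpha> s)"
    using assms by (auto simp: is_root_def)
  have v: "val \<beta> h = ht (act (inv h \<otimes> u) (\<alpha> s))" if "h \<in> carrier W" for h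
    using u that by (simp add: val_def act_mult)
  show "val \<beta> g \<noteq> 0" unfolding v[OF assms(2)] using ht_sign(1) u assms by simp
  have "val \<beta> h < 0 \<longleftrightarrow> (r \<in> inversions h) \<noteq> (r \<in> inversions u)" if h: "h \<in> carrier W" for h
  proof -
    have "cj h (cj (inv h \<otimes> u) s) = r" using u h by (simp add: cj_cj m_assoc[symmetric])
    then show ?thesis
      unfolding v[OF h] using ht_sign(2)[of "inv h \<otimes> u" s] u h 
        inversions_diff[of h u "cj (inv h \<otimes> u) s"] by simp
  qed
  then show "r \<in> inversions g \<longleftrightarrow> (val \<beta> g < 0) \<noteq> (val \<beta> \<one> < 0)" using assms by auto
qed

text \<open>
  The positive roots, those with \<open>1\<close> on their positive side.
\<close>

definition posroot :: "('a \<Rightarrow> real) \<Rightarrow> bool" where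
  "posroot \<beta> \<longleftrightarrow> (\<exists>r. is_root r \<beta>) \<and> val \<beta> \<one> > 0"

lemma posroot_inversion:
  "is_root r \<beta> \<Longrightarrow> posroot \<beta> \<Longrightarrow> g \<in> carrier W \<Longrightarrow> r \<in> inversions g \<longleftrightarrow> val \<beta> g < 0"
  using val_sign(2)[of r \<beta> g] by (auto simp: posroot_def)

lemma reflection_posroot:
  assumes "r \<in> reflections W S" obtains \<beta> where "is_root r \<beta>" "posroot \<beta>"
proof -
  obtain \<beta> where b: "is_root r \<beta>" using reflection_root assms by blast
  then have "val \<beta> \<one> \<noteq> 0" using val_sign by simp
  then show thesis
    using that[of \<beta>] that[of "\<lambda>x. - \<beta> x"] b root_uminus[OF b] unfolding posroot_def
    by (cases "val \<beta> \<one> > 0") auto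
qed

lemma root_unique:
  assumes "is_root r \<beta>" "is_root r \<beta>'"
  shows "\<beta>' = \<beta> \<or> \<beta>' = (\<lambda>x. - \<beta> x)"
proof -
  have n: "B \<beta> \<beta> = 1" "B \<beta>' \<beta>' = 1" using assms by auto
  define c where "c = B \<beta> \<beta>'"
  have "reflect \<beta> \<beta>' = reflect \<beta>' \<beta>'" using act_reflection[OF assms(1)] act_reflection[OF assms(2)] by metis
  then have "(\<lambda>x. \<beta>' x - 2 * c * \<beta> x) = (\<lambda>x. - \<beta>' x)" using n reflect_self by (simp add: reflect_def c_def)
  then have e: "\<beta>' x = c * \<beta> x" for x by (metis (no_types, lifting) add_diff_cancel_left' diff_eq_eq mult.assoc mult_2 mult_cancel_left zero_neq_numeral minus_diff_eq diff_minus_eq_add)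
  then have "\<beta>' = (\<lambda>x. c * \<beta> x)" by auto
  then have "B \<beta>' \<beta>' = c * c" using n by (simp only: B_left B_right)
  then have "c = 1 \<or> c = - 1" using n by (metis power2_eq_1_iff power2_eq_square)
  then show ?thesis using \<open>\<beta>' = (\<lambda>x. c * \<beta> x)\<close> by auto
qed

lemma posroot_unique: "is_root r \<beta> \<Longrightarrow> is_root r \<beta>' \<Longrightarrow> posroot \<beta> \<Longrightarrow> posroot \<beta>' \<Longrightarrow> \<beta>' = \<beta>"
  using root_unique[of r \<beta> \<beta>'] by (auto simp: posroot_def)

text \<open>
  A reflection is determined by its sides, since some edge crosses its wall and no other.
\<close>

lemma reflection_eqI:
  assumes "r \<in> reflections W S" "q \<in> carrier W"
    and "\<And>g. g \<in> carrier W \<Longrightarrow> r \<in> inversions g \<longleftrightarrow> q \<in> inversions g"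
  shows "r = q"
proof -
  obtain g s where g: "g \<in> carrier W" "s \<in> S" "r = cj g s" using assms(1) by (rule reflectionE)
  then have "(r \<in> inversions (g \<otimes> s)) \<noteq> (r \<in> inversions g)"
    using inversions_mult_gen[of g s r] by auto
  then have "(q \<in> inversions (g \<otimes> s)) \<noteq> (q \<in> inversions g)" using assms g by auto
  then show ?thesis using inversions_mult_gen[of g s q] g assms by auto
qed

lemma finite_neg_roots:
  assumes "g \<in> carrier W" shows "finite {\<beta>. posroot \<beta> \<and> val \<beta> g < 0}"
proof -
  define f where "f \<beta> = (SOME r. is_root r \<beta>)" for \<beta>
  have f: "is_root (f \<beta>) \<beta>" if "posroot \<beta>" for \<beta>
    unfolding f_def using that by (auto simp: posroot_def intro: someI)
  have "inj_on f {\<beta>. posroot \<beta> \<and> val \<beta> g < 0}"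
    using f posroot_unique by (intro inj_onI) (metis (no_types, lifting) mem_Collect_eq)
  moreover have "f ` {\<beta>. posroot \<beta> \<and> val \<beta> g < 0} \<subseteq> inversions g"
    using f posroot_inversion assms by blast
  ultimately show ?thesis using finite_inversions[OF assms] by (meson inj_on_finite)
qed

end

section \<open>Estimates of cosines\<close>

lemma cos_ge_quadratic: "cos x \<ge> 1 - x\<^sup>2 / 2" for x :: real
proof -
  have "cos x = 1 - 2 * (sin (x / 2))\<^sup>2" using cos_double_sin[of "x / 2"] by simp
  moreover have "(sin (x / 2))\<^sup>2 \<le> (x / 2)\<^sup>2"
    using abs_sin_x_le_abs_x[of "x / 2"] by (simp only: abs_le_square_iff)
  ultimately show ?thesis by (simp add: power2_eq_square)
qed

lemma sec_ge_quadratic: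
  fixes x :: real assumes "0 \<le> x" "x < pi / 2"
  shows "1 / cos x - 1 \<ge> x\<^sup>2 / 2"
proof -
  define h where "h = x / 2"
  have h: "0 \<le> h" "h < pi / 4" using assms by (auto simp: h_def)
  then have ch: "cos h > 0" by (intro cos_gt_zero_pi) auto
  have cx: "cos x > 0" using assms by (intro cos_gt_zero_pi) auto
  have cx2: "cos x = (cos h)\<^sup>2 - (sin h)\<^sup>2" using cos_double[of h] by (simp add: h_def)
  have "\<bar>h\<bar> \<le> \<bar>tan h\<bar>" using h by (intro abs_tan_ge) auto
  then have "h\<^sup>2 \<le> (tan h)\<^sup>2" by (simp add: abs_le_square_iff)
  also have "\<dots> = (sin h)\<^sup>2 / (cos h)\<^sup>2" by (simp add: tan_def power_divide)
  also have "\<dots> \<le> (sin h)\<^sup>2 / cos x" 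
    using ch cx cx2 by (intro divide_left_mono) auto
  finally have "2 * h\<^sup>2 \<le> 2 * (sin h)\<^sup>2 / cos x" by simp
  also have "2 * (sin h)\<^sup>2 / cos x = (1 - cos x) / cos x"
    using cos_double_sin[of h] by (simp add: h_def)
  also have "\<dots> = 1 / cos x - 1" using cx by (simp add: diff_divide_distrib)
  finally show ?thesis by (simp add: h_def power2_eq_square)
qed

text \<open>
  The left hand side is \<open>cos (y - a) + cos a cos y (1 / cos z - 1)\<close>; the second term makes up
  for the deviation of \<open>y\<close> from \<open>a\<close>.
\<close>

lemma near_angle:
  fixes a y z c :: real
  assumes z: "0 \<le> z" "z < pi / 2" and c: "0 \<le> c" "c\<^sup>2 \<le> cos a * cos y" and d: "\<bar>y - a\<bar> \<le> c * z"
  shows "cos a * cos y / cos z + sin a * sin y \<ge> 1"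
proof -
  have "(y - a)\<^sup>2 \<le> (c * z)\<^sup>2" using d by (metis abs_ge_zero power2_abs power_mono)
  then have "1 - c\<^sup>2 * z\<^sup>2 / 2 \<le> cos (y - a)"
    using cos_ge_quadratic[of "y - a"] by (simp add: power_mult_distrib)
  moreover have "c\<^sup>2 * (z\<^sup>2 / 2) \<le> cos a * cos y * (1 / cos z - 1)"
    using c(2) sec_ge_quadratic[OF z] by (intro mult_mono) (auto intro: order_trans[OF zero_le_power2 c(2)])
  ultimately show ?thesis by (simp add: cos_diff algebra_simps)
qed

lemma cos_prod_quarter:
  fixes a y :: real
  assumes "0 \<le> a" "a \<le> pi / 4" "0 \<le> y" "y \<le> 3 / 2 * a"
  shows "cos a * cos y \<ge> (1 / 2)\<^sup>2"
proof -
  have y: "y \<le> 3 / 8 * pi" using assms by simp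
  have p: "cos (pi / 4) \<le> cos a" "cos (3 / 8 * pi) \<le> cos y" 
    using assms y by (auto intro!: cos_monotone_0_pi_le)
  have c: "cos (3 / 8 * pi) > 0" by (intro cos_gt_zero_pi) auto
  have "cos (3 / 4 * pi) = - cos (pi / 4)" using cos_pi_minus[of "pi / 4"] by (simp add: algebra_simps)
  then have e: "2 * (cos (3 / 8 * pi))\<^sup>2 - 1 = - (sqrt 2 / 2)"
    using cos_double_cos[of "3 / 8 * pi"] by (simp add: cos_45)
  have "sqrt 2 \<le> 3 / 2" by (rule real_le_lsqrt) (auto simp: power2_eq_square)
  then have "(1 / 4)\<^sup>2 \<le> (cos (pi / 4) * cos (3 / 8 * pi))\<^sup>2"
    using e by (simp add: power_mult_distrib cos_45 power_divide) 
  then have "1 / 4 \<le> cos (pi / 4) * cos (3 / 8 * pi)"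
    using c by (subst (asm) power_mono_iff) (auto simp: cos_45)
  also have "\<dots> \<le> cos a * cos y"
    using p c assms by (intro mult_mono) (auto intro!: cos_ge_zero)
  finally show ?thesis by (simp add: power2_eq_square)
qed

lemma cos_prod_bound:
  fixes l :: nat and a y :: real
  assumes "l \<ge> 2" "a = pi / (2 * real l)" "0 \<le> y" "y \<le> (2 - 1 / real l) * a"
  shows "cos a * cos y \<ge> (1 - 1 / real l)\<^sup>2"
proof (cases "l = 2")
  case True
  have "(1 / 2)\<^sup>2 \<le> cos a * cos y" by (rule cos_prod_quarter) (use assms True in auto)
  then show ?thesis using True by simp
next
  case False
  define x where "x = 1 / real l"
  have x: "0 < x" "x \<le> 1 / 3" using False assms by (auto simp: x_def field_simps)
  have "pi\<^sup>2 \<le> (3.15)\<^sup>2" using pi_approx by (intro power_mono) auto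
  then have pi10: "pi\<^sup>2 \<le> 10" by (simp add: power2_eq_square)
  have a: "a = pi * x / 2" using assms by (simp add: x_def)
  have "a\<^sup>2 = pi\<^sup>2 * x\<^sup>2 / 4" by (simp add: a power_mult_distrib power_divide)
  also have "\<dots> \<le> 10 * x\<^sup>2 / 4" using pi10 by (intro divide_right_mono mult_right_mono) auto
  finally have a2: "a\<^sup>2 \<le> 5 / 2 * x\<^sup>2" by simp
  have "y\<^sup>2 \<le> ((2 - x) * a)\<^sup>2" using assms by (intro power_mono) (auto simp: x_def)
  also have "\<dots> \<le> (2 - x)\<^sup>2 * (5 / 2 * x\<^sup>2)" 
    unfolding power_mult_distrib using a2 by (intro mult_left_mono) auto
  finally have y2: "y\<^sup>2 \<le> 5 / 2 * x\<^sup>2 * (2 - x)\<^sup>2" by (simp add: mult_ac)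
  have ca: "1 - 5 / 4 * x\<^sup>2 \<le> cos a" using cos_ge_quadratic[of a] a2 by simp
  have cy: "1 - 5 / 4 * x\<^sup>2 * (2 - x)\<^sup>2 \<le> cos y" using cos_ge_quadratic[of y] y2 by simp
  have x9: "x\<^sup>2 \<le> (1 / 3)\<^sup>2" using x by (intro power_mono) auto
  have "(2 - x)\<^sup>2 \<le> 2\<^sup>2" using x by (intro power_mono) auto
  then have "x\<^sup>2 * (2 - x)\<^sup>2 \<le> (1 / 3)\<^sup>2 * 2\<^sup>2" using x9 by (intro mult_mono) auto
  then have pos: "0 \<le> 1 - 5 / 4 * x\<^sup>2" "0 \<le> 1 - 5 / 4 * x\<^sup>2 * (2 - x)\<^sup>2"
    using x9 by (auto simp: power2_eq_square)
  have "x * (x * x) \<le> 1/3 * (1/3 * (1/3))" using x by (intro mult_mono) auto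
  moreover have "x * x \<ge> 2 / 3 * x - 1 / 9" 
    using zero_le_square[of "x - 1/3"] by (simp add: algebra_simps)
  moreover have "5 / 4 * x * (1 + (2 - x)\<^sup>2) = 25 / 4 * x - 5 * (x * x) + 5 / 4 * (x * (x * x))"
    by (simp add: power2_eq_square algebra_simps)
  ultimately have "5 / 4 * x * (1 + (2 - x)\<^sup>2) \<le> 2 - x" using x by linarith
  then have "x * (5 / 4 * x * (1 + (2 - x)\<^sup>2)) \<le> x * (2 - x)" using x by (intro mult_left_mono) auto
  then have "(1 - x)\<^sup>2 \<le> 1 - 5 / 4 * x\<^sup>2 * (1 + (2 - x)\<^sup>2)"
    by (simp add: power2_eq_square algebra_simps)
  also have "\<dots> \<le> (1 - 5 / 4 * x\<^sup>2) * (1 - 5 / 4 * x\<^sup>2 * (2 - x)\<^sup>2)"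
  proof -
    have "0 \<le> 5 / 4 * x\<^sup>2 * (5 / 4 * x\<^sup>2 * (2 - x)\<^sup>2)" by (intro mult_nonneg_nonneg) auto
    then show ?thesis by (simp add: algebra_simps)
  qed
  also have "\<dots> \<le> cos a * cos y" using ca cy pos by (intro mult_mono) auto
  finally show ?thesis by (simp add: x_def)
qed

lemma odd_multiple_near:
  fixes P l :: int
  assumes "odd P" "l \<ge> 1"
  shows "\<exists>i. \<bar>(2 * i + 1) * l - P\<bar> \<le> l - 1"
proof -
  define k where "k = P div l"
  define r where "r = P mod l"
  have P: "P = k * l + r" by (simp add: k_def r_def)
  have r: "0 \<le> r" "r < l" using assms by (auto simp: r_def)
  show ?thesis
  proof (cases "odd k")
    case True
    then obtain i where "k = 2 * i + 1" by (elim oddE)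
    then show ?thesis using P r by (intro exI[of _ i]) auto
  next
    case False
    then obtain i where i: "k = 2 * i" by auto
    have "r \<noteq> 0" using P i assms by auto
    then show ?thesis using P r i by (intro exI[of _ i]) (auto simp: algebra_simps)
  qed
qed

text \<open>
  Among the angles \<open>y = (j + 2 i) h\<close> in the interval from \<open>z = j h\<close> to \<open>\<pi>/2\<close>, take the one
  nearest to \<open>a\<close>. If \<open>j \<ge> 2\<close>, its distance from \<open>a\<close> is at most \<open>h \<le> z/2\<close>. If \<open>j = 1\<close>, then \<open>\<pi>/2\<close>
  is an odd multiple of \<open>h\<close> and the denominator \<open>2 l\<close> of \<open>a\<close> gives the slightly better bound \<open>(1
  - 1/l) h\<close> where \<open>h = z\<close>. In both cases \<open>near_angle\<close> applies.
\<close>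

lemma angle_grid:
  fixes l :: nat and a h :: real and j q :: int
  assumes l: "l \<ge> 2" and a: "a = pi / (2 * real l)" and h: "h > 0" and j: "j \<ge> 1"
    and q: "q \<ge> 0" and e: "of_int (j + 2 * q) * h = pi / 2" and z: "of_int j * h < pi / 2"
  shows "\<exists>i. 0 \<le> i \<and> i \<le> q \<and>
    cos a * cos (of_int (j + 2 * i) * h) / cos (of_int j * h) + sin a * sin (of_int (j + 2 * i) * h) \<ge> 1"
proof -
  define z where "z = of_int j * h"
  have z0: "0 < z" "z < pi / 2" using h j z by (auto simp: z_def)
  have a0: "0 < a" "a \<le> pi / 4" using l by (auto simp: a field_simps)
  have ca: "0 < cos a" "0 < sin a" using a0 by (auto intro!: cos_gt_zero_pi sin_gt_zero)
  show ?thesis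
  proof (cases "z \<ge> a")
    case True
    have "sin a \<le> sin z" using True a0 z0 by (intro sin_monotone_2pi_le) auto
    then have "sin a * sin a \<le> sin a * sin z" using ca by (intro mult_left_mono) auto
    moreover have "1 = cos a * cos a + sin a * sin a" 
      using sin_cos_squared_add[of a] by (simp add: power2_eq_square)
    moreover have "cos a * cos a \<le> cos a * 1" using ca by (intro mult_left_mono) auto
    ultimately have "1 \<le> cos a + sin a * sin z" by linarith
    moreover have "cos z \<noteq> 0" using cos_gt_zero_pi[of z] z0 by auto
    ultimately show ?thesis using q by (intro exI[of _ 0]) (simp add: z_def)
  next
    case za: False
    show ?thesis
    \<comment> \<open>From here on \<open>z < a\<close>, so that the grid has an angle near \<open>a\<close> that is at least \<open>z\<close>.\<close>
    proof (cases "j = 1")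
      case False
      define i where "i = round ((a - z) / (2 * h))"
      have "\<bar>of_int i - (a - z) / (2 * h)\<bar> \<le> 1 / 2" unfolding i_def by (rule of_int_round_abs_le)
      then have "2 * h * \<bar>of_int i - (a - z) / (2 * h)\<bar> \<le> 2 * h * (1 / 2)" 
        using h by (intro mult_left_mono) auto
      also have "2 * h * \<bar>of_int i - (a - z) / (2 * h)\<bar> = \<bar>2 * h * (of_int i - (a - z) / (2 * h))\<bar>"
        using h by (simp add: abs_mult)
      also have "2 * h * (of_int i - (a - z) / (2 * h)) = z + 2 * h * of_int i - a"
        using h by (simp add: field_simps)
      finally have d0: "\<bar>z + 2 * h * of_int i - a\<bar> \<le> h" by simp
      define y where "y = of_int (j + 2 * i) * h"
      have y: "y = z + 2 * h * of_int i" by (simp add: y_def z_def algebra_simps)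
      have hz: "2 * h \<le> z" unfolding z_def using False j h by (intro mult_right_mono) auto
      have d: "\<bar>y - a\<bar> \<le> 1 / 2 * z" using d0 hz y by simp
      have i0: "i \<ge> 0" unfolding i_def using za h by (intro round_mono[of 0, simplified]) simp
      have y0: "y \<ge> 0" using y z0 h i0 by simp
      have y32: "y \<le> 3 / 2 * a" using d za by linarith
      then have "y < pi / 2" using a0 pi_gt_zero by linarith
      then have "of_int (j + 2 * i) * h < of_int (j + 2 * q) * h" using e y_def by simp
      then have iq: "i \<le> q" using h by simp
      have "cos a * cos y / cos z + sin a * sin y \<ge> 1"
        using near_angle[of z "1/2" a y] d z0 cos_prod_quarter[of a y] a0 y0 y32 by simp
      then show ?thesis using i0 iq by (intro exI[of _ i]) (simp add: y_def z_def)
    next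
      case True
      define P where "P = j + 2 * q"
      have "odd P" using True by (simp add: P_def)
      then obtain i where i: "\<bar>(2 * i + 1) * int l - P\<bar> \<le> int l - 1"
        using odd_multiple_near[of P "int l"] l by auto
      define y where "y = of_int (j + 2 * i) * h"
      have zh: "z = h" using True by (simp add: z_def)
      have aP: "a * real l = of_int P * h" using e l a by (simp add: P_def)
      have "\<bar>of_int ((2 * i + 1) * int l - P) :: real\<bar> \<le> of_int (int l - 1)"
        using i by (metis of_int_abs of_int_le_iff)
      then have "h * \<bar>of_int ((2 * i + 1) * int l - P) :: real\<bar> \<le> h * of_int (int l - 1)"
        using h by (intro mult_left_mono) auto
      then have e1: "\<bar>h * of_int ((2 * i + 1) * int l - P)\<bar> \<le> h * (real l - 1)"
        using h by (simp add: abs_mult)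
      have e2: "h * of_int ((2 * i + 1) * int l - P) = real l * (y - a)"
        using aP True by (simp add: y_def algebra_simps)
      have "real l * \<bar>y - a\<bar> \<le> h * (real l - 1)" using e1 unfolding e2 by (simp add: abs_mult)
      then have d: "\<bar>y - a\<bar> \<le> (1 - 1 / real l) * z" using l zh by (simp add: field_simps)
      have hl: "0 \<le> 1 - 1 / real l" "1 - 1 / real l < 1" using l by auto
      have "(1 - 1 / real l) * z \<le> (1 - 1 / real l) * a" using hl za by (intro mult_left_mono) auto
      then have ya: "y \<le> (2 - 1 / real l) * a" "0 < y" 
      proof -
        assume A: "(1 - 1 / real l) * z \<le> (1 - 1 / real l) * a"
        show "y \<le> (2 - 1 / real l) * a" using A d by (simp add: abs_le_iff algebra_simps)
        have "(1 - 1 / real l) * z < 1 * a" using hl za z0 a0 by (intro mult_strict_mono) auto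
        then show "0 < y" using d by (simp add: abs_le_iff)
      qed
      have "(2 - 1 / real l) * a < 2 * a" using a0 l by (intro mult_strict_right_mono) auto
      then have "y < pi / 2" using ya(1) a0 by linarith
      then have "of_int (j + 2 * i) * h < of_int (j + 2 * q) * h" using e y_def by simp
      then have iq: "i \<le> q" using h by simp
      have "of_int (j + 2 * i) > (0::real)" using ya(2) h unfolding y_def by (simp add: zero_less_mult_iff)
      then have "j + 2 * i > 0" by simp
      then have i0: "i \<ge> 0" using True by simp
      have "cos a * cos y / cos z + sin a * sin y \<ge> 1"
        using near_angle[of z "1 - 1 / real l" a y] d z0 hl cos_prod_bound[OF l a] ya by simp
      then show ?thesis using i0 iq by (intro exI[of _ i]) (simp add: y_def z_def)
    qed
  qed
qed

text \<open>
  For \<open>b < 1\<close> the sequence would be strictly concave because it is positive, hence eventually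
  negative.
\<close>

lemma positive_recurrence:
  fixes u :: "nat \<Rightarrow> real"
  assumes pos: "\<And>k. u k > 0" and rec: "\<And>k. u (Suc (Suc k)) = 2 * b * u (Suc k) - u k"
  shows "b \<ge> 1"
proof (rule ccontr)
  assume "\<not> b \<ge> 1"
  then have b: "b < 1" by simp
  define d where "d k = u (Suc k) - u k" for k
  have dS: "d (Suc k) = d k - 2 * (1 - b) * u (Suc k)" for k
    by (simp add: d_def rec algebra_simps)
  have dec: "d (Suc k) \<le> d k" for k
    unfolding dS using b pos[of "Suc k"] by simp
  show False
  proof (cases "\<exists>k. d k < 0")
    case True
    then obtain k where k: "d k < 0" by blast
    have dk: "d (k + n) \<le> d k" for n
      by (induction n) (use dec order_trans in auto)
    have un: "u (k + n) \<le> u k + real n * d k" for n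
    proof (induction n)
      case (Suc n)
      then show ?case using dk[of n] by (simp add: d_def algebra_simps)
    qed simp
    obtain n :: nat where "u k < real n * (- d k)" 
      using k ex_less_of_nat_mult[of "- d k" "u k"] by auto
    then have "u k + real n * d k < 0" by simp
    then show False using pos[of "k + n"] un[of n] by linarith
  next
    case False
    then have "u k \<le> u (Suc k)" for k by (simp add: d_def not_less)
    then have u0: "u 0 \<le> u k" for k by (induction k) (auto intro: order_trans)
    define c where "c = 2 * (1 - b) * u 0"
    have c: "c > 0" using b pos by (simp add: c_def)
    have dn: "d k \<le> d 0 - real k * c" for k
    proof (induction k)
      case (Suc k)
      have "c \<le> 2 * (1 - b) * u (Suc k)" unfolding c_def using b u0 by (intro mult_left_mono) auto
      then show ?case using Suc by (simp add: dS algebra_simps)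
    qed simp
    obtain n :: nat where "d 0 < real n * c" using c ex_less_of_nat_mult by blast
    then have "d n < 0" using dn[of n] by linarith
    then show False using False by blast
  qed
qed

section \<open>Dominance\<close>

context coxeter_finite_rank
begin

text \<open>
  The negative side of \<open>\<beta>\<close> is contained in that of \<open>\<delta>\<close>. If both roots are positive and distinct,
  then the wall of \<open>\<delta>\<close> separates \<open>1\<close> from the wall of \<open>\<beta>\<close>.
\<close>

definition dominates :: "('a \<Rightarrow> real) \<Rightarrow> ('a \<Rightarrow> real) \<Rightarrow> bool" where
  "dominates \<beta> \<delta> \<longleftrightarrow> (\<forall>g\<in>carrier W. val \<beta> g < 0 \<longrightarrow> val \<delta> g < 0)"

text \<open>
  Used for positive roots \<open>\<beta>\<close>: some wall separates \<open>1\<close> from the wall of \<open>\<beta>\<close>.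
\<close>

definition nonelementary :: "('a \<Rightarrow> real) \<Rightarrow> bool" where
  "nonelementary \<beta> \<longleftrightarrow> (\<exists>\<delta>. posroot \<delta> \<and> \<delta> \<noteq> \<beta> \<and> dominates \<beta> \<delta>)"

lemma posroot_root: "posroot \<beta> \<Longrightarrow> \<exists>r. is_root r \<beta>"
  by (simp add: posroot_def)

lemma posroot_norm [simp]: "posroot \<beta> \<Longrightarrow> B \<beta> \<beta> = 1"
  by (auto simp: posroot_def)

lemma posroot_val_one: "posroot \<beta> \<Longrightarrow> val \<beta> \<one> > 0"
  by (simp add: posroot_def)

lemma posroot_val_nonzero: "posroot \<beta> \<Longrightarrow> g \<in> carrier W \<Longrightarrow> val \<beta> g \<noteq> 0"
  using val_sign(1) by (auto simp: posroot_def)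

text \<open>
  The roots obtained from \<open>\<delta>\<close> and \<open>\<beta>\<close> by reflecting each root in the next one and changing the
  sign. The form takes the same value on any two consecutive members.
\<close>

fun root_chain :: "('a \<Rightarrow> real) \<Rightarrow> ('a \<Rightarrow> real) \<Rightarrow> nat \<Rightarrow> 'a \<Rightarrow> real" where
  "root_chain \<delta> \<beta> 0 = \<delta>"
| "root_chain \<delta> \<beta> (Suc 0) = \<beta>"
| "root_chain \<delta> \<beta> (Suc (Suc k)) = (\<lambda>x. 2 * B \<delta> \<beta> * root_chain \<delta> \<beta> (Suc k) x - root_chain \<delta> \<beta> k x)"

lemma root_chain_form:
  assumes "B \<delta> \<delta> = 1" "B \<beta> \<beta> = 1"
  shows "B (root_chain \<delta> \<beta> k) (root_chain \<delta> \<beta> k) = 1 \<and> B (root_chain \<delta> \<beta> (Suc k)) (root_chain \<delta> \<beta> (Suc k)) = 1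
    \<and> B (root_chain \<delta> \<beta> k) (root_chain \<delta> \<beta> (Suc k)) = B \<delta> \<beta>"
proof (induction k)
  case (Suc k)
  then show ?case
    using B_sym[of "root_chain \<delta> \<beta> (Suc k)" "root_chain \<delta> \<beta> k"] by (simp add: algebra_simps)
qed (use assms in simp)

lemma root_chain_reflect:
  assumes "B \<delta> \<delta> = 1" "B \<beta> \<beta> = 1"
  shows "root_chain \<delta> \<beta> (Suc (Suc k)) = (\<lambda>x. - reflect (root_chain \<delta> \<beta> (Suc k)) (root_chain \<delta> \<beta> k) x)"
  using root_chain_form[OF assms, of k] B_sym[of "root_chain \<delta> \<beta> (Suc k)" "root_chain \<delta> \<beta> k"] by (simp add: reflect_def)

lemma root_chain_root:
  assumes "is_root d \<delta>" "is_root b \<beta>"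
  shows "(\<exists>r. is_root r (root_chain \<delta> \<beta> k)) \<and> (\<exists>r. is_root r (root_chain \<delta> \<beta> (Suc k)))"
proof (induction k)
  case (Suc k)
  then obtain r q where "is_root r (root_chain \<delta> \<beta> k)" "is_root q (root_chain \<delta> \<beta> (Suc k))" by blast
  then have "is_root (cj q r) (root_chain \<delta> \<beta> (Suc (Suc k)))"
    using root_uminus[OF root_reflect[of q "root_chain \<delta> \<beta> (Suc k)" r "root_chain \<delta> \<beta> k"]] 
      root_chain_reflect[of \<delta> \<beta> k] assms by simp
  then show ?case using Suc by blast
qed (use assms in auto)

text \<open>
  If \<open>\<beta>\<close> dominates \<open>\<delta>\<close>, then each member of the chain dominates the preceding one. So all of
  them are positive, and \<open>positive_recurrence\<close> applies to their values at \<open>1\<close>.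
\<close>

lemma dominates_imp_form:
  assumes "posroot \<beta>" "posroot \<delta>" "dominates \<beta> \<delta>"
  shows "B \<delta> \<beta> \<ge> 1"
proof -
  let ?b = "root_chain \<delta> \<beta>"
  obtain d b where db: "is_root d \<delta>" "is_root b \<beta>" using assms posroot_root by blast
  have n: "B \<delta> \<delta> = 1" "B \<beta> \<beta> = 1" using assms by auto
  have dom: "dominates (?b (Suc k)) (?b k)" for k
  proof (induction k)
    case (Suc k)
    obtain q where q: "is_root q (?b (Suc k))" using root_chain_root[OF db, of k] by blast
    obtain r where r: "is_root r (?b k)" using root_chain_root[OF db, of k] by blast
    have "val (?b (Suc k)) g < 0" if g: "g \<in> carrier W" "val (?b (Suc (Suc k))) g < 0" for g
    proof -
      have qg: "q \<otimes> g \<in> carrier W" using q g by simp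
      have "val (?b (Suc (Suc k))) g = - val (?b k) (q \<otimes> g)"
        unfolding root_chain_reflect[OF n] using val_reflect_eq[OF q g(1)] by simp
      then have "val (?b k) (q \<otimes> g) > 0" using g by simp
      then have "\<not> val (?b (Suc k)) (q \<otimes> g) < 0"
        using Suc qg unfolding dominates_def by fastforce
      moreover have "val (?b (Suc k)) (q \<otimes> g) = - val (?b (Suc k)) g"
        using val_reflect_eq[OF q g(1), of "?b (Suc k)"] q by (simp add: reflect_self)
      ultimately show ?thesis using val_sign(1)[OF q g(1)] by simp
    qed
    then show ?case unfolding dominates_def by blast
  qed (use assms in simp)
  have "val (?b k) \<one> > 0" for k
  proof (induction k)
    case 0
    then show ?case using assms by (simp add: posroot_def)
  next
    case (Suc k)
    obtain q where q: "is_root q (?b (Suc k))" using root_chain_root[OF db, of k] by blast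
    have "\<not> val (?b (Suc k)) \<one> < 0" using dom[of k] Suc unfolding dominates_def by fastforce
    then show ?case using val_sign(1)[OF q one_closed] by simp
  qed
  then show ?thesis
    by (rule positive_recurrence[of "\<lambda>k. val (?b k) \<one>"]) simp
qed

text \<open>
  If neither root dominated the other, then \<open>g\<close> and some \<open>h\<close> would lie on opposite sides of both
  walls, and all members of the chain would separate \<open>g\<close> from \<open>h\<close>; they are infinitely many,
  because their values at \<open>g\<close> increase.
\<close>

lemma dominates_if_form:
  assumes \<beta>: "posroot \<beta>" and \<epsilon>: "posroot \<epsilon>" and form: "B \<epsilon> \<beta> \<ge> 1"
    and g: "g \<in> carrier W" "val \<epsilon> g < 0" "val \<beta> g > 0"
  shows "dominates \<beta> \<epsilon>"
proof (rule ccontr)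
  assume "\<not> ?thesis"
  then obtain h where h: "h \<in> carrier W" "val \<beta> h < 0" "val \<epsilon> h > 0"
    using posroot_val_nonzero[OF \<epsilon>] unfolding dominates_def by (metis linorder_neqE_linordered_idom)
  let ?b = "root_chain \<epsilon> \<beta>"
  have up: "val (?b k) g < val (?b (Suc k)) g \<and> val (?b (Suc k)) g > 0" for k
  proof (induction k)
    case (Suc k)
    have "val (?b (Suc (Suc k))) g - val (?b (Suc k)) g
        = (val (?b (Suc k)) g - val (?b k) g) + 2 * (B \<epsilon> \<beta> - 1) * val (?b (Suc k)) g"
      by (simp add: algebra_simps)
    moreover have "2 * (B \<epsilon> \<beta> - 1) * val (?b (Suc k)) g \<ge> 0" using Suc form by simp
    ultimately show ?case using Suc by linarith
  qed (use g in simp)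
  have dn: "val (?b k) h > val (?b (Suc k)) h \<and> val (?b (Suc k)) h < 0" for k
  proof (induction k)
    case (Suc k)
    have "val (?b (Suc (Suc k))) h - val (?b (Suc k)) h
        = (val (?b (Suc k)) h - val (?b k) h) + 2 * (B \<epsilon> \<beta> - 1) * val (?b (Suc k)) h"
      by (simp add: algebra_simps)
    moreover have "2 * (B \<epsilon> \<beta> - 1) * val (?b (Suc k)) h \<le> 0" 
      using Suc form by (intro mult_nonneg_nonpos) auto
    ultimately show ?case using Suc by linarith
  qed (use h in simp)
  obtain d b where db: "is_root d \<epsilon>" "is_root b \<beta>" using assms posroot_root by blast
  let ?N = "{\<gamma>. posroot \<gamma> \<and> val \<gamma> g < 0} \<union> {\<gamma>. posroot \<gamma> \<and> val \<gamma> h < 0}"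
  let ?F = "?N \<union> (\<lambda>\<gamma> x. - \<gamma> x) ` ?N"
  have "?b (Suc k) \<in> ?F" for k
  proof -
    obtain r where r: "is_root r (?b (Suc k))" using root_chain_root[OF db, of k] by blast
    show ?thesis
    proof (cases "val (?b (Suc k)) \<one> > 0")
      case True
      then have "?b (Suc k) \<in> ?N" using r dn[of k] unfolding posroot_def by blast
      then show ?thesis by blast
    next
      case False
      then have "val (\<lambda>x. - ?b (Suc k) x) \<one> > 0" using val_sign(1)[OF r one_closed] by simp
      moreover have "val (\<lambda>x. - ?b (Suc k) x) g < 0" using up[of k] by simp
      ultimately have "(\<lambda>x. - ?b (Suc k) x) \<in> ?N" 
        using root_uminus[OF r] unfolding posroot_def by blast
      then have "(\<lambda>x. - (- ?b (Suc k) x)) \<in> (\<lambda>\<gamma> x. - \<gamma> x) ` ?N" by (rule image_eqI[rotated]) simp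
      then show ?thesis by simp
    qed
  qed
  then have "range (\<lambda>k. ?b (Suc k)) \<subseteq> ?F" by blast
  moreover have "finite ?F" using finite_neg_roots g h by simp
  ultimately have fin: "finite (range (\<lambda>k. ?b (Suc k)))" by (rule finite_subset)
  have "strict_mono (\<lambda>k. val (?b (Suc k)) g)" using up by (simp add: strict_mono_Suc_iff del: root_chain.simps)
  then have "inj (\<lambda>k. ?b (Suc k))" by (metis (mono_tags, lifting) injI strict_mono_eq)
  then show False using fin finite_imageD infinite_UNIV_nat by blast
qed

lemma posroot_reflect:
  assumes "posroot \<gamma>" "posroot \<tau>" "B \<tau> \<gamma> \<le> 0"
  shows "posroot (reflect \<tau> \<gamma>)"
proof -
  obtain r q where "is_root r \<tau>" "is_root q \<gamma>" using assms posroot_root by blast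
  then have "is_root (cj r q) (reflect \<tau> \<gamma>)" by (rule root_reflect)
  moreover have "B \<tau> \<gamma> * val \<tau> \<one> \<le> 0"
    using assms(3) posroot_val_one[OF assms(2)] by (intro mult_nonpos_nonneg) auto
  then have "val (reflect \<tau> \<gamma>) \<one> > 0" using posroot_val_one[OF assms(1)] by (simp add: val_reflect)
  ultimately show ?thesis unfolding posroot_def by blast
qed

text \<open>
  The hypothesis on the form says that the reflection adds a non-negative multiple of \<open>\<tau>\<close> to
  \<open>\<gamma>\<close>. Let \<open>\<gamma>\<close> dominate \<open>\<delta>\<close>. If the reflection adds a non-negative multiple of \<open>\<tau>\<close> to \<open>\<delta>\<close> too,
  then it carries \<open>\<delta>\<close> to a positive root dominated by the image of \<open>\<gamma>\<close>; otherwise that image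
  dominates \<open>\<delta>\<close> itself.
\<close>

lemma nonelementary_reflect:
  assumes \<gamma>: "posroot \<gamma>" and \<tau>: "posroot \<tau>" and form: "B \<tau> \<gamma> \<le> 0" and ne: "nonelementary \<gamma>"
  shows "nonelementary (reflect \<tau> \<gamma>)"
proof -
  obtain \<delta> where \<delta>: "posroot \<delta>" "\<delta> \<noteq> \<gamma>" "dominates \<gamma> \<delta>" using ne unfolding nonelementary_def by blast
  obtain r where r: "is_root r \<tau>" using \<tau> posroot_root by blast
  have rc: "r \<in> carrier W" using r by simp
  have \<gamma>': "val (reflect \<tau> \<gamma>) g = val \<gamma> (r \<otimes> g)" if "g \<in> carrier W" for g
    by (rule val_reflect_eq[OF r that])
  show ?thesis
  proof (cases "B \<tau> \<delta> \<le> 0")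
    case True
    have "reflect \<tau> \<delta> \<noteq> reflect \<tau> \<gamma>" using \<delta>(2) reflect_reflect[of \<tau>] \<tau> by (metis posroot_norm)
    moreover have "dominates (reflect \<tau> \<gamma>) (reflect \<tau> \<delta>)"
      unfolding dominates_def using \<delta>(3) rc val_reflect_eq[OF r] by (simp add: dominates_def)
    ultimately show ?thesis using posroot_reflect[OF \<delta>(1) \<tau> True] unfolding nonelementary_def by blast
  next
    case False
    have "dominates (reflect \<tau> \<gamma>) \<delta>" unfolding dominates_def
    proof (intro ballI impI, rule ccontr)
      fix g assume g: "g \<in> carrier W" "val (reflect \<tau> \<gamma>) g < 0" and n: "\<not> val \<delta> g < 0"
      have dg: "val \<delta> g > 0" using n posroot_val_nonzero[OF \<delta>(1) g(1)] by simp
      have "\<not> val \<gamma> g < 0" using \<delta>(3) g n unfolding dominates_def by blast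
      then have gg: "val \<gamma> g > 0" using posroot_val_nonzero[OF \<gamma> g(1)] by simp
      have "val \<gamma> g - 2 * B \<tau> \<gamma> * val \<tau> g < 0" using g by (simp add: val_reflect)
      then have "B \<tau> \<gamma> * val \<tau> g > 0" using gg by simp
      then have tg: "val \<tau> g < 0" using form by (simp add: zero_less_mult_iff)
      have "B \<tau> \<delta> * val \<tau> g < 0" using False tg by (simp add: mult_less_0_iff)
      then have "val (reflect \<tau> \<delta>) g > 0" using dg by (simp add: val_reflect)
      then have "val \<delta> (r \<otimes> g) > 0" using val_reflect_eq[OF r g(1)] by simp
      then have "\<not> val \<gamma> (r \<otimes> g) < 0" using \<delta>(3) rc g unfolding dominates_def by fastforce
      then show False using g \<gamma>' by simp
    qed
    moreover have "\<delta> \<noteq> reflect \<tau> \<gamma>"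
    proof
      assume e: "\<delta> = reflect \<tau> \<gamma>"
      have "B \<tau> \<delta> = - B \<tau> \<gamma>" using \<tau> by (simp add: e reflect_def)
      then have "B \<tau> \<gamma> < 0" using False by simp
      have "B \<delta> \<gamma> = 1 - 2 * (B \<tau> \<gamma> * B \<tau> \<gamma>)" using \<gamma> by (simp add: e reflect_def)
      moreover have "B \<tau> \<gamma> * B \<tau> \<gamma> > 0" using \<open>B \<tau> \<gamma> < 0\<close> by (simp add: mult_neg_neg)
      ultimately show False using dominates_imp_form[OF \<gamma> \<delta>(1,3)] by linarith
    qed
    ultimately show ?thesis using \<delta>(1) unfolding nonelementary_def by blast
  qed
qed

lemma nonelementary_if_form:
  assumes "posroot \<gamma>" "posroot \<epsilon>" "B \<epsilon> \<gamma> \<ge> 1" "g \<in> carrier W" "val \<epsilon> g < 0" "val \<gamma> g > 0"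
  shows "nonelementary \<gamma>"
  using dominates_if_form[OF assms] assms unfolding nonelementary_def by (metis less_asym)

section \<open>Roots in a plane\<close>

text \<open>
  The angles of the roots in a plane are closed under point reflections, and only finitely many
  of them lie between \<open>z\<close> and \<open>\<pi>/2\<close>, because \<open>g\<close> has finitely many inversions. So they form an
  arithmetic progression with some difference \<open>2 h\<close>; as it contains \<open>z\<close>, \<open>- z\<close> and \<open>\<pi>/2\<close>, these
  are integral multiples of \<open>h\<close>.
\<close>

lemma root_grid:
  assumes on: "orthonormal e f" and rf: "is_root m f" and z: "0 < z" "z < pi / 2"
    and rz: "is_root d (circ e f z)" and g: "g \<in> carrier W"
    and pos: "\<And>y. z \<le> y \<Longrightarrow> y \<le> pi / 2 \<Longrightarrow> val (circ e f y) \<one> > 0 \<and> val (circ e f y) g < 0"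
  shows "\<exists>h j q. h > 0 \<and> j \<ge> 1 \<and> q \<ge> 0 \<and> z = of_int j * h \<and> of_int (j + 2 * q) * h = pi / 2
    \<and> (\<forall>i. \<exists>r. is_root r (circ e f (of_int (j + 2 * i) * h)))"
proof -
  define Y where "Y = {y. \<exists>r. is_root r (circ e f y)}"
  have Yref: "2 * y - y' \<in> Y" if "y \<in> Y" "y' \<in> Y" for y y'
  proof -
    obtain r q where "is_root r (circ e f y)" "is_root q (circ e f y')" using \<open>y \<in> Y\<close> \<open>y' \<in> Y\<close> by (auto simp: Y_def)
    then have "is_root (cj r q) (\<lambda>x. - reflect (circ e f y) (circ e f y') x)" by (intro root_uminus root_reflect)
    then show ?thesis unfolding Y_def by (auto simp: reflect_circ[OF on])
  qed
  have Ypi: "y - pi \<in> Y" if "y \<in> Y" for y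
  proof -
    obtain r where "is_root r (circ e f y)" using \<open>y \<in> Y\<close> by (auto simp: Y_def)
    then have "is_root r (\<lambda>x. - circ e f y x)" by (rule root_uminus)
    moreover have "(\<lambda>x. - circ e f y x) = circ e f (y - pi)"
      using circ_add_pi[of e f "y - pi"] by simp
    ultimately show ?thesis unfolding Y_def by auto
  qed
  have Yz: "z \<in> Y" using rz by (auto simp: Y_def)
  have "circ e f (pi / 2) = f" by (simp add: circ_def)
  then have Yp: "pi / 2 \<in> Y" using rf by (auto simp: Y_def)
  define K where "K = {y \<in> Y. z \<le> y \<and> y \<le> pi / 2}"
  have "circ e f ` K \<subseteq> {\<beta>. posroot \<beta> \<and> val \<beta> g < 0}"
    using pos by (auto simp: K_def Y_def posroot_def)
  then have "finite (circ e f ` K)" using finite_neg_roots[OF g] finite_subset by blast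
  moreover have "inj_on (circ e f) K"
  proof (rule inj_onI)
    fix x y assume xy: "x \<in> K" "y \<in> K" "circ e f x = circ e f y"
    have "B (circ e f u) (circ e f (pi / 2)) = sin u" for u
      unfolding B_circ[OF on] by (simp add: cos_diff)
    then have "sin x = sin y" using xy by metis
    moreover have "- (pi / 2) \<le> x" "- (pi / 2) \<le> y" "x \<le> pi / 2" "y \<le> pi / 2" 
      using xy z by (auto simp: K_def)
    ultimately show "x = y" using sin_inj_pi[of x y] by simp
  qed
  ultimately have finK: "finite K" by (rule finite_imageD)
  have ne: "K - {z} \<noteq> {}" using Yp z by (auto simp: K_def)
  \<comment> \<open>The angle next to \<open>z\<close>. Reflections in \<open>z\<close> and \<open>y1\<close> generate the whole progression.\<close>
  define y1 where "y1 = Min (K - {z})"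
  have y1: "y1 \<in> K" "y1 \<noteq> z" using Min_in[OF _ ne] finK by (auto simp: y1_def)
  have y1min: "y1 \<le> y" if "y \<in> K" "y \<noteq> z" for y using that finK by (auto simp: y1_def)
  have Y1: "y1 \<in> Y" "z < y1" "y1 \<le> pi / 2" using y1 by (auto simp: K_def)
  have gap: "y \<notin> Y" if "z < y" "y < y1" for y
    using y1min[of y] that Y1 by (auto simp: K_def)
  define w where "w = y1 - z"
  have w: "w > 0" using Y1 by (simp add: w_def)
  have Yplus: "y + 2 * w \<in> Y" "y - 2 * w \<in> Y" if "y \<in> Y" for y
  proof -
    have "2 * y1 - (2 * z - y) \<in> Y" "2 * z - (2 * y1 - y) \<in> Y" using \<open>y \<in> Y\<close> Yz Y1 Yref by auto
    then show "y + 2 * w \<in> Y" "y - 2 * w \<in> Y" by (simp_all add: w_def algebra_simps)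
  qed
  have Yeven: "y + 2 * of_int k * w \<in> Y" if "y \<in> Y" for y and k :: int
  proof (induction k rule: int_induct[where k = 0])
    case base
    then show ?case using that by simp
  next
    case (step1 i)
    then show ?case using Yplus(1)[of "y + 2 * of_int i * w"] by (simp add: algebra_simps)
  next
    case (step2 i)
    then show ?case using Yplus(2)[of "y + 2 * of_int i * w"] by (simp add: algebra_simps)
  qed
  have Ygrid: "z + of_int k * w \<in> Y" for k :: int
  proof (cases "even k")
    case True
    then obtain i where "k = 2 * i" by auto
    then show ?thesis using Yeven[OF Yz, of i] by simp
  next
    case False
    then obtain i where "k = 2 * i + 1" by (elim oddE)
    then show ?thesis using Yeven[OF Y1(1), of i] by (simp add: w_def algebra_simps)
  qed
  have grid: "\<exists>k::int. y = z + of_int k * w" if y: "y \<in> Y" for y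
  proof -
    define k where "k = \<lfloor>(y - z) / w\<rfloor>"
    define t where "t = y - z - of_int k * w"
    have "of_int k \<le> (y - z) / w" "(y - z) / w < of_int k + 1" unfolding k_def by linarith+
    then have t: "0 \<le> t" "t < w" using w by (auto simp: t_def field_simps)
    have "t = 0"
    proof (cases "even k")
      case True
      then obtain i where k: "k = 2 * i" by auto
      have "y + 2 * of_int (- i) * w \<in> Y" by (rule Yeven[OF y])
      then have "z + t \<in> Y" by (simp add: t_def k algebra_simps)
      then show ?thesis using gap[of "z + t"] t by (cases "t = 0") (auto simp: w_def)
    next
      case False
      then obtain i where k: "k = 2 * i + 1" by (elim oddE)
      have "2 * (z + of_int (i + 1) * w) - y \<in> Y" by (rule Yref[OF Ygrid y])
      then have "z + (w - t) \<in> Y" by (simp add: t_def k algebra_simps)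
      then show ?thesis using gap[of "z + (w - t)"] t by (cases "t = 0") (auto simp: w_def)
    qed
    then show ?thesis by (intro exI[of _ k]) (simp add: t_def)
  qed
  \<comment> \<open>This element is \<open>- z\<close>: reflect \<open>z\<close> in \<open>\<pi>/2\<close>, then pass to the negative root.\<close>
  have "2 * (pi / 2) - z - pi \<in> Y" by (intro Ypi Yref Yp Yz)
  then obtain k where "2 * (pi / 2) - z - pi = z + of_int k * w" using grid by blast
  then have k: "2 * z = of_int (- k) * w" by simp
  obtain q where q: "pi / 2 = z + of_int q * w" using grid[OF Yp] by blast
  define h where "h = w / 2"
  have h: "h > 0" using w by (simp add: h_def)
  have zk: "z = of_int (- k) * h" using k by (simp add: h_def)
  have "of_int (- k) * h > 0" using zk z by simp
  then have "(of_int (- k) :: real) > 0" using h by (rule zero_less_mult_pos2)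
  then have k1: "- k \<ge> 1" by simp
  have "of_int q * w > 0" using q z by simp
  then have "(of_int q :: real) > 0" using w by (rule zero_less_mult_pos2)
  then have q0: "q \<ge> 0" by simp
  have eq: "of_int (- k + 2 * i) * h = z + of_int i * w" for i
    using zk by (simp add: h_def algebra_simps)
  have "\<exists>r. is_root r (circ e f (of_int (- k + 2 * i) * h))" for i
    using Ygrid[of i] unfolding eq Y_def by simp
  then show ?thesis using h k1 q0 zk eq[of q] q by (intro exI[of _ h] exI[of _ "- k"] exI[of _ q]) auto
qed

text \<open>
  Here \<open>\<rho>\<close> and \<open>circ \<rho> \<mu> (pi - a)\<close> are the extreme roots of a residue with \<open>2 l\<close> reflections,
  \<open>\<mu>\<close> is its root orthogonal to \<open>\<rho>\<close>, and \<open>circ \<rho> \<mu> a\<close> is its root next to \<open>\<rho>\<close>. The conclusion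
  concerns a root that is not conjugate to \<open>\<rho>\<close> in the residue. The element \<open>g\<close> serves to tell,
  by \<open>dominates_if_form\<close>, which of two roots is the dominating one.
\<close>

lemma nonelementary_even_acute:
  fixes l :: nat
  assumes l: "l \<ge> 2" and a: "a = pi / (2 * real l)"
    and \<rho>: "posroot \<rho>" and \<mu>: "posroot \<mu>" and ort: "B \<rho> \<mu> = 0"
    and \<gamma>: "posroot (circ \<rho> \<mu> a)" and \<rho>2: "posroot (circ \<rho> \<mu> (pi - a))"
    and \<delta>: "posroot \<delta>" and f: "B \<delta> \<rho> \<ge> 1" and c: "B \<delta> \<mu> \<ge> 0"
    and g: "g \<in> carrier W" "val \<mu> g < 0" "val (circ \<rho> \<mu> (pi - a)) g < 0" "val \<delta> g < 0"
      "val (circ \<rho> \<mu> a) g > 0"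
  shows "nonelementary (circ \<rho> \<mu> a)"
proof -
  have a0: "0 < a" "a \<le> pi / 4" using l by (auto simp: a field_simps)
  have ca: "0 < cos a" "0 < sin a" using a0 by (auto intro!: cos_gt_zero_pi sin_gt_zero)
  have sc: "cos a * cos a + sin a * sin a = 1"
    using sin_cos_squared_add[of a] by (simp add: power2_eq_square)
  have main: "nonelementary (circ \<rho> \<mu> a)" 
    if "posroot \<epsilon>" "B \<epsilon> (circ \<rho> \<mu> a) \<ge> 1" "val \<epsilon> g < 0" for \<epsilon>
    by (rule nonelementary_if_form[OF \<gamma> that(1,2) g(1) that(3) g(5)])
  have Bg: "B v (circ \<rho> \<mu> a) = cos a * B v \<rho> + sin a * B v \<mu>" for v by (simp add: circ_def)
  \<comment> \<open>The walls of \<open>\<delta>\<close> and \<open>\<mu>\<close> are disjoint, orthogonal, or cross at an acute angle. The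
    dominated root is \<open>\<delta>\<close> itself, the image of \<open>circ \<rho> \<mu> (pi - a)\<close> under the reflection in \<open>\<delta>\<close>,
    or a root between \<open>\<delta>\<close> and \<open>\<mu>\<close> in their plane.\<close>
  consider "B \<delta> \<mu> \<ge> 1" | "B \<delta> \<mu> = 0" | "0 < B \<delta> \<mu>" "B \<delta> \<mu> < 1" using c by linarith
  then show ?thesis
  proof cases
    case 1
    have "1 \<le> cos a + sin a"
    proof -
      have "cos a * cos a \<le> cos a * 1" "sin a * sin a \<le> sin a * 1" using ca by (intro mult_left_mono; simp)+
      then show ?thesis using sc by linarith
    qed
    also have "\<dots> \<le> cos a * B \<delta> \<rho> + sin a * B \<delta> \<mu>"
      using f 1 ca by (intro add_mono) (auto simp: mult_le_cancel_left1)
    finally show ?thesis using main[OF \<delta>] g Bg by simp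
  next
    case 2
    let ?\<rho>2 = "circ \<rho> \<mu> (pi - a)"
    have b: "B \<delta> ?\<rho>2 = - (cos a * B \<delta> \<rho>)" using 2 by (simp add: circ_def)
    have b0: "B \<delta> ?\<rho>2 \<le> 0" unfolding b using ca f by simp
    have p: "posroot (reflect \<delta> ?\<rho>2)" by (rule posroot_reflect[OF \<rho>2 \<delta> b0])
    have "B \<delta> ?\<rho>2 * val \<delta> g \<ge> 0" using b0 g by (intro mult_nonpos_nonpos) auto
    then have n: "val (reflect \<delta> ?\<rho>2) g < 0" using g by (simp add: val_reflect)
    have "B (reflect \<delta> ?\<rho>2) (circ \<rho> \<mu> a) 
       = sin a * sin a - cos a * cos a + 2 * (cos a * cos a) * (B \<delta> \<rho> * B \<delta> \<rho>)"
      using 2 \<rho> \<mu> ort B_sym[of \<mu> \<rho>] by (simp add: reflect_def b) (simp add: circ_def algebra_simps)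
    moreover have "2 * (cos a * cos a) * 1 \<le> 2 * (cos a * cos a) * (B \<delta> \<rho> * B \<delta> \<rho>)"
    proof (intro mult_left_mono)
      show "1 \<le> B \<delta> \<rho> * B \<delta> \<rho>" using mult_mono[of 1 "B \<delta> \<rho>" 1 "B \<delta> \<rho>"] f by simp
    qed auto
    ultimately have "B (reflect \<delta> ?\<rho>2) (circ \<rho> \<mu> a) \<ge> 1" using sc by linarith
    then show ?thesis using main[OF p] n by blast
  next
    case 3
    define z where "z = arcsin (B \<delta> \<mu>)"
    have sz: "sin z = B \<delta> \<mu>" using 3 by (simp add: z_def)
    have z: "0 < z" "z < pi / 2" using 3 arcsin_less_mono[of 0 "B \<delta> \<mu>"] arcsin_less_mono[of "B \<delta> \<mu>" 1] 
      by (auto simp: z_def)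
    have cz: "cos z > 0" using z by (intro cos_gt_zero_pi) auto
    have scz: "cos z * cos z = 1 - sin z * sin z"
      using sin_cos_squared_add[of z] by (simp add: power2_eq_square)
    define \<nu> where "\<nu> = (\<lambda>x. (\<delta> x - sin z * \<mu> x) / cos z)"
    have "B \<nu> \<nu> = (1 - sin z * sin z) / (cos z * cos z)"
      unfolding \<nu>_def B_left B_right using \<delta> \<mu> B_sym[of \<mu> \<delta>] sz by (simp add: field_simps)
    then have "B \<nu> \<nu> = 1" unfolding scz[symmetric] using cz by simp
    moreover have "B \<nu> \<mu> = 0" using \<mu> sz by (simp add: \<nu>_def)
    ultimately have on: "orthonormal \<nu> \<mu>" using \<mu> by (simp add: orthonormal_def)
    obtain m d where m: "is_root m \<mu>" and d: "is_root d \<delta>" using \<mu> \<delta> posroot_root by blast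
    have cz\<delta>: "circ \<nu> \<mu> z = \<delta>" using cz by (auto simp: circ_def \<nu>_def)
    have vc: "val (circ \<nu> \<mu> y) h = (cos y * val \<delta> h + sin (y - z) * val \<mu> h) / cos z" for y h
      using cz by (simp add: circ_def \<nu>_def sin_diff) (simp add: field_simps)
    have pos: "val (circ \<nu> \<mu> y) \<one> > 0 \<and> val (circ \<nu> \<mu> y) g < 0" if y: "z \<le> y" "y \<le> pi / 2" for y
    proof (cases "y = pi / 2")
      case True
      have "circ \<nu> \<mu> y = \<mu>" unfolding True by (simp add: circ_def)
      then show ?thesis using posroot_val_one[OF \<mu>] g by simp
    next
      case False
      have "cos y > 0" using y z False by (intro cos_gt_zero_pi) auto
      moreover have "sin (y - z) \<ge> 0" using y z by (intro sin_ge_zero) auto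
      ultimately have "cos y * val \<delta> \<one> + sin (y - z) * val \<mu> \<one> > 0" 
        "cos y * val \<delta> g + sin (y - z) * val \<mu> g < 0"
        using posroot_val_one[OF \<mu>] posroot_val_one[OF \<delta>] g
        by (auto intro!: add_pos_nonneg add_neg_nonpos mult_pos_neg mult_nonneg_nonpos)
      then show ?thesis unfolding vc using cz by (simp add: divide_neg_pos)
    qed
    have rz: "is_root d (circ \<nu> \<mu> z)" using d cz\<delta> by simp
    obtain h j q where hjq: "h > 0" "j \<ge> 1" "q \<ge> 0" "z = of_int j * h" "of_int (j + 2 * q) * h = pi / 2"
      and roots: "\<And>i. \<exists>r. is_root r (circ \<nu> \<mu> (of_int (j + 2 * i) * h))"
      using root_grid[OF on m z rz g(1) pos] by blast
    obtain i where i: "0 \<le> i" "i \<le> q" 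
      "cos a * cos (of_int (j + 2 * i) * h) / cos (of_int j * h) + sin a * sin (of_int (j + 2 * i) * h) \<ge> 1"
      using angle_grid[OF l a hjq(1-3,5)] z(2) hjq(4) by auto
    define y where "y = of_int (j + 2 * i) * h"
    have "of_int j * h \<le> of_int (j + 2 * i) * h" using i hjq by (intro mult_right_mono) auto
    then have y1: "z \<le> y" using hjq by (simp add: y_def)
    have "of_int (j + 2 * i) * h \<le> of_int (j + 2 * q) * h" using i hjq by (intro mult_right_mono) auto
    then have y2: "y \<le> pi / 2" unfolding y_def[symmetric] hjq(5) .
    have cy: "cos y \<ge> 0" using y1 y2 z by (intro cos_ge_zero) auto
    have e: "posroot (circ \<nu> \<mu> y)" unfolding posroot_def using roots[of i] pos[OF y1 y2] y_def by auto
    have "B (circ \<nu> \<mu> y) (circ \<rho> \<mu> a) = cos a * cos y * B \<delta> \<rho> / cos z + sin a * sin y"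
      unfolding Bg using \<mu> ort B_sym[of \<mu> \<rho>] on
      by (simp add: circ_def orthonormal_def) (simp add: \<nu>_def B_sym[of \<mu> \<rho>])
    moreover have "cos a * cos y * 1 \<le> cos a * cos y * B \<delta> \<rho>" using f ca cy by (intro mult_left_mono) auto
    then have "cos a * cos y / cos z \<le> cos a * cos y * B \<delta> \<rho> / cos z" 
      using cz by (intro divide_right_mono) auto
    ultimately have "B (circ \<nu> \<mu> y) (circ \<rho> \<mu> a) \<ge> 1"
      using i(3) hjq(4) unfolding y_def[symmetric] by simp
    then show ?thesis using main[OF e] pos[OF y1 y2] by blast
  qed
qed

text \<open>
  If the form is negative on \<open>\<delta>\<close> and \<open>\<mu>\<close>, replace \<open>\<delta>\<close> by its image under the reflection in \<open>\<mu>\<close>,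
  which fixes \<open>\<rho>\<close>.
\<close>

lemma nonelementary_even:
  fixes l :: nat
  assumes l: "l \<ge> 2" and a: "a = pi / (2 * real l)"
    and \<rho>: "posroot \<rho>" and \<mu>: "posroot \<mu>" and ort: "B \<rho> \<mu> = 0"
    and \<gamma>: "posroot (circ \<rho> \<mu> a)" and \<rho>2: "posroot (circ \<rho> \<mu> (pi - a))"
    and \<delta>: "posroot \<delta>" and f: "B \<delta> \<rho> \<ge> 1"
    and g: "g \<in> carrier W" "val \<mu> g < 0" "val (circ \<rho> \<mu> (pi - a)) g < 0" "val \<delta> g < 0"
      "val (circ \<rho> \<mu> a) g > 0"
  shows "nonelementary (circ \<rho> \<mu> a)"
proof (cases "B \<delta> \<mu> \<ge> 0")
  case True
  then show ?thesis using nonelementary_even_acute[OF l a \<rho> \<mu> ort \<gamma> \<rho>2 \<delta> f _ g] by blast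
next
  case False
  have b: "B \<mu> \<delta> \<le> 0" using False B_sym[of \<mu> \<delta>] by simp
  have p: "posroot (reflect \<mu> \<delta>)" by (rule posroot_reflect[OF \<delta> \<mu> b])
  have f': "B (reflect \<mu> \<delta>) \<rho> \<ge> 1" using f ort B_sym[of \<mu> \<rho>] by (simp add: reflect_def)
  have c': "B (reflect \<mu> \<delta>) \<mu> \<ge> 0" using b \<mu> B_sym[of \<mu> \<delta>] by (simp add: reflect_def)
  have "B \<mu> \<delta> * val \<mu> g \<ge> 0" using b g by (intro mult_nonpos_nonpos) auto
  then have "val (reflect \<mu> \<delta>) g < 0" using g by (simp add: val_reflect)
  then show ?thesis using nonelementary_even_acute[OF l a \<rho> \<mu> ort \<gamma> \<rho>2 p f' c' g(1-3)] g(5) by blast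
qed

section \<open>Elementary reflections in rank two residues\<close>

text \<open>
  No wall separates the wall of \<open>r\<close> from \<open>1\<close>; see \<open>close_to_0_iff\<close> for the agreement with
  \<open>0\<close>-closeness.
\<close>

definition elementary :: "'a \<Rightarrow> bool" where
  "elementary r \<longleftrightarrow> \<not> (\<exists>q \<in> reflections W S. q \<noteq> r \<and>
     (\<forall>g \<in> carrier W. r \<in> inversions g \<longrightarrow> q \<in> inversions g))"

lemma elementary_root:
  assumes r: "is_root r \<beta>" and \<beta>: "posroot \<beta>"
  shows "elementary r \<longleftrightarrow> \<not> nonelementary \<beta>"
proof -
  have 1: "dominates \<beta> \<delta> \<longleftrightarrow> (\<forall>g \<in> carrier W. r \<in> inversions g \<longrightarrow> q \<in> inversions g)"
    if "is_root q \<delta>" "posroot \<delta>" for q \<delta>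
    using posroot_inversion[OF r \<beta>] posroot_inversion[OF that] unfolding dominates_def by simp
  show ?thesis
  proof
    assume e: "elementary r"
    show "\<not> nonelementary \<beta>"
    proof
      assume "nonelementary \<beta>"
      then obtain \<delta> where \<delta>: "posroot \<delta>" "\<delta> \<noteq> \<beta>" "dominates \<beta> \<delta>" unfolding nonelementary_def by blast
      obtain q where q: "is_root q \<delta>" using \<delta> posroot_root by blast
      have "q \<noteq> r" using posroot_unique[of r \<beta> \<delta>] r \<beta> \<delta> q by auto
      then show False using e 1[OF q \<delta>(1)] \<delta>(3) root_reflection[OF q] unfolding elementary_def by blast
    qed
  next
    assume n: "\<not> nonelementary \<beta>"
    show "elementary r" unfolding elementary_def
    proof
      assume "\<exists>q\<in>reflections W S. q \<noteq> r \<and> (\<forall>g\<in>carrier W. r \<in> inversions g \<longrightarrow> q \<in> inversions g)"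
      then obtain q where q: "q \<in> reflections W S" "q \<noteq> r" 
        "\<forall>g\<in>carrier W. r \<in> inversions g \<longrightarrow> q \<in> inversions g" by blast
      obtain \<delta> where \<delta>: "is_root q \<delta>" "posroot \<delta>" using reflection_posroot[OF q(1)] by blast
      have "\<delta> \<noteq> \<beta>"
      proof
        assume "\<delta> = \<beta>"
        then have "r = q"
          using posroot_inversion[OF r \<beta>] posroot_inversion[OF \<delta>] 
          by (intro reflection_eqI root_reflection[OF r] reflection_closed[OF q(1)]) auto
        then show False using q by simp
      qed
      then show False using n 1[OF \<delta>] q(3) \<delta>(2) unfolding nonelementary_def by blast
    qed
  qed
qed

text \<open>
  The root of \<open>w s w\<^sup>-\<^sup>1\<close> that is negative at \<open>w\<close>. It is positive if \<open>s\<close> is a right descent of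
  \<open>w\<close>.
\<close>

definition rho :: "'a \<Rightarrow> 'a \<Rightarrow> 'a \<Rightarrow> real" where
  "rho w s = (\<lambda>x. - act w (\<alpha> s) x)"

text \<open>
  The unit circle in the plane of \<open>rho w s\<close>, at angle \<open>0\<close>, and \<open>rho w t\<close>, at angle \<open>\<pi> - \<pi>/n\<close>,
  where \<open>n\<close> is the order of \<open>s t\<close>.
\<close>

definition residue_root :: "'a \<Rightarrow> 'a \<Rightarrow> 'a \<Rightarrow> real \<Rightarrow> 'a \<Rightarrow> real" where
  "residue_root w s t = circ (rho w s) (perp_vec (pi / real (ord (s \<otimes> t))) (rho w s) (rho w t))"

text \<open>
  The reflections that cross the residue of \<open>w\<close>, in the order in which the path \<open>w, w s, w s t,
  \<dots>\<close> crosses their walls. The root of the \<open>i\<close>-th one is at angle \<open>i \<pi>/n\<close> (\<open>residue_refl_root\<close>).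
\<close>

definition residue_refl :: "'a \<Rightarrow> 'a \<Rightarrow> 'a \<Rightarrow> nat \<Rightarrow> 'a" where
  "residue_refl w s t i = cj w ((s \<otimes> t) [^] i \<otimes> s)"

lemma rho_root: "w \<in> carrier W \<Longrightarrow> s \<in> S \<Longrightarrow> is_root (cj w s) (rho w s)"
  unfolding rho_def by (intro root_uminus) (auto simp: is_root_def)

lemma rho_posroot:
  assumes "w \<in> carrier W" "s \<in> S" "cj w s \<in> inversions w"
  shows "posroot (rho w s)"
proof -
  have "val (rho w s) \<one> > 0" using ht_sign[of w s] assms by (simp add: rho_def val_def)
  then show ?thesis using rho_root assms unfolding posroot_def by blast
qed

lemma val_rho: "w \<in> carrier W \<Longrightarrow> s \<in> S \<Longrightarrow> val (rho w s) w = - 1"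
  by (simp add: rho_def val_def)

lemma B_rho: "w \<in> carrier W \<Longrightarrow> s \<in> S \<Longrightarrow> t \<in> S \<Longrightarrow> B (rho w s) (rho w t) = gram s t"
  by (simp add: rho_def)

context
  fixes w s t
  assumes w: "w \<in> carrier W" and st: "s \<in> S" "t \<in> S" "s \<noteq> t"
    and ds: "cj w s \<in> inversions w" and dt: "cj w t \<in> inversions w"
begin

text \<open>
  If \<open>s t\<close> had infinite order, all combinations \<open>k (rho w t) + (k - 1) (rho w s)\<close> with \<open>k \<ge> 1\<close>
  would be roots of inversions of \<open>w\<close>, which are finitely many.
\<close>

lemma two_descents_ord: "ord (s \<otimes> t) \<ge> 2"
proof (cases "ord (s \<otimes> t) = 0")
  case True
  define b where "b = root_chain (\<lambda>x. - rho w s x) (rho w t)"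
  have B1: "B (rho w s) (rho w t) = - 1"
    using st w True by (simp add: B_rho gram_def)
  have v: "val (b k) g = - val (rho w s) g + real k * (val (rho w t) g + val (rho w s) g) \<and>
     val (b (Suc k)) g = - val (rho w s) g + real (Suc k) * (val (rho w t) g + val (rho w s) g)" for k g
    by (induction k) (simp_all add: b_def B1 algebra_simps)
  have "b (Suc k) \<in> {\<beta>. posroot \<beta> \<and> val \<beta> w < 0}" for k
  proof -
    have p: "val (rho w s) \<one> > 0" "val (rho w t) \<one> > 0"
      using rho_posroot[OF w st(1) ds] rho_posroot[OF w st(2) dt] by (auto simp: posroot_val_one)
    have "val (b (Suc k)) \<one> = val (rho w t) \<one> + real k * (val (rho w t) \<one> + val (rho w s) \<one>)"
      using v[of k \<one>] by (simp add: algebra_simps)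
    then have "val (b (Suc k)) \<one> > 0" using p by (simp add: add_pos_nonneg)
    moreover have "\<exists>r. is_root r (b (Suc k))"
      using root_chain_root[OF root_uminus[OF rho_root[OF w st(1)]] rho_root[OF w st(2)], of k] by (simp add: b_def)
    moreover have "val (b (Suc k)) w < 0"
      using v[of k w] st w by (simp add: val_rho)
    ultimately show ?thesis unfolding posroot_def by blast
  qed
  then have "range (\<lambda>k. b (Suc k)) \<subseteq> {\<beta>. posroot \<beta> \<and> val \<beta> w < 0}" by blast
  then have fin: "finite (range (\<lambda>k. b (Suc k)))" using finite_neg_roots[OF w] finite_subset by blast
  have "inj (\<lambda>k. b (Suc k))"
  proof (rule injI)
    fix i j assume "b (Suc i) = b (Suc j)"
    then have "val (b (Suc i)) w = val (b (Suc j)) w" by simp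
    then show "i = j" using v[of i w] v[of j w] st w by (simp add: val_rho)
  qed
  then show ?thesis using fin finite_imageD infinite_UNIV_nat by blast
next
  case False
  then show ?thesis using ord_gens_ge_2 st by blast
qed

text \<open>
  The angle between consecutive roots of the residue.
\<close>

definition ang :: real where "ang = pi / real (ord (s \<otimes> t))"

lemma ang: "0 < ang" "ang \<le> pi / 2" "real (ord (s \<otimes> t)) * ang = pi" "sin ang > 0"
proof -
  show 1: "0 < ang" "ang \<le> pi / 2" "real (ord (s \<otimes> t)) * ang = pi"
    using two_descents_ord by (auto simp: ang_def field_simps)
  show "sin ang > 0" using 1 by (intro sin_gt_zero) auto
qed

lemma resplane:
  "orthonormal (rho w s) (perp_vec ang (rho w s) (rho w t))"
  "residue_root w s t = circ (rho w s) (perp_vec ang (rho w s) (rho w t))"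
  "residue_root w s t 0 = rho w s" "residue_root w s t (pi - ang) = rho w t"
proof -
  show e: "residue_root w s t = circ (rho w s) (perp_vec ang (rho w s) (rho w t))"
    by (simp add: residue_root_def ang_def)
  have "B (rho w s) (rho w t) = - cos ang"
    using st w two_descents_ord by (simp add: B_rho gram_def ang_def)
  then show "orthonormal (rho w s) (perp_vec ang (rho w s) (rho w t))"
    "residue_root w s t 0 = rho w s" "residue_root w s t (pi - ang) = rho w t"
    unfolding e using plane_of_pair[of "rho w s" "rho w t" ang] ang(4) st w by (auto simp: B_rho)
qed

lemma residue_root_val:
  "val (residue_root w s t \<theta>) g = (sin (ang + \<theta>) * val (rho w s) g + sin \<theta> * val (rho w t) g) / sin ang"
proof -
  have "val (residue_root w s t \<theta>) g = cos \<theta> * val (rho w s) g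
      + sin \<theta> * ((val (rho w t) g + cos ang * val (rho w s) g) / sin ang)"
    by (simp add: resplane circ_def perp_vec_def)
  then show ?thesis using ang(4) by (simp add: sin_add field_simps)
qed

lemma residue_refl_step: "cj (residue_refl w s t (Suc i)) (residue_refl w s t i) = residue_refl w s t (Suc (Suc i))"
proof -
  let ?x = "s \<otimes> t"
  have x: "?x \<in> carrier W" using st by auto
  have sx: "s \<otimes> inv ?x = ?x \<otimes> s" using st by (simp add: inv_mult_group m_assoc)
  have c: "cj (cj w u) (cj w v) = cj w (cj u v)" if "u \<in> carrier W" "v \<in> carrier W" for u v
    using w that by (simp add: cj_def m_assoc inv_mult_group) (simp add: m_assoc[symmetric])
  define L where "L = cj (?x [^] Suc i \<otimes> s) (?x [^] i \<otimes> s)"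
  have "L = ?x [^] Suc i \<otimes> s \<otimes> ?x [^] i \<otimes> inv (?x [^] Suc i)"
    using x st by (simp add: L_def cj_def m_assoc inv_mult_group del: nat_pow_Suc)
  also have "?x [^] Suc i = ?x \<otimes> ?x [^] i" using nat_pow_Suc2[OF x] .
  also have "inv (?x \<otimes> ?x [^] i) = inv (?x [^] i) \<otimes> inv ?x" using x by (simp add: inv_mult_group)
  also have "?x \<otimes> ?x [^] i \<otimes> s \<otimes> ?x [^] i \<otimes> (inv (?x [^] i) \<otimes> inv ?x) 
     = ?x \<otimes> ?x [^] i \<otimes> s \<otimes> (?x [^] i \<otimes> inv (?x [^] i)) \<otimes> inv ?x"
    using x st by (simp only: m_assoc m_closed nat_pow_closed inv_closed gen_closed)
  also have "\<dots> = ?x \<otimes> ?x [^] i \<otimes> (s \<otimes> inv ?x)" using x st by (simp add: m_assoc)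
  also have "\<dots> = ?x \<otimes> ?x [^] i \<otimes> ?x \<otimes> s" unfolding sx using x st by (simp add: m_assoc)
  also have "\<dots> = ?x [^] Suc (Suc i) \<otimes> s" using nat_pow_Suc2[OF x, of i] by simp
  finally show ?thesis
    unfolding residue_refl_def L_def using c x st by (simp del: nat_pow_Suc)
qed

lemma residue_refl_root: "is_root (residue_refl w s t i) (residue_root w s t (real i * ang))"
proof -
  let ?U = "residue_root w s t"
  have r: "reflect (?U a) (?U b) = (\<lambda>x. - ?U (2 * a - b) x)" for a b
    unfolding resplane(2) by (rule reflect_circ[OF resplane(1)])
  have "is_root (residue_refl w s t i) (?U (real i * ang)) 
    \<and> is_root (residue_refl w s t (Suc i)) (?U (real (Suc i) * ang))"
  proof (induction i)
    case 0
    have 1: "is_root (residue_refl w s t 0) (?U 0)" 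
      using rho_root[OF w st(1)] st by (simp add: residue_refl_def resplane(3))
    have "cj (cj w s) (cj w t) = residue_refl w s t 1"
      using w st by (simp add: residue_refl_def cj_def m_assoc inv_mult_group) (simp add: m_assoc[symmetric])
    then have "is_root (residue_refl w s t 1) (reflect (?U 0) (?U (pi - ang)))"
      using root_reflect[OF rho_root[OF w st(1)] rho_root[OF w st(2)]] by (simp add: resplane(3,4))
    moreover have "reflect (?U 0) (?U (pi - ang)) = ?U ang"
      unfolding r using circ_add_pi[of "rho w s" _ "ang - pi"] by (simp add: resplane(2))
    ultimately show ?case using 1 by simp
  next
    case (Suc i)
    have e: "2 * (real (Suc i) * ang) - real i * ang = real (Suc (Suc i)) * ang"
      by (simp add: algebra_simps)
    have "is_root (cj (residue_refl w s t (Suc i)) (residue_refl w s t i)) (reflect (?U (real (Suc i) * ang)) (?U (real i * ang)))"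
      using Suc by (intro root_reflect) auto
    then show ?case using Suc root_uminus unfolding r e residue_refl_step by fastforce
  qed
  then show ?thesis by blast
qed

lemma residue_root_pos:
  assumes "i < ord (s \<otimes> t)"
  shows "posroot (residue_root w s t (real i * ang))" "val (residue_root w s t (real i * ang)) w < 0"
proof -
  have "real (Suc i) * ang \<le> real (ord (s \<otimes> t)) * ang" using assms ang by (intro mult_right_mono) auto
  then have i: "ang + real i * ang \<le> pi" using ang(3) by (simp add: algebra_simps)
  have s1: "sin (ang + real i * ang) \<ge> 0" "sin (real i * ang) \<ge> 0"
    using i ang(1) by (auto intro!: sin_ge_zero)
  have s2: "sin (ang + real i * ang) > 0 \<or> sin (real i * ang) > 0"
  proof (cases "i = 0")
    case True then show ?thesis using ang(4) by simp
  next
    case False then show ?thesis using i ang(1) by (intro disjI2 sin_gt_zero) auto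
  qed
  have p: "val (rho w s) \<one> > 0" "val (rho w t) \<one> > 0"
    using rho_posroot[OF w st(1) ds] rho_posroot[OF w st(2) dt] by (auto simp: posroot_val_one)
  have "sin (ang + real i * ang) * val (rho w s) \<one> + sin (real i * ang) * val (rho w t) \<one> > 0"
    using s1 s2 p by (auto intro: add_pos_nonneg add_nonneg_pos)
  then have "val (residue_root w s t (real i * ang)) \<one> > 0" unfolding residue_root_val using ang(4) by simp
  then show "posroot (residue_root w s t (real i * ang))" using residue_refl_root unfolding posroot_def by blast
  show "val (residue_root w s t (real i * ang)) w < 0"
    unfolding residue_root_val using s1 s2 ang(4) w st by (auto simp: val_rho divide_neg_pos)
qed

lemma residue_refl_inversion: "i < ord (s \<otimes> t) \<Longrightarrow> residue_refl w s t i \<in> inversions w"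
  using posroot_inversion[OF residue_refl_root] residue_root_pos w by blast

lemma B_residue_root: "B (residue_root w s t a) (residue_root w s t b) = cos (a - b)"
  unfolding resplane(2) by (rule B_circ[OF resplane(1)])

lemma residue_refl_inj: 
  assumes "i < ord (s \<otimes> t)" "j < ord (s \<otimes> t)" "residue_refl w s t i = residue_refl w s t j"
  shows "i = j"
proof -
  have "residue_root w s t (real i * ang) = residue_root w s t (real j * ang)"
    using posroot_unique residue_refl_root residue_root_pos assms by metis
  then have "cos (real i * ang - 0) = cos (real j * ang - 0)" using B_residue_root by metis
  then have c: "cos (real i * ang) = cos (real j * ang)" by simp
  have le: "real k * ang \<le> pi" if "k < ord (s \<otimes> t)" for k
    using mult_right_mono[of "real k" "real (ord (s \<otimes> t))" ang] that ang(1) unfolding ang(3) by simp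
  have "0 \<le> real i * ang" "0 \<le> real j * ang" using ang(1) by simp_all
  then have "real i * ang = real j * ang" using cos_inj_pi le[OF assms(1)] le[OF assms(2)] c by blast
  then show ?thesis using ang(1) by simp
qed

lemma residue_refl_ends: "residue_refl w s t 0 = cj w s" "residue_refl w s t (ord (s \<otimes> t) - 1) = cj w t"
  using pow_ord_minus_one[of s t] two_descents_ord st by (simp_all add: residue_refl_def)

lemma inversions_alt_prod:
  "i \<le> ord (s \<otimes> t) \<Longrightarrow> inversions (w \<otimes> alt_prod s t i) = inversions w - residue_refl w s t ` {..<i}"
proof (induction i)
  case (Suc i)
  define z where "z = (if even i then s else t)"
  have z: "z \<in> S" using st by (simp add: z_def)
  have c: "w \<otimes> alt_prod s t i \<in> carrier W" using w st by auto
  have e: "cj (w \<otimes> alt_prod s t i) z = residue_refl w s t i"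
    unfolding residue_refl_def cj_alt_prod[OF st(1,2), symmetric] z_def[symmetric]
    using w st z by (simp add: cj_cj)
  have "residue_refl w s t i \<notin> residue_refl w s t ` {..<i}"
  proof
    assume "residue_refl w s t i \<in> residue_refl w s t ` {..<i}"
    then obtain j where "j < i" "residue_refl w s t i = residue_refl w s t j" by blast
    then show False using residue_refl_inj[of i j] Suc.prems by simp
  qed
  then have "cj (w \<otimes> alt_prod s t i) z \<in> inversions (w \<otimes> alt_prod s t i)"
    unfolding e using Suc residue_refl_inversion[of i] by simp
  moreover have "w \<otimes> alt_prod s t (Suc i) = w \<otimes> alt_prod s t i \<otimes> z"
    using w st z by (simp add: z_def m_assoc)
  ultimately have "inversions (w \<otimes> alt_prod s t (Suc i)) = inversions (w \<otimes> alt_prod s t i) - {residue_refl w s t i}"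
    using down_gen(1)[OF c z] e by simp
  then show ?case using Suc by (auto simp: lessThan_Suc)
qed (use w in simp)

text \<open>
  For odd \<open>n\<close>, the reflection in the root at angle \<open>(n + 1) \<pi>/(2 n)\<close> maps the root at angle \<open>0\<close>
  to that at angle \<open>\<pi>/n\<close>. For even \<open>n\<close> the two roots are not conjugate in the residue, and
  \<open>nonelementary_even\<close> is needed. It is used with \<open>g = w s t\<close>, whose inversions are those of \<open>w\<close>
  except for the first two reflections of the residue.
\<close>

lemma bipodal_second:
  assumes n3: "ord (s \<otimes> t) \<ge> 3" and ne: "nonelementary (rho w s)"
  shows "nonelementary (residue_root w s t ang)"
proof -
  let ?U = "residue_root w s t" and ?n = "ord (s \<otimes> t)"
  have \<rho>: "posroot (rho w s)" by (rule rho_posroot[OF w st(1) ds])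
  show ?thesis
  proof (cases "odd ?n")
    case True
    then obtain k where k: "?n = 2 * k + 1" by (elim oddE)
    have kn: "Suc k < ?n" using k n3 by simp
    have e: "2 * (real (Suc k) * ang) = pi + ang" using ang(3) k by (simp add: algebra_simps)
    have "B (?U (real (Suc k) * ang)) (rho w s) = cos (real (Suc k) * ang)"
      using B_residue_root[of "real (Suc k) * ang" 0] resplane(3) by simp
    also have "\<dots> \<le> 0"
    proof -
      have "pi / 2 \<le> real (Suc k) * ang" "real (Suc k) * ang \<le> pi" 
        using e ang(1,2) by auto
      then show ?thesis using cos_monotone_0_pi_le[of "pi/2" "real (Suc k) * ang"] by simp
    qed
    finally have "nonelementary (reflect (?U (real (Suc k) * ang)) (rho w s))"
      using nonelementary_reflect[OF \<rho> residue_root_pos(1)[OF kn] _ ne] by blast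
    moreover have "reflect (?U (real (Suc k) * ang)) (rho w s) = ?U ang"
    proof -
      have "reflect (?U (real (Suc k) * ang)) (?U 0) = (\<lambda>x. - ?U (2 * (real (Suc k) * ang) - 0) x)"
        unfolding resplane(2) by (rule reflect_circ[OF resplane(1)])
      also have "\<dots> = ?U ang" unfolding e diff_0_right unfolding resplane(2) circ_pi_add by simp
      finally show ?thesis by (simp add: resplane(3))
    qed
    ultimately show ?thesis by simp
  next
    case False
    then obtain l where l: "?n = 2 * l" by auto
    have l2: "l \<ge> 2" using l n3 by simp
    let ?f = "perp_vec ang (rho w s) (rho w t)"
    have a: "ang = pi / (2 * real l)" using l by (simp add: ang_def)
    have la: "real l * ang = pi / 2" using l2 by (simp add: a)
    have \<mu>U: "?U (real l * ang) = ?f" unfolding la resplane(2) by (simp add: circ_def)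
    have \<mu>: "posroot ?f" using residue_root_pos(1)[of l] l l2 \<mu>U by simp
    have ort: "B (rho w s) ?f = 0" using resplane(1) by (simp add: orthonormal_def)
    have \<gamma>: "posroot (circ (rho w s) ?f ang)" using residue_root_pos(1)[of 1] n3 by (simp add: resplane(2))
    have \<rho>2U: "circ (rho w s) ?f (pi - ang) = rho w t" using resplane(2,4) by simp
    then have \<rho>2: "posroot (circ (rho w s) ?f (pi - ang))" using rho_posroot[OF w st(2) dt] by simp
    obtain \<delta> where \<delta>: "posroot \<delta>" "\<delta> \<noteq> rho w s" "dominates (rho w s) \<delta>" using ne unfolding nonelementary_def by blast
    have f: "B \<delta> (rho w s) \<ge> 1" by (rule dominates_imp_form[OF \<rho> \<delta>(1,3)])
    define g where "g = w \<otimes> alt_prod s t 2"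
    have g: "g \<in> carrier W" using w st by (simp add: g_def)
    have Ng: "inversions g = inversions w - {residue_refl w s t 0, residue_refl w s t 1}"
      unfolding g_def using inversions_alt_prod[of 2] n3 by (auto simp: lessThan_Suc numeral_2_eq_2)
    have g1: "val ?f g < 0"
    proof -
      have "residue_refl w s t l \<in> inversions g"
        unfolding Ng using residue_refl_inversion[of l] residue_refl_inj[of l 0] residue_refl_inj[of l 1] l l2 by auto
      then show ?thesis using posroot_inversion[OF residue_refl_root[of l]] \<mu> \<mu>U g by simp
    qed
    have g2: "val (rho w t) g < 0"
    proof -
      have "residue_refl w s t (?n - 1) \<in> inversions g"
        unfolding Ng using residue_refl_inversion[of "?n - 1"] residue_refl_inj[of "?n - 1" 0] residue_refl_inj[of "?n - 1" 1] n3 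
        by auto
      then show ?thesis 
        using posroot_inversion[OF rho_root[OF w st(2)] rho_posroot[OF w st(2) dt] g] residue_refl_ends by simp
    qed
    have g3: "val \<delta> g < 0"
    proof -
      obtain d where d: "is_root d \<delta>" using \<delta> posroot_root by blast
      have "val \<delta> w < 0" using \<delta>(3) val_rho[OF w st(1)] w unfolding dominates_def by simp
      then have dw: "d \<in> inversions w" using posroot_inversion[OF d \<delta>(1) w] by simp
      have "d \<noteq> residue_refl w s t 0" 
        using posroot_unique[OF _ d \<rho> \<delta>(1)] rho_root[OF w st(1)] \<delta>(2) residue_refl_ends by auto
      moreover have "d \<noteq> residue_refl w s t 1"
      proof
        assume "d = residue_refl w s t 1"
        then have "\<delta> = ?U ang"
          using posroot_unique[OF residue_refl_root[of 1] _ _ \<delta>(1)] d residue_root_pos(1)[of 1] n3 by simp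
        then have "B \<delta> (rho w s) = cos ang" using B_residue_root[of ang 0] resplane(3) by simp
        moreover have "cos ang < 1" using ang(1,2) cos_monotone_0_pi[of 0 ang] by simp
        ultimately show False using f by simp
      qed
      ultimately have "d \<in> inversions g" using dw Ng by simp
      then show ?thesis using posroot_inversion[OF d \<delta>(1) g] by simp
    qed
    have g4: "val (?U ang) g > 0"
    proof -
      have "residue_refl w s t 1 \<notin> inversions g" using Ng by simp
      then have "\<not> val (?U ang) g < 0"
        using posroot_inversion[OF residue_refl_root[of 1] _ g] residue_root_pos(1)[of 1] n3 by simp
      then show ?thesis using posroot_val_nonzero[OF \<gamma> g] by (simp add: resplane(2))
    qed
    show ?thesis
      unfolding resplane(2)
      by (rule nonelementary_even[OF l2 a \<rho> \<mu> ort \<gamma> \<rho>2 \<delta>(1) f g g1 _ g3]) (use g2 g4 \<rho>2U resplane(2) in simp_all)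
  qed
qed

text \<open>
  The reflections in the two extreme roots exchange the indices \<open>i\<close> and \<open>n - i\<close>, and the indices
  \<open>i\<close> and \<open>n - 2 - i\<close>. By \<open>nonelementary_reflect\<close> the first preserves non-elementarity if \<open>2 i \<ge>
  n\<close>, the second if \<open>2 i \<le> n - 2\<close>. Starting from the indices \<open>0\<close> and \<open>1\<close>, they reach all indices
  up to \<open>n - 2\<close>.
\<close>

lemma bipodal_root:
  assumes ne: "nonelementary (rho w s)" and i: "Suc i < ord (s \<otimes> t)"
  shows "nonelementary (residue_root w s t (real i * ang))"
proof -
  let ?U = "residue_root w s t" and ?n = "ord (s \<otimes> t)"
  let ?Q = "\<lambda>i. nonelementary (?U (real i * ang))"
  have r: "reflect (?U a) (?U b) = (\<lambda>x. - ?U (2 * a - b) x)" for a b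
    unfolding resplane(2) by (rule reflect_circ[OF resplane(1)])
  have neg: "(\<lambda>x. - ?U a x) = ?U (a + pi)" for a
    unfolding resplane(2) circ_add_pi ..
  have per: "?U (a + 2 * pi) = ?U a" for a
    unfolding resplane(2) circ_add_2pi ..
  have \<rho>s: "posroot (rho w s)" by (rule rho_posroot[OF w st(1) ds])
  have \<rho>t: "posroot (rho w t)" by (rule rho_posroot[OF w st(2) dt])
  have refs: "?Q (?n - i)" if "?Q i" "?n \<le> 2 * i" "i < ?n" for i
  proof -
    have "real ?n * ang \<le> real (2 * i) * ang" using that(2) ang(1) by (intro mult_right_mono) auto
    then have "pi / 2 \<le> real i * ang" using ang(3) by simp
    moreover have "real i * ang \<le> real ?n * ang" using that(3) ang(1) by (intro mult_right_mono) auto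
    ultimately have "cos (real i * ang) \<le> 0" 
      using cos_monotone_0_pi_le[of "pi/2" "real i * ang"] ang(3) by simp
    then have "B (rho w s) (?U (real i * ang)) \<le> 0" 
      using B_residue_root[of 0 "real i * ang"] by (simp add: resplane(3))
    then have "nonelementary (reflect (rho w s) (?U (real i * ang)))"
      using nonelementary_reflect[OF residue_root_pos(1)[OF that(3)] \<rho>s] that(1) by blast
    moreover have "reflect (rho w s) (?U (real i * ang)) = ?U (real (?n - i) * ang)"
      using r[of 0 "real i * ang"] that(3) ang(3)
      by (simp add: resplane(3) neg of_nat_diff algebra_simps)
    ultimately show ?thesis by simp
  qed
  have reft: "?Q (?n - 2 - i)" if "?Q i" "2 * i + 2 \<le> ?n" for i
  proof -
    have "real (2 * i + 2) * ang \<le> real ?n * ang" using that(2) ang(1) by (intro mult_right_mono) auto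
    then have h: "real i * ang + ang \<le> pi / 2" using ang(3) by (simp add: algebra_simps)
    have "cos (pi - ang - real i * ang) = - cos (ang + real i * ang)"
      using cos_pi_minus[of "ang + real i * ang"] by (simp add: algebra_simps)
    also have "\<dots> \<le> 0"
    proof -
      have "0 \<le> real i * ang" using ang(1) by simp
      then have "cos (ang + real i * ang) \<ge> 0" using h ang(1) by (intro cos_ge_zero) linarith+
      then show ?thesis by simp
    qed
    finally have "B (rho w t) (?U (real i * ang)) \<le> 0"
      using B_residue_root[of "pi - ang" "real i * ang"] by (simp add: resplane(4))
    moreover have "i < ?n" using that(2) by simp
    ultimately have "nonelementary (reflect (rho w t) (?U (real i * ang)))"
      using nonelementary_reflect[OF residue_root_pos(1) \<rho>t] that(1) by blast
    moreover have "reflect (rho w t) (?U (real i * ang)) = ?U (real (?n - 2 - i) * ang)"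
    proof -
      have "real (?n - 2 - i) = real ?n - 2 - real i" using that(2) by (simp add: of_nat_diff)
      then have e: "2 * (pi - ang) - real i * ang + pi = real (?n - 2 - i) * ang + 2 * pi"
        using ang(3) by (simp add: algebra_simps)
      show ?thesis using r[of "pi - ang" "real i * ang"] unfolding neg e per by (simp add: resplane(4))
    qed
    ultimately show ?thesis by simp
  qed
  have Q0: "?Q 0" using ne by (simp add: resplane(3))
  have low: "?Q j" if "2 * j \<le> ?n" "Suc j < ?n" for j
    using that
  proof (induction j rule: less_induct)
    case (less j)
    consider "j = 0" | "j = 1" | "j \<ge> 2" by linarith
    then show ?case
    proof cases
      case 1 then show ?thesis using Q0 by simp
    next
      case 2 then show ?thesis using bipodal_second[OF _ ne] less.prems by simp
    next
      case 3
      have "?Q (j - 2)" using less.IH[of "j - 2"] less.prems 3 by simp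
      then have "?Q (?n - 2 - (j - 2))" using less.prems 3 by (intro reft) auto
      moreover have "?n - 2 - (j - 2) = ?n - j" using 3 less.prems by simp
      ultimately have "?Q (?n - j)" by simp
      then have "?Q (?n - (?n - j))" using refs[of "?n - j"] less.prems 3 by simp
      then show ?thesis using less.prems by simp
    qed
  qed
  show ?thesis
  proof (cases "2 * i \<le> ?n")
    case True then show ?thesis using low i by simp
  next
    case False
    have "?Q (?n - 2 - i)" using False i two_descents_ord by (intro low) auto
    then have "?Q (?n - 2 - (?n - 2 - i))" by (rule reft) (use False i in auto)
    moreover have "?n - 2 - (?n - 2 - i) = i" using i by simp
    ultimately show ?thesis by simp
  qed
qed

text \<open>
  A reflection strictly inside a residue can be elementary only if the outermost ones are.
  Applied with \<open>s\<close> and \<open>t\<close> exchanged, this covers the other end.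
\<close>

lemma bipodal:
  assumes "\<not> elementary (cj w s)" "Suc i < ord (s \<otimes> t)"
  shows "\<not> elementary (residue_refl w s t i)"
proof -
  have "nonelementary (rho w s)" using assms elementary_root[OF rho_root rho_posroot] w st ds by blast
  then show ?thesis
    using bipodal_root[OF _ assms(2)] elementary_root[OF residue_refl_root residue_root_pos(1)] assms(2) by simp
qed

end

section \<open>Gates of Shi parts\<close>

text \<open>
  The Shi part of \<open>h\<close>, described by inversions; \<open>shi_part_eq\<close> compares it with the components of
  the graph.
\<close>

definition shi_class :: "'a \<Rightarrow> 'a set" where
  "shi_class h = {g \<in> carrier W. \<forall>r \<in> reflections W S. elementary r \<longrightarrow>
     (r \<in> inversions g \<longleftrightarrow> r \<in> inversions h)}"

lemma shi_class_carrier: "g \<in> shi_class h \<Longrightarrow> g \<in> carrier W"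
  by (simp add: shi_class_def)

lemma shi_class_self: "h \<in> carrier W \<Longrightarrow> h \<in> shi_class h"
  by (simp add: shi_class_def)

lemma shi_class_eq: "g \<in> shi_class h \<Longrightarrow> shi_class g = shi_class h"
  by (auto simp: shi_class_def)

lemma shi_class_convex:
  assumes "x \<in> shi_class h" "y \<in> shi_class h" "g \<in> carrier W" "inversions x \<subseteq> inversions g" "inversions g \<subseteq> inversions y"
  shows "g \<in> shi_class h"
  using assms unfolding shi_class_def by blast

lemma shi_class_down:
  assumes "g \<in> shi_class h" "s \<in> S" "\<not> elementary (cj g s)"
  shows "g \<otimes> s \<in> shi_class h"
proof -
  have "r \<in> inversions (g \<otimes> s) \<longleftrightarrow> r \<in> inversions g" 
    if "r \<in> reflections W S" "elementary r" for r
    using that assms shi_class_carrier[OF assms(1)] by (auto simp: inversions_mult_gen)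
  then show ?thesis using assms shi_class_carrier[OF assms(1)] by (simp add: shi_class_def)
qed

lemma shi_class_down_nonelementary:
  assumes "g \<in> shi_class h" "s \<in> S" "g \<otimes> s \<in> shi_class h"
  shows "\<not> elementary (cj g s)"
proof
  assume e: "elementary (cj g s)"
  have c: "g \<in> carrier W" "cj g s \<in> reflections W S" using shi_class_carrier[OF assms(1)] assms by auto
  then have "cj g s \<in> inversions (g \<otimes> s) \<longleftrightarrow> cj g s \<in> inversions g"
    using assms e unfolding shi_class_def by blast
  then show False using c assms inversions_mult_gen[of g s "cj g s"] by auto
qed

text \<open>
  An element of the part of \<open>h\<close> from which no edge leads down within the part.
\<close>

definition minimal_in :: "'a \<Rightarrow> 'a \<Rightarrow> bool" where
  "minimal_in h x \<longleftrightarrow> x \<in> shi_class h \<and> (\<forall>s\<in>S. cj x s \<in> inversions x \<longrightarrow> elementary (cj x s))"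

lemma minimal_below: "k \<in> shi_class h \<Longrightarrow> \<exists>x. minimal_in h x \<and> inversions x \<subseteq> inversions k"
proof (induction "len k" arbitrary: k rule: less_induct)
  case less
  show ?case
  proof (cases "minimal_in h k")
    case False
    then obtain s where s: "s \<in> S" "cj k s \<in> inversions k" "\<not> elementary (cj k s)"
      using less.prems unfolding minimal_in_def by blast
    have k: "k \<in> carrier W" using less.prems shi_class_carrier by blast
    have "len (k \<otimes> s) < len k" "inversions (k \<otimes> s) \<subseteq> inversions k" using down_gen[OF k s(1,2)] by auto
    then show ?thesis using less.hyps[of "k \<otimes> s"] shi_class_down[OF less.prems s(1,3)] by blast
  qed blast
qed

lemma down_to:
  assumes x: "x \<in> shi_class h" and k: "k \<in> shi_class h" and sub: "inversions x \<subseteq> inversions k" and ne: "x \<noteq> k"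
  shows "\<exists>s\<in>S. cj k s \<in> inversions k \<and> \<not> elementary (cj k s) \<and> k \<otimes> s \<in> shi_class h
    \<and> inversions x \<subseteq> inversions (k \<otimes> s)"
proof -
  have c: "x \<in> carrier W" "k \<in> carrier W" using x k shi_class_carrier by auto
  have "inversions x \<subset> inversions k" using sub ne inversions_inj[OF c] by blast
  then obtain s where s: "s \<in> S" "cj k s \<in> inversions k" "cj k s \<notin> inversions x"
    using down_step[OF c] by blast
  have N: "inversions (k \<otimes> s) = inversions k - {cj k s}" by (rule down_gen(1)[OF c(2) s(1,2)])
  have "k \<otimes> s \<in> shi_class h" using shi_class_convex[OF x k, of "k \<otimes> s"] c s sub N by auto
  then show ?thesis using s N sub shi_class_down_nonelementary[OF k s(1)] by blast
qed

text \<open>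
  Local confluence of descents within a part: the residue of two descents has its lowest element
  in the part.
\<close>

lemma residue_bottom_in_shi_class:
  assumes k: "k \<in> shi_class h" and st: "s \<in> S" "t \<in> S" "s \<noteq> t"
    and s: "cj k s \<in> inversions k" "\<not> elementary (cj k s)"
    and t: "cj k t \<in> inversions k" "\<not> elementary (cj k t)"
  shows "\<exists>m \<in> shi_class h. inversions m \<subseteq> inversions (k \<otimes> s) \<and> inversions m \<subseteq> inversions (k \<otimes> t)"
proof -
  let ?n = "ord (s \<otimes> t)"
  have kc: "k \<in> carrier W" using k shi_class_carrier by blast
  define m where "m = k \<otimes> alt_prod s t ?n"
  have mc: "m \<in> carrier W" using kc st by (simp add: m_def)
  have n2: "?n \<ge> 2" by (rule two_descents_ord[OF kc st s(1) t(1)])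
  have Nm: "inversions m = inversions k - residue_refl k s t ` {..<?n}"
    unfolding m_def by (rule inversions_alt_prod[OF kc st s(1) t(1)]) simp
  have ends: "residue_refl k s t 0 = cj k s" "residue_refl k s t (?n - 1) = cj k t"
    by (rule residue_refl_ends[OF kc st s(1) t(1)])+
  have ne: "\<not> elementary (residue_refl k s t i)" if "i < ?n" for i
  proof (cases "Suc i < ?n")
    case True
    then show ?thesis using bipodal[OF kc st s(1) t(1) s(2)] by blast
  next
    case False
    then have "i = ?n - 1" using that by simp
    then show ?thesis using ends t by simp
  qed
  have "m \<in> shi_class h" unfolding shi_class_def
  proof (intro CollectI conjI mc ballI impI)
    fix r assume r: "r \<in> reflections W S" "elementary r"
    have "r \<notin> residue_refl k s t ` {..<?n}" using ne r by auto
    then show "r \<in> inversions m \<longleftrightarrow> r \<in> inversions h" using k r unfolding Nm shi_class_def by blast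
  qed
  moreover have "residue_refl k s t 0 \<in> residue_refl k s t ` {..<?n}" "residue_refl k s t (?n - 1) \<in> residue_refl k s t ` {..<?n}"
    using n2 by auto
  then have "cj k s \<notin> inversions m" "cj k t \<notin> inversions m" using Nm ends by auto
  then have "inversions m \<subseteq> inversions (k \<otimes> s)" "inversions m \<subseteq> inversions (k \<otimes> t)"
    using Nm down_gen(1)[OF kc st(1) s(1)] down_gen(1)[OF kc st(2) t(1)] by auto
  ultimately show ?thesis by blast
qed

text \<open>
  The two minimal elements lie below neighbours \<open>k s\<close> and \<open>k t\<close> of \<open>k\<close>. A third minimal element,
  below the lowest element of the residue, equals both of them by induction.
\<close>

lemma minimal_unique:
  assumes "k \<in> shi_class h" "minimal_in h x" "minimal_in h y"
    "inversions x \<subseteq> inversions k" "inversions y \<subseteq> inversions k"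
  shows "x = y"
  using assms
proof (induction "len k" arbitrary: k x y rule: less_induct)
  case less
  have kc: "k \<in> carrier W" using less.prems shi_class_carrier by blast
  have xy: "x \<in> shi_class h" "y \<in> shi_class h" using less.prems by (auto simp: minimal_in_def)
  have top: "z = k" if "minimal_in h k" "z \<in> shi_class h" "inversions z \<subseteq> inversions k" for z
    using down_to[of z h k] that less.prems(1) unfolding minimal_in_def by blast
  show ?case
  proof (cases "x = k \<or> y = k")
    case True
    then show ?thesis using top less.prems xy by blast
  next
    case False
    obtain s where s: "s \<in> S" "cj k s \<in> inversions k" "\<not> elementary (cj k s)" "k \<otimes> s \<in> shi_class h"
       "inversions x \<subseteq> inversions (k \<otimes> s)" using down_to[of x h k] xy less.prems False by blast
    obtain t where t: "t \<in> S" "cj k t \<in> inversions k" "\<not> elementary (cj k t)" "k \<otimes> t \<in> shi_class h"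
       "inversions y \<subseteq> inversions (k \<otimes> t)" using down_to[of y h k] xy less.prems False by blast
    have ls: "len (k \<otimes> s) < len k" "len (k \<otimes> t) < len k"
      using down_gen(2)[OF kc s(1,2)] down_gen(2)[OF kc t(1,2)] by auto
    show ?thesis
    proof (cases "s = t")
      case True
      then show ?thesis using less.hyps[OF ls(1) s(4) less.prems(2,3) s(5)] t by simp
    next
      case False
      obtain m where m: "m \<in> shi_class h" "inversions m \<subseteq> inversions (k \<otimes> s)" "inversions m \<subseteq> inversions (k \<otimes> t)"
        using residue_bottom_in_shi_class[OF less.prems(1) s(1) t(1) False s(2,3) t(2,3)] by blast
      obtain z where z: "minimal_in h z" "inversions z \<subseteq> inversions m" using minimal_below[OF m(1)] by blast
      have "x = z" using less.hyps[OF ls(1) s(4) less.prems(2) z(1) s(5)] z(2) m(2) by blast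
      moreover have "y = z" using less.hyps[OF ls(2) t(4) less.prems(3) z(1) t(5)] z(2) m(3) by blast
      ultimately show ?thesis by simp
    qed
  qed
qed

lemma first_letter:
  assumes "x \<in> carrier W" "x \<noteq> \<one>"
  shows "\<exists>s\<in>S. s \<in> inversions x \<and> len (s \<otimes> x) < len x"
proof -
  obtain u where u: "set u \<subseteq> S" "wprod u = x" "length u = len x" "distinct (crossings u)" "set (crossings u) = inversions x"
    using reduced_word[OF assms(1)] by blast
  have "u \<noteq> []" using u assms by auto
  then obtain s v where su: "u = s # v" by (cases u) auto
  have "s \<otimes> x = wprod v" using u su by auto
  then have "len (s \<otimes> x) \<le> length v" using u su by (simp add: len_le_length)
  then show ?thesis using u su by (intro bexI[of _ s]) auto
qed

text \<open>
  Parts are convex, so \<open>g\<close> and \<open>k\<close> are joined by a path within the part; along each of its edges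
  the minimal element below does not change.
\<close>

lemma minimal_transfer:
  assumes "g \<in> shi_class h" "k \<in> shi_class h" "minimal_in h x" "inversions x \<subseteq> inversions k"
  shows "inversions x \<subseteq> inversions g"
  using assms(1)
proof (induction "len (inv g \<otimes> k)" arbitrary: g rule: less_induct)
  case less
  have c: "g \<in> carrier W" "k \<in> carrier W" using less.prems assms shi_class_carrier by auto
  show ?case
  proof (cases "g = k")
    case False
    have "inv g \<otimes> k \<noteq> \<one>" using False c by (metis inv_closed inv_equality inv_inv)
    then obtain s where s: "s \<in> S" "s \<in> inversions (inv g \<otimes> k)" "len (s \<otimes> (inv g \<otimes> k)) < len (inv g \<otimes> k)"
      using first_letter[of "inv g \<otimes> k"] c by auto
    have d: "(cj g s \<in> inversions g) \<noteq> (cj g s \<in> inversions k)" using inversions_diff[of g k s] s c by auto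
    have r: "cj g s \<in> reflections W S" using c s by auto
    have ne: "\<not> elementary (cj g s)" using d r less.prems assms(2) unfolding shi_class_def by blast
    have gs: "g \<otimes> s \<in> shi_class h" by (rule shi_class_down[OF less.prems s(1) ne])
    have "inv (g \<otimes> s) \<otimes> k = s \<otimes> (inv g \<otimes> k)" using c s by (simp add: inv_mult_group m_assoc)
    then have sub: "inversions x \<subseteq> inversions (g \<otimes> s)" using less.hyps[OF _ gs] s by simp
    show ?thesis
    proof (cases "cj g s \<in> inversions g")
      case True
      then show ?thesis using sub down_gen(1)[OF c(1) s(1)] by blast
    next
      case F: False
      obtain y where y: "minimal_in h y" "inversions y \<subseteq> inversions g" using minimal_below[OF less.prems] by blast
      have "inversions y \<subseteq> inversions (g \<otimes> s)" using y up_gen(1)[OF c(1) s(1) F] by blast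
      then have "x = y" using minimal_unique[OF gs assms(3) y(1) sub] by blast
      then show ?thesis using y by simp
    qed
  qed (use assms in simp)
qed

text \<open>
  The gate of the part of \<open>h\<close>, with the weak order expressed by inversions.
\<close>

definition is_gate :: "'a \<Rightarrow> 'a \<Rightarrow> bool" where
  "is_gate h m \<longleftrightarrow> m \<in> shi_class h \<and> (\<forall>g \<in> shi_class h. inversions m \<subseteq> inversions g)"

theorem gate_exists:
  assumes "h \<in> carrier W" shows "\<exists>m. is_gate h m"
proof -
  obtain m where m: "minimal_in h m" "inversions m \<subseteq> inversions h" 
    using minimal_below[OF shi_class_self[OF assms]] by blast
  then show ?thesis
    using minimal_transfer[OF _ shi_class_self[OF assms] m] unfolding is_gate_def minimal_in_def by blast
qed

lemma residue_refl_swap: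
  assumes k: "k \<in> carrier W" and st: "s \<in> S" "t \<in> S" and i: "i < ord (s \<otimes> t)"
  shows "residue_refl k t s i = residue_refl k s t (ord (s \<otimes> t) - 1 - i)"
proof -
  let ?x = "s \<otimes> t" and ?n = "ord (s \<otimes> t)"
  have x: "?x \<in> carrier W" using st by auto
  have "?x [^] i \<otimes> (?x [^] (?n - 1 - i) \<otimes> s) = ?x [^] (?n - 1) \<otimes> s"
    using x st i by (simp add: m_assoc[symmetric] nat_pow_mult)
  also have "\<dots> = t" using pow_ord_minus_one[OF st] i by simp
  finally have "inv (?x [^] i) \<otimes> (?x [^] i \<otimes> (?x [^] (?n - 1 - i) \<otimes> s)) = inv (?x [^] i) \<otimes> t" by simp
  then have "?x [^] (?n - 1 - i) \<otimes> s = inv (?x [^] i) \<otimes> t"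
    using x st by (simp add: m_assoc[symmetric])
  also have "inv (?x [^] i) = (t \<otimes> s) [^] i"
    using nat_pow_inv[OF x, of i] st by (simp add: inv_mult_group)
  finally show ?thesis by (simp add: residue_refl_def)
qed

lemma ord_swap: "s \<in> S \<Longrightarrow> t \<in> S \<Longrightarrow> ord (t \<otimes> s) = ord (s \<otimes> t)"
  using ord_inv[of "s \<otimes> t"] by (simp add: inv_mult_group)

text \<open>
  Suppose that \<open>cj k s\<close> is an inversion of the low element \<open>b\<close> but not elementary. Since \<open>b\<close> is
  a gate, \<open>k \<noteq> b\<close>, and some descent \<open>t\<close> of \<open>k\<close> leads to an element that is still above \<open>b\<close>. In
  the residue of \<open>k\<close>, descend from \<open>k\<close> starting with \<open>t\<close>, as long as the reflections crossed are
  not inversions of \<open>b\<close>. This ends above \<open>b\<close> and below \<open>k\<close>, in front of a wall of an inversion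
  of \<open>b\<close> that is not elementary by \<open>bipodal\<close>, contrary to the induction hypothesis.
\<close>

lemma gate_boundary:
  assumes b: "is_gate b b" "b \<in> carrier W"
    and "k \<in> carrier W" "inversions b \<subseteq> inversions k" "s \<in> S" "cj k s \<in> inversions b"
  shows "elementary (cj k s)"
  using assms(3-)
proof (induction "len k" arbitrary: k s rule: less_induct)
  case less
  have k: "k \<in> carrier W" and s: "s \<in> S" using less.prems by auto
  have sk: "cj k s \<in> inversions k" using less.prems by blast
  show ?case
  proof (rule ccontr)
    assume ne: "\<not> elementary (cj k s)"
    show False
    proof (cases "k = b")
      case True
      have "b \<otimes> s \<in> shi_class b" using shi_class_down[OF shi_class_self[OF b(2)] s] ne True by simp
      then have "inversions b \<subseteq> inversions (b \<otimes> s)" using b by (simp add: is_gate_def)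
      then show False using down_gen(1)[OF b(2) s] less.prems True by auto
    next
      case False
      then have "inversions b \<subset> inversions k" using less.prems inversions_inj[OF b(2) k] by blast
      then obtain t where t: "t \<in> S" "cj k t \<in> inversions k" "cj k t \<notin> inversions b"
        using down_step[OF b(2) k] by blast
      have st: "s \<noteq> t" using t less.prems by auto
      let ?n = "ord (s \<otimes> t)"
      let ?q = "residue_refl k s t"
      have n2: "?n \<ge> 2" by (rule two_descents_ord[OF k s t(1) st sk t(2)])
      have ends: "?q 0 = cj k s" "?q (?n - 1) = cj k t" by (rule residue_refl_ends[OF k s t(1) st sk t(2)])+
      \<comment> \<open>The index \<open>j\<close> below is that of the last reflection of the residue that is an inversion of \<open>b\<close>,
        counted from the side of \<open>s\<close>.\<close>
      define J where "J = {j. j < ?n \<and> ?q j \<in> inversions b}"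
      have fin: "finite J" by (simp add: J_def)
      have "0 \<in> J" using ends less.prems n2 by (simp add: J_def)
      define j where "j = Max J"
      have j: "j \<in> J" using Max_in[OF fin] \<open>0 \<in> J\<close> unfolding j_def by blast
      have jmax: "i \<le> j" if "i \<in> J" for i using Max_ge[OF fin that] by (simp add: j_def)
      have jn: "j < ?n" "?q j \<in> inversions b" using j by (auto simp: J_def)
      have "j \<noteq> ?n - 1" using jn ends t by metis
      then have jn1: "Suc j < ?n" using jn by simp
      define i where "i = ?n - 1 - j"
      have i1: "i \<ge> 1" "i < ?n" using jn1 by (auto simp: i_def)
      define k' where "k' = k \<otimes> alt_prod t s i"
      have k': "k' \<in> carrier W" using k s t by (simp add: k'_def)
      have sw: "residue_refl k t s i' = ?q (?n - 1 - i')" if "i' < ?n" for i'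
        by (rule residue_refl_swap[OF k s t(1) that])
      have Nk': "inversions k' = inversions k - residue_refl k t s ` {..<i}"
        unfolding k'_def using inversions_alt_prod[OF k t(1) s st[symmetric] t(2) sk, of i] i1 
          ord_swap[OF s t(1)] by simp
      have sub: "inversions b \<subseteq> inversions k'"
      proof
        fix r assume r: "r \<in> inversions b"
        have "r \<notin> residue_refl k t s ` {..<i}"
        proof
          assume "r \<in> residue_refl k t s ` {..<i}"
          then obtain i' where i': "i' < i" "r = residue_refl k t s i'" by auto
          then have "?n - 1 - i' \<in> J" using sw[of i'] r i1 by (simp add: J_def)
          then show False using jmax[of "?n - 1 - i'"] i' i1 by (simp add: i_def)
        qed
        then show "r \<in> inversions k'" using r Nk' less.prems by blast
      qed
      define z where "z = (if even i then t else s)"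
      have z: "z \<in> S" using s t by (simp add: z_def)
      have "cj k' z = cj k (cj (alt_prod t s i) z)" using k s t z by (simp add: k'_def cj_cj)
      also have "\<dots> = residue_refl k t s i" unfolding z_def cj_alt_prod[OF t(1) s] by (simp add: residue_refl_def)
      also have "\<dots> = ?q j" using sw[OF i1(2)] jn by (simp add: i_def)
      finally have e: "cj k' z = ?q j" .
      have "len k' < len k"
      proof -
        have "residue_refl k t s 0 \<in> residue_refl k t s ` {..<i}" using i1 by auto
        moreover have "residue_refl k t s 0 = cj k t" using k t by (simp add: residue_refl_def)
        ultimately have "cj k t \<notin> inversions k'" unfolding Nk' by simp
        moreover have "inversions k' \<subseteq> inversions k" unfolding Nk' by (rule Diff_subset)
        ultimately have "inversions k' \<subset> inversions k" using t(2) by (metis psubsetI)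
        then show ?thesis unfolding len_def using k by (intro psubset_card_mono) auto
      qed
      then have "elementary (?q j)" using less.hyps[OF _ k' sub z] e jn by simp
      then show False using bipodal[OF k s t(1) st sk t(2) ne jn1] by simp
    qed
  qed
qed

text \<open>
  The gate of the part of an upper bound of a low element is again an upper bound: descend from
  \<open>h\<close> to its gate within the part, where by \<open>gate_boundary\<close> no step leads below the low element.
\<close>

theorem gate_mono:
  assumes b: "is_gate b b" "b \<in> carrier W" and h: "h \<in> carrier W" and sub: "inversions b \<subseteq> inversions h"
    and m: "is_gate h m"
  shows "inversions b \<subseteq> inversions m"
proof -
  have mh: "m \<in> shi_class h" using m by (simp add: is_gate_def)
  have "inversions b \<subseteq> inversions m" if "k \<in> shi_class h" "inversions b \<subseteq> inversions k" for k
    using that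
  proof (induction "len k" arbitrary: k rule: less_induct)
    case less
    have k: "k \<in> carrier W" using less.prems shi_class_carrier by blast
    have mk: "inversions m \<subseteq> inversions k" using m less.prems by (simp add: is_gate_def)
    show ?case
    proof (cases "m = k")
      case True then show ?thesis using less.prems by simp
    next
      case False
      obtain s where s: "s \<in> S" "cj k s \<in> inversions k" "\<not> elementary (cj k s)" "k \<otimes> s \<in> shi_class h"
        using down_to[OF mh less.prems(1) mk False] by blast
      have "cj k s \<notin> inversions b" using gate_boundary[OF b k less.prems(2) s(1)] s(3) by blast
      then have "inversions b \<subseteq> inversions (k \<otimes> s)" using down_gen(1)[OF k s(1,2)] less.prems(2) by blast
      moreover have "len (k \<otimes> s) < len k" using down_gen(2)[OF k s(1,2)] by simp
      ultimately show ?thesis using less.hyps s(4) by blast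
    qed
  qed
  then show ?thesis using shi_class_self[OF h] sub by blast
qed

section \<open>Walls and half-spaces in the Cayley graph\<close>

abbreviation cayley where "cayley \<equiv> cayley_graph W S"

text \<open>
  The point at parameter \<open>t\<close> on the edge from \<open>g\<close> to \<open>h\<close>.
\<close>

definition edge_point :: "'a \<Rightarrow> 'a \<Rightarrow> real \<Rightarrow> 'a \<Rightarrow> real" where
  "edge_point g h t = (\<lambda>k. (1 - t) * vertex g k + t * vertex h k)"

lemma cayley_edge_edge_point: "cayley_edge g h = edge_point g h ` {0..1}"
  by (auto simp: cayley_edge_def edge_point_def image_def)

lemma edge_point_ends [simp]: "edge_point g h 0 = vertex g" "edge_point g h 1 = vertex h"
  by (auto simp: edge_point_def)

lemma edge_point_val:
  "g \<noteq> h \<Longrightarrow> edge_point g h t g = 1 - t" "g \<noteq> h \<Longrightarrow> edge_point g h t h = t"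
  "k \<noteq> g \<Longrightarrow> k \<noteq> h \<Longrightarrow> edge_point g h t k = 0"
  by (auto simp: edge_point_def vertex_def)

lemma gen_move: "g \<in> carrier W \<Longrightarrow> s \<in> S \<Longrightarrow> g \<otimes> s \<noteq> g"
  using gen_neq_one by simp

lemma edge_in_X: "g \<in> carrier W \<Longrightarrow> s \<in> S \<Longrightarrow> cayley_edge g (g \<otimes> s) \<subseteq> cayley"
  by (auto simp: cayley_graph_def)

lemma vertex_in_X: "g \<in> carrier W \<Longrightarrow> vertex g \<in> cayley"
  by (auto simp: cayley_graph_def)

lemma X_point:
  assumes "x \<in> cayley" "s0 \<in> S"
  obtains g s t where "g \<in> carrier W" "s \<in> S" "0 \<le> t" "t \<le> 1" "x = edge_point g (g \<otimes> s) t"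
proof -
  from assms(1) consider g where "g \<in> carrier W" "x = vertex g"
    | g s where "g \<in> carrier W" "s \<in> S" "x \<in> cayley_edge g (g \<otimes> s)"
    unfolding cayley_graph_def by blast
  then show thesis
  proof cases
    case 1
    then show ?thesis using that[of g s0 0] assms by simp
  next
    case 2
    then show ?thesis using that[of g s] unfolding cayley_edge_edge_point by auto
  qed
qed

lemma cj_reflects: "g \<in> carrier W \<Longrightarrow> s \<in> S \<Longrightarrow> cj g s \<otimes> g = g \<otimes> s"
  by (simp add: cj_def m_assoc)

lemma midpoint_in_wall:
  assumes g: "g \<in> carrier W" and s: "s \<in> S"
  shows "edge_point g (g \<otimes> s) (1 / 2) \<in> wall W S (cj g s)"
proof -
  let ?r = "cj g s"
  have r: "?r \<in> reflections W S" "?r \<in> carrier W" "inv ?r = ?r" using g s reflection_inv by auto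
  have rg: "?r \<otimes> g = g \<otimes> s" "?r \<otimes> (g \<otimes> s) = g"
    using cj_reflects[OF g s] r g s reflection_sq[OF r(1)] by (auto simp: m_assoc[symmetric])
  have sw: "?r \<otimes> k = a \<longleftrightarrow> k = ?r \<otimes> a" if "k \<in> carrier W" "a \<in> carrier W" for k a
    using that r(2) reflection_sq[OF r(1)] m_assoc[OF r(2) r(2)] by (metis l_one)
  have "vertex g (?r \<otimes> k) = vertex (g \<otimes> s) k" "vertex (g \<otimes> s) (?r \<otimes> k) = vertex g k" if "k \<in> carrier W" for k
    using sw[OF that g] sw[OF that, of "g \<otimes> s"] rg g s by (simp_all add: vertex_def)
  moreover have "edge_point g (g \<otimes> s) (1 / 2) k = 0" if "k \<notin> carrier W" for k
    using that g s by (auto simp: edge_point_def vertex_def)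
  ultimately have "translate W ?r (edge_point g (g \<otimes> s) (1 / 2)) = edge_point g (g \<otimes> s) (1 / 2)"
    using r by (auto simp: translate_def edge_point_def fun_eq_iff)
  moreover have "edge_point g (g \<otimes> s) (1 / 2) \<in> cayley"
    using edge_in_X[OF g s] unfolding cayley_edge_edge_point by auto
  ultimately show ?thesis by (simp add: wall_def)
qed

text \<open>
  With \<open>midpoint_in_wall\<close>: the wall of \<open>r\<close> consists of the midpoints of the edges that \<open>r\<close>
  reverses.
\<close>

lemma wall_point:
  assumes r: "r \<in> reflections W S" and x: "x \<in> wall W S r"
  obtains g s where "g \<in> carrier W" "s \<in> S" "r = cj g s" "x = edge_point g (g \<otimes> s) (1 / 2)"
proof -
  obtain s0 where "s0 \<in> S" using r by (auto elim: reflectionE)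
  moreover have "x \<in> cayley" using x by (simp add: wall_def)
  ultimately obtain g s t where g: "g \<in> carrier W" "s \<in> S" "0 \<le> t" "t \<le> 1" "x = edge_point g (g \<otimes> s) t"
    using X_point by blast
  have rc: "r \<in> carrier W" "inv r = r" using r reflection_inv by auto
  have fx: "x (r \<otimes> k) = x k" if "k \<in> carrier W" for k
  proof -
    have "translate W r x k = x k" using x by (simp add: wall_def)
    then show ?thesis using that rc by (simp add: translate_def)
  qed
  have mv: "r \<otimes> k \<noteq> k" if "k \<in> carrier W" for k
    using that rc reflection_neq_one[OF r] by simp
  let ?h = "g \<otimes> s"
  have gh: "g \<noteq> ?h" "?h \<in> carrier W" using gen_move[OF g(1,2)] g by auto
  have "t \<noteq> 1"
  proof
    assume t: "t = 1"
    have "x (r \<otimes> ?h) = 1" using fx[of ?h] gh g t by (simp add: vertex_def)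
    then show False using mv[OF gh(2)] g t by (auto simp: vertex_def split: if_splits)
  qed
  have xg: "x (r \<otimes> g) = 1 - t" using fx[of g] g gh by (simp add: edge_point_val)
  then have "r \<otimes> g = ?h" using \<open>t \<noteq> 1\<close> mv[OF g(1)] g(5) edge_point_val(3)[of "r \<otimes> g" g ?h t] by auto
  then have t2: "t = 1 / 2" using xg g gh by (simp add: edge_point_val)
  have x2: "x = edge_point g ?h (1 / 2)" unfolding t2[symmetric] by (rule g(5))
  have "r = cj g s" 
    using \<open>r \<otimes> g = ?h\<close> rc g by (simp add: cj_def) (metis inv_solve_right m_closed gen_closed)
  then show thesis using that[OF g(1,2) _ x2] by blast
qed

lemma vertex_notin_wall:
  assumes "r \<in> reflections W S" shows "vertex k \<notin> wall W S r"
proof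
  assume "vertex k \<in> wall W S r"
  then obtain g s where g: "g \<in> carrier W" "s \<in> S" "vertex k = edge_point g (g \<otimes> s) (1 / 2)"
    using wall_point[OF assms] by metis
  then have "vertex k g = 1 / 2" using gen_move[OF g(1,2)] by (simp add: edge_point_val)
  then show False by (auto simp: vertex_def split: if_splits)
qed

lemma edge_meets_wall:
  assumes q: "q \<in> reflections W S" and g: "g \<in> carrier W" "s \<in> S"
    and x: "x \<in> cayley_edge g (g \<otimes> s)" "x \<in> wall W S q"
  shows "q = cj g s"
proof -
  obtain k u where k: "k \<in> carrier W" "u \<in> S" "q = cj k u" "x = edge_point k (k \<otimes> u) (1 / 2)"
    using wall_point[OF q x(2)] by blast
  obtain t where t: "x = edge_point g (g \<otimes> s) t" using x(1) unfolding cayley_edge_edge_point by auto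
  have ku: "k \<noteq> k \<otimes> u" using gen_move[OF k(1,2)] by auto
  have "x k \<noteq> 0" "x (k \<otimes> u) \<noteq> 0" using k(4) ku by (simp_all add: edge_point_val)
  then have "k \<in> {g, g \<otimes> s}" "k \<otimes> u \<in> {g, g \<otimes> s}" using t edge_point_val(3)[of _ g "g \<otimes> s" t] by blast+
  then consider "k = g" "k \<otimes> u = g \<otimes> s" | "k = g \<otimes> s" "k \<otimes> u = g" using ku by auto
  then show ?thesis
  proof cases
    case 1
    then show ?thesis using k g by simp
  next
    case 2
    have "q = k \<otimes> u \<otimes> inv k" using k by (simp add: cj_def)
    also have "\<dots> = cj g s" unfolding 2(2) unfolding 2(1) using g by (simp add: cj_def inv_mult_group m_assoc)
    finally show ?thesis .
  qed
qed

lemma connected_edge: 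
  fixes g h :: 'a shows "connected (cayley_edge g h)"
  unfolding cayley_edge_edge_point
proof (rule connected_continuous_image)
  show "continuous_on {0..1} (edge_point g h)"
    unfolding edge_point_def by (intro continuous_on_coordinatewise_then_product continuous_intros)
qed simp

lemma edge_ends: 
  fixes g h :: 'a shows "vertex g \<in> cayley_edge g h" "vertex h \<in> cayley_edge g h"
  unfolding cayley_edge_edge_point by (auto simp: image_iff intro: bexI[of _ 0] bexI[of _ 1])

lemma edge_component:
  assumes Q: "Q \<subseteq> reflections W S" and g: "g \<in> carrier W" "s \<in> S" "cj g s \<notin> Q"
    and x: "x \<in> cayley_edge g (g \<otimes> s)"
  shows "connected_component (cayley - \<Union> (wall W S ` Q)) (vertex g) x"
proof -
  have "cayley_edge g (g \<otimes> s) \<subseteq> cayley - \<Union> (wall W S ` Q)"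
    using edge_in_X[OF g(1,2)] edge_meets_wall[OF _ g(1,2)] Q g(3) by blast
  then show ?thesis
    unfolding connected_component_def using connected_edge edge_ends x by blast
qed

lemma vertex_in_complement:
  "Q \<subseteq> reflections W S \<Longrightarrow> g \<in> carrier W \<Longrightarrow> vertex g \<in> cayley - \<Union> (wall W S ` Q)"
  using vertex_in_X vertex_notin_wall by blast

lemma path_component_vertices:
  assumes "Q \<subseteq> reflections W S" "g \<in> carrier W" "set u \<subseteq> S" "\<forall>r\<in>set (crossings u). cj g r \<notin> Q"
  shows "connected_component (cayley - \<Union> (wall W S ` Q)) (vertex g) (vertex (g \<otimes> wprod u))"
  using assms(2-)
proof (induction u arbitrary: g)
  case Nil
  then show ?case using vertex_in_complement[OF assms(1), of g] by simp
next
  case (Cons s u)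
  have s: "s \<in> S" "set u \<subseteq> S" "cj g s \<notin> Q" using Cons.prems by auto
  have "connected_component (cayley - \<Union> (wall W S ` Q)) (vertex g) (vertex (g \<otimes> s))"
    using edge_component[OF assms(1) Cons.prems(1) s(1,3)] edge_ends by blast
  moreover have "\<forall>r\<in>set (crossings u). cj (g \<otimes> s) r \<notin> Q"
    using Cons.prems s crossings_closed[OF s(2)] by (auto simp: cj_cj[symmetric])
  then have "connected_component (cayley - \<Union> (wall W S ` Q)) (vertex (g \<otimes> s)) (vertex (g \<otimes> s \<otimes> wprod u))"
    using Cons.IH[of "g \<otimes> s"] Cons.prems s by simp
  ultimately show ?case using Cons.prems s by (simp add: m_assoc) (rule connected_component_trans)
qed

lemma same_side_component:
  assumes Q: "Q \<subseteq> reflections W S" and g: "g \<in> carrier W" and h: "h \<in> carrier W"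
    and eq: "\<And>q. q \<in> Q \<Longrightarrow> q \<in> inversions g \<longleftrightarrow> q \<in> inversions h"
  shows "connected_component (cayley - \<Union> (wall W S ` Q)) (vertex g) (vertex h)"
proof -
  have "inv g \<otimes> h \<in> carrier W" using g h by simp
  then obtain u where u: "set u \<subseteq> S" "wprod u = inv g \<otimes> h" "length u = len (inv g \<otimes> h)" 
    "distinct (crossings u)" "set (crossings u) = inversions (inv g \<otimes> h)" by (rule reduced_word)
  have "cj g r \<notin> Q" if "r \<in> set (crossings u)" for r
    using eq[of "cj g r"] that u crossings_closed[OF u(1)] inversions_diff[OF g h, of r] by auto
  then have "connected_component (cayley - \<Union> (wall W S ` Q)) (vertex g) (vertex (g \<otimes> wprod u))"
    using path_component_vertices[OF Q g u(1)] by blast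
  moreover have "g \<otimes> wprod u = h" using u g h by (simp add: m_assoc[symmetric])
  ultimately show ?thesis by simp
qed

text \<open>
  The functions that exceed \<open>1/2\<close> at some element of \<open>H\<close> or are positive at two elements of \<open>H\<close>.
  They form an open set. If \<open>H\<close> and \<open>K\<close> consist of the elements on either side of a wall, then
  the sets of \<open>H\<close> and \<open>K\<close> cover the complement of the wall in the graph, because only midpoints
  of edges across the wall are missed, and they do not meet in the graph.
\<close>

definition side_nbhd :: "'a set \<Rightarrow> ('a \<Rightarrow> real) set" where
  "side_nbhd H = (\<Union>g\<in>H. {x. x g > 1 / 2}) \<union> (\<Union>g\<in>H. \<Union>h\<in>H - {g}. {x. x g > 0} \<inter> {x. x h > 0})"

lemma sideI:
  "g \<in> H \<Longrightarrow> x g > 1 / 2 \<Longrightarrow> x \<in> side_nbhd H"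
  "g \<in> H \<Longrightarrow> h \<in> H \<Longrightarrow> h \<noteq> g \<Longrightarrow> x g > 0 \<Longrightarrow> x h > 0 \<Longrightarrow> x \<in> side_nbhd H"
  unfolding side_nbhd_def by auto

lemma open_side: "open (side_nbhd H)"
proof -
  have op: "open {x :: 'a \<Rightarrow> real. x g > c}" for g c
    by (intro open_Collect_less continuous_on_product_coordinates continuous_on_const)
  then show ?thesis unfolding side_nbhd_def by (intro open_Un open_UN ballI open_Int op)
qed

lemma sides_disjoint:
  assumes x: "x = edge_point a b t" "a \<noteq> b" "0 \<le> t" "t \<le> 1" and HK: "H \<inter> K = {}" and xH: "x \<in> side_nbhd H" and xK: "x \<in> side_nbhd K"
  shows False
proof -
  have sup: "k = a \<or> k = b" if "x k > 0" for k using that x edge_point_val(3)[of k a b t] by force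
  have sum: "x a + x b = 1" using x by (simp add: edge_point_val)
  have w: "(\<exists>g\<in>H. x g > 1 / 2) \<or> {a, b} \<subseteq> H" if xs: "x \<in> side_nbhd H" for H
  proof (cases "\<exists>g\<in>H. x g > 1 / 2")
    case False
    then obtain g h where "g \<in> H" "h \<in> H" "h \<noteq> g" "x g > 0" "x h > 0"
      using xs unfolding side_nbhd_def by blast
    then show ?thesis using sup[of g] sup[of h] by auto
  qed simp
  have half: "k = a \<or> k = b" if "x k > 1 / 2" for k using that sup by force
  from w[OF xH] w[OF xK] show False
  proof (elim disjE bexE)
    fix g k assume "g \<in> H" "1 / 2 < x g" "k \<in> K" "1 / 2 < x k"
    then show False using half[of g] half[of k] sum HK by auto
  next
    fix g assume "g \<in> H" "1 / 2 < x g" "{a, b} \<subseteq> K"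
    then show False using half[of g] HK by auto
  next
    fix g assume "g \<in> K" "1 / 2 < x g" "{a, b} \<subseteq> H"
    then show False using half[of g] HK by auto
  next
    assume "{a, b} \<subseteq> H" "{a, b} \<subseteq> K"
    then show False using HK by auto
  qed
qed

lemma connected_same_side:
  assumes q: "q \<in> reflections W S" and T: "connected T" "T \<subseteq> cayley - wall W S q"
    and g: "g \<in> carrier W" "vertex g \<in> T" and h: "h \<in> carrier W" "vertex h \<in> T"
  shows "q \<in> inversions g \<longleftrightarrow> q \<in> inversions h"
proof -
  define H where "H = {k \<in> carrier W. q \<in> inversions k}"
  define K where "K = {k \<in> carrier W. q \<notin> inversions k}"
  have HK: "H \<inter> K = {}" by (auto simp: H_def K_def)
  obtain s0 where s0: "s0 \<in> S" using q by (auto elim: reflectionE)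
  have cover: "T \<subseteq> side_nbhd H \<union> side_nbhd K"
  proof
    fix x assume x: "x \<in> T"
    then have "x \<in> cayley" using T by blast
    then obtain a s t where a: "a \<in> carrier W" "s \<in> S" "0 \<le> t" "t \<le> 1" "x = edge_point a (a \<otimes> s) t"
      using X_point s0 by blast
    let ?b = "a \<otimes> s"
    have b: "?b \<in> carrier W" "a \<noteq> ?b" using a gen_move[OF a(1,2)] by auto
    have v: "x a = 1 - t" "x ?b = t" using a b by (simp_all add: edge_point_val)
    show "x \<in> side_nbhd H \<union> side_nbhd K"
    proof (cases "t > 1 / 2 \<or> t < 1 / 2")
      case True
      then have "x a > 1 / 2 \<or> x ?b > 1 / 2" using v by auto
      moreover have "a \<in> H \<or> a \<in> K" "?b \<in> H \<or> ?b \<in> K" using a(1) b by (auto simp: H_def K_def)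
      ultimately show ?thesis 
        using sideI(1)[of a H x] sideI(1)[of a K x] sideI(1)[of ?b H x] sideI(1)[of ?b K x] by blast
    next
      case False
      then have t: "t = 1 / 2" by auto
      have "cj a s \<noteq> q" using midpoint_in_wall[OF a(1,2)] a(5) t x T by auto
      then have "q \<in> inversions ?b \<longleftrightarrow> q \<in> inversions a"
        using inversions_mult_gen[OF a(1,2), of q] q by auto
      moreover have "x a > 0" "x ?b > 0" using v t by auto
      ultimately show ?thesis 
        using a(1) b sideI(2)[of a H ?b x] sideI(2)[of a K ?b x] by (auto simp: H_def K_def)
    qed
  qed
  have disj: "side_nbhd H \<inter> side_nbhd K \<inter> T = {}"
  proof (rule ccontr)
    assume "side_nbhd H \<inter> side_nbhd K \<inter> T \<noteq> {}"
    then obtain x where x: "x \<in> side_nbhd H" "x \<in> side_nbhd K" "x \<in> T" by blast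
    then have "x \<in> cayley" using T by blast
    then obtain a s t where a: "a \<in> carrier W" "s \<in> S" "0 \<le> t" "t \<le> 1" "x = edge_point a (a \<otimes> s) t"
      using X_point s0 by blast
    show False using sides_disjoint[OF a(5) gen_move[OF a(1,2), symmetric] a(3,4) HK x(1,2)] .
  qed
  have one: "side_nbhd H \<inter> T = {} \<or> side_nbhd K \<inter> T = {}"
    using connectedD[OF T(1) open_side open_side disj cover] by blast
  have vs: "vertex k \<in> side_nbhd L" if "k \<in> L" for k L
    using that by (intro sideI(1)[of k]) (auto simp: vertex_def)
  show ?thesis
  proof (rule ccontr)
    assume "\<not> ?thesis"
    then have "(g \<in> H \<and> h \<in> K) \<or> (g \<in> K \<and> h \<in> H)" using g(1) h(1) by (auto simp: H_def K_def)
    then have "vertex g \<in> side_nbhd H \<and> vertex h \<in> side_nbhd K \<or> vertex g \<in> side_nbhd K \<and> vertex h \<in> side_nbhd H"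
      using vs by metis
    then show False using one g(2) h(2) by blast
  qed
qed

lemma component_same_side:
  assumes "q \<in> Q" "Q \<subseteq> reflections W S" "g \<in> carrier W" "h \<in> carrier W"
    "connected_component (cayley - \<Union> (wall W S ` Q)) (vertex g) (vertex h)"
  shows "q \<in> inversions g \<longleftrightarrow> q \<in> inversions h"
proof -
  obtain T where T: "connected T" "T \<subseteq> cayley - \<Union> (wall W S ` Q)" "vertex g \<in> T" "vertex h \<in> T"
    using assms(5) unfolding connected_component_def by blast
  then have "T \<subseteq> cayley - wall W S q" using assms(1) by blast
  then show ?thesis using connected_same_side[OF _ T(1)] assms T by blast
qed

lemma component_unique:
  assumes "C \<in> components Y" "x \<in> C" shows "C = connected_component_set Y x"
proof -
  obtain y where "C = connected_component_set Y y" using assms by (auto simp: components_def)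
  then show ?thesis using assms(2) connected_component_eq by blast
qed

lemma component_intro: "x \<in> Y \<Longrightarrow> connected_component_set Y x \<in> components Y"
  by (auto simp: components_def)

lemma separatesI:
  assumes "x \<in> cayley - V" "y \<in> cayley - V" "\<not> connected_component (cayley - V) x y"
    "P \<subseteq> connected_component_set (cayley - V) x" "Q \<subseteq> connected_component_set (cayley - V) y"
  shows "separates W S V P Q"
proof -
  have "y \<in> connected_component_set (cayley - V) y" using assms(2) by simp
  then have ne: "connected_component_set (cayley - V) x \<noteq> connected_component_set (cayley - V) y"
    using assms(3) by (metis mem_Collect_eq)
  show ?thesis
    unfolding separates_def half_spaces_def
    by (intro bexI[of _ "connected_component_set (cayley - V) x"] bexI[of _ "connected_component_set (cayley - V) y"]
        conjI ne assms(4,5) component_intro assms(1,2))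
qed

lemma separates_vertices:
  assumes q: "q \<in> reflections W S" and g: "g \<in> carrier W" and h: "h \<in> carrier W"
  shows "separates W S (wall W S q) {vertex g} {vertex h} \<longleftrightarrow> (q \<in> inversions g) \<noteq> (q \<in> inversions h)"
proof -
  let ?Y = "cayley - \<Union> (wall W S ` {q})"
  have Y: "?Y = cayley - wall W S q" by simp
  have Q: "{q} \<subseteq> reflections W S" using q by simp
  have v: "vertex g \<in> ?Y" "vertex h \<in> ?Y" using vertex_in_complement[OF Q] g h by auto
  have "separates W S (wall W S q) {vertex g} {vertex h} \<longleftrightarrow> \<not> connected_component ?Y (vertex g) (vertex h)"
  proof
    assume "separates W S (wall W S q) {vertex g} {vertex h}"
    then obtain H K where H: "H \<in> components ?Y" "K \<in> components ?Y" "H \<noteq> K" "vertex g \<in> H" "vertex h \<in> K"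
      unfolding separates_def half_spaces_def Y by blast
    then have "H = connected_component_set ?Y (vertex g)" "K = connected_component_set ?Y (vertex h)"
      using component_unique by blast+
    then show "\<not> connected_component ?Y (vertex g) (vertex h)"
      using H(3) connected_component_eq[of "vertex h" ?Y "vertex g"] by auto
  next
    assume n: "\<not> connected_component ?Y (vertex g) (vertex h)"
    show "separates W S (wall W S q) {vertex g} {vertex h}"
      by (rule separatesI[of "vertex g" _ "vertex h"]) (use n v Y in auto)
  qed
  also have "\<dots> \<longleftrightarrow> (q \<in> inversions g) \<noteq> (q \<in> inversions h)"
    using same_side_component[OF Q g h] component_same_side[of q "{q}" g h] g h Q by blast
  finally show ?thesis .
qed

text \<open>
  The edges reversed by \<open>r\<close> have their midpoints on the wall of \<open>r\<close>, and for \<open>q \<noteq> r\<close> they avoid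
  the wall of \<open>q\<close>. So the side of the wall of \<open>r\<close> can be read off from the end points of these
  edges.
\<close>

lemma separates_wall:
  assumes q: "q \<in> reflections W S" and r: "r \<in> reflections W S" and g: "g \<in> carrier W"
  shows "separates W S (wall W S q) {vertex g} (wall W S r) \<longleftrightarrow>
    q \<noteq> r \<and> (\<forall>z\<in>carrier W. \<forall>s\<in>S. cj z s = r \<longrightarrow> (q \<in> inversions z) \<noteq> (q \<in> inversions g))"
proof -
  let ?Y = "cayley - \<Union> (wall W S ` {q})"
  have Y: "?Y = cayley - wall W S q" by simp
  have Q: "{q} \<subseteq> reflections W S" using q by simp
  have v: "vertex z \<in> ?Y" if "z \<in> carrier W" for z using vertex_in_complement[OF Q] that by auto
  have mid: "connected_component ?Y (vertex z) (edge_point z (z \<otimes> s) (1 / 2))" 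
    if "z \<in> carrier W" "s \<in> S" "cj z s = r" "q \<noteq> r" for z s
    by (rule edge_component[OF Q that(1,2)]) (use that in \<open>auto simp: cayley_edge_edge_point\<close>)
  obtain z0 s0 where z0: "z0 \<in> carrier W" "s0 \<in> S" "r = cj z0 s0" using r by (rule reflectionE)
  show ?thesis
  proof
    assume "separates W S (wall W S q) {vertex g} (wall W S r)"
    then obtain H K where H: "H \<in> components ?Y" "K \<in> components ?Y" "H \<noteq> K" "vertex g \<in> H" "wall W S r \<subseteq> K"
      unfolding separates_def half_spaces_def Y by blast
    have "K \<subseteq> ?Y" using H(2) in_components_subset by blast
    then have qr: "q \<noteq> r" using midpoint_in_wall[OF z0(1,2)] z0 H(5) by auto
    have "(q \<in> inversions z) \<noteq> (q \<in> inversions g)" if z: "z \<in> carrier W" "s \<in> S" "cj z s = r" for z s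
    proof
      assume e: "(q \<in> inversions z) = (q \<in> inversions g)"
      have "edge_point z (z \<otimes> s) (1 / 2) \<in> K" using midpoint_in_wall[OF z(1,2)] z(3) H(5) by auto
      then have "K = connected_component_set ?Y (edge_point z (z \<otimes> s) (1 / 2))" using component_unique H(2) by blast
      also have "\<dots> = connected_component_set ?Y (vertex z)"
        using mid[OF z qr] connected_component_eq by blast
      also have "\<dots> = connected_component_set ?Y (vertex g)"
        using same_side_component[OF Q g z(1)] e connected_component_eq by blast
      also have "\<dots> = H" using component_unique H by blast
      finally show False using H(3) by simp
    qed
    then show "q \<noteq> r \<and> (\<forall>z\<in>carrier W. \<forall>s\<in>S. cj z s = r \<longrightarrow> (q \<in> inversions z) \<noteq> (q \<in> inversions g))"
      using qr by blast
  next
    assume A: "q \<noteq> r \<and> (\<forall>z\<in>carrier W. \<forall>s\<in>S. cj z s = r \<longrightarrow> (q \<in> inversions z) \<noteq> (q \<in> inversions g))"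
    let ?H = "connected_component_set ?Y (vertex g)" and ?K = "connected_component_set ?Y (vertex z0)"
    have n: "\<not> connected_component ?Y (vertex g) (vertex z0)"
      using A z0 component_same_side[of q "{q}" g z0] g Q by blast
    have "wall W S r \<subseteq> ?K"
    proof
      fix x assume "x \<in> wall W S r"
      then obtain z s where z: "z \<in> carrier W" "s \<in> S" "r = cj z s" "x = edge_point z (z \<otimes> s) (1 / 2)"
        using wall_point[OF r] by blast
      have "connected_component ?Y (vertex z0) (vertex z)"
        using same_side_component[OF Q z0(1) z(1)] A z z0 by auto
      then show "x \<in> ?K" using mid[OF z(1,2) z(3)[symmetric]] A z(4) connected_component_trans by blast
    qed
    then show "separates W S (wall W S q) {vertex g} (wall W S r)"
      using separatesI[of "vertex g" "wall W S q" "vertex z0"] n v[OF g] v[OF z0(1)] Y by simp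
  qed
qed

lemma inversions_prefix:
  assumes u: "set u \<subseteq> S" "set (crossings u) = inversions (wprod u)" 
  shows "inversions (wprod (take i u)) \<subseteq> inversions (wprod u)"
proof -
  have t: "set (take i u) \<subseteq> S" "set (drop i u) \<subseteq> S" using u by (auto dest: in_set_takeD in_set_dropD)
  have "set (crossings (take i u)) \<subseteq> set (crossings (take i u @ drop i u))"
    unfolding crossings_append[OF t] by auto
  then show ?thesis using inversions_sub_crossings[OF t(1)] u by auto
qed

text \<open>
  A reduced path from \<open>1\<close> to \<open>y\<close> crosses the wall of each inversion of \<open>y\<close>, and its vertices lie
  below \<open>y\<close>.
\<close>

lemma crossing_prefix:
  assumes y: "y \<in> carrier W" "r \<in> inversions y"
  obtains p s where "p \<in> carrier W" "s \<in> S" "r = cj p s" "inversions p \<subseteq> inversions y"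
proof -
  obtain u where u: "set u \<subseteq> S" "wprod u = y" "length u = len y" "distinct (crossings u)" "set (crossings u) = inversions y"
    using y(1) by (rule reduced_word)
  then obtain i where i: "i < length u" "r = crossings u ! i" using y(2) by (metis in_set_conv_nth length_crossings)
  have "set (take i u) \<subseteq> S" using u by (auto dest: in_set_takeD)
  moreover have "u ! i \<in> S" using u i by auto
  moreover have "r = cj (wprod (take i u)) (u ! i)" using crossings_nth[OF u(1) i(1)] i by simp
  ultimately show thesis using that[of "wprod (take i u)" "u ! i"] inversions_prefix[of u i] u by auto
qed

text \<open>
  Translation by \<open>g\<^sup>-\<^sup>1\<close> reduces separation from \<open>g\<close> to separation from \<open>1\<close>.
\<close>

lemma separation_translate:
  assumes q: "q \<in> reflections W S" and r: "r \<in> reflections W S" and g: "g \<in> carrier W"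
  shows "(q \<noteq> r \<and> (\<forall>z\<in>carrier W. \<forall>s\<in>S. cj z s = r \<longrightarrow> (q \<in> inversions z) \<noteq> (q \<in> inversions g))) \<longleftrightarrow>
    (cj (inv g) q \<noteq> cj (inv g) r \<and>
      (\<forall>y\<in>carrier W. cj (inv g) r \<in> inversions y \<longrightarrow> cj (inv g) q \<in> inversions y))"
proof -
  let ?q = "cj (inv g) q" and ?r = "cj (inv g) r"
  have c: "q \<in> carrier W" "r \<in> carrier W" "?q \<in> carrier W" "?r \<in> carrier W" using q r g by auto
  have ne: "?q \<noteq> ?r \<longleftrightarrow> q \<noteq> r" using c g by (metis cj_inv_cj(2))
  have tr: "(q \<in> inversions (g \<otimes> y)) \<noteq> (q \<in> inversions g) \<longleftrightarrow> ?q \<in> inversions y" if "y \<in> carrier W" for y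
    using inversions_mult[OF g that c(1)] by auto
  show ?thesis
  proof (cases "q = r")
    case True
    then show ?thesis by simp
  next
    case False
    have qr: "?q \<noteq> ?r" using ne False by simp
    show ?thesis
    proof (intro iffI conjI qr False ballI impI; elim conjE)
      fix y assume y: "y \<in> carrier W" "?r \<in> inversions y" 
        and A: "\<forall>z\<in>carrier W. \<forall>s\<in>S. cj z s = r \<longrightarrow> (q \<in> inversions z) \<noteq> (q \<in> inversions g)"
      obtain p s where p: "p \<in> carrier W" "s \<in> S" "?r = cj p s" "inversions p \<subseteq> inversions y"
        using crossing_prefix[OF y] by blast
      have "cj (g \<otimes> p) s = cj g ?r" using p g by (simp add: cj_cj)
      then have "cj (g \<otimes> p) s = r" using g c by simp
      then have "(q \<in> inversions (g \<otimes> p)) \<noteq> (q \<in> inversions g)" 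
        using A p(2) m_closed[OF g p(1)] by blast
      then show "?q \<in> inversions y" using tr[OF p(1)] p(4) by blast
    next
      fix z s assume z: "z \<in> carrier W" "s \<in> S" "cj z s = r"
        and A: "\<forall>y\<in>carrier W. ?r \<in> inversions y \<longrightarrow> ?q \<in> inversions y"
      define y where "y = inv g \<otimes> z"
      have y: "y \<in> carrier W" "g \<otimes> y = z" using z g by (auto simp: y_def m_assoc[symmetric])
      have ry: "cj y s = ?r" unfolding y_def using cj_cj[of "inv g" z s] z g by simp
      have "?q \<in> inversions y"
      proof (cases "?r \<in> inversions y")
        case True
        then show ?thesis using A y by blast
      next
        case F: False
        then have "?r \<in> inversions (y \<otimes> s)" using inversions_mult_gen[OF y(1) z(2) c(4)] ry by simp
        then have "?q \<in> inversions (y \<otimes> s)" using A y z by simp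
        then show ?thesis using inversions_mult_gen[OF y(1) z(2) c(3)] ry qr by simp
      qed
      then show "(q \<in> inversions z) \<noteq> (q \<in> inversions g)" using tr[OF y(1)] y(2) by simp
    qed
  qed
qed

lemma cj_reflections_image:
  assumes g: "g \<in> carrier W" shows "cj g ` reflections W S = reflections W S"
proof -
  have "q \<in> cj g ` reflections W S" if q: "q \<in> reflections W S" for q
    using q g reflections_cj_closed[of "inv g" q] by (intro image_eqI[of _ _ "cj (inv g) q"]) auto
  then show ?thesis using reflections_cj_closed[OF g] by auto
qed

lemma close_to_0_iff:
  assumes r: "r \<in> reflections W S" and g: "g \<in> carrier W"
  shows "close_to W S 0 (wall W S r) g \<longleftrightarrow> elementary (cj (inv g) r)"
proof -
  let ?r = "cj (inv g) r"
  have "close_to W S 0 (wall W S r) g \<longleftrightarrow> 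
      \<not> (\<exists>q\<in>reflections W S. separates W S (wall W S q) {vertex g} (wall W S r))"
  proof -
    have "finite A \<and> card A \<le> 0 \<longleftrightarrow> A = {}" for A :: "('a \<Rightarrow> real) set set" by auto
    then show ?thesis unfolding close_to_def walls_def by auto
  qed
  also have "\<dots> \<longleftrightarrow> \<not> (\<exists>q\<in>reflections W S. cj (inv g) q \<noteq> ?r \<and>
      (\<forall>y\<in>carrier W. ?r \<in> inversions y \<longrightarrow> cj (inv g) q \<in> inversions y))"
    using separates_wall[OF _ r g] separation_translate[OF _ r g] by simp
  also have "\<dots> \<longleftrightarrow> elementary ?r"
  proof -
    have "elementary ?r \<longleftrightarrow> \<not> (\<exists>q\<in>cj (inv g) ` reflections W S. q \<noteq> ?r \<and>
      (\<forall>y\<in>carrier W. ?r \<in> inversions y \<longrightarrow> q \<in> inversions y))"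
      unfolding cj_reflections_image[OF inv_closed[OF g]] elementary_def ..
    then show ?thesis by simp
  qed
  finally show ?thesis .
qed

lemma elementary_walls_eq:
  "elementary_walls W S = wall W S ` {r \<in> reflections W S. elementary r}"
proof -
  have "cj (inv \<one>) r = r" if "r \<in> reflections W S" for r using that by simp
  then show ?thesis
    unfolding elementary_walls_def walls_def using close_to_0_iff[OF _ one_closed] by auto
qed

lemma shi_part_eq:
  assumes C: "C \<in> components (cayley - \<Union> (elementary_walls W S))" and h: "h \<in> carrier W" "vertex h \<in> C"
  shows "{g \<in> carrier W. vertex g \<in> C} = shi_class h"
proof -
  let ?Q = "{r \<in> reflections W S. elementary r}"
  let ?Y = "cayley - \<Union> (wall W S ` ?Q)"
  have Q: "?Q \<subseteq> reflections W S" by auto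
  have "C = connected_component_set ?Y (vertex h)"
    using component_unique[OF C h(2)] by (simp add: elementary_walls_eq)
  then have "vertex g \<in> C \<longleftrightarrow> g \<in> shi_class h" if g: "g \<in> carrier W" for g
    using same_side_component[OF Q h(1) g] component_same_side[OF _ Q h(1) g] g unfolding shi_class_def by blast
  then show ?thesis using shi_class_carrier by auto
qed

lemma shi_part_exists:
  assumes h: "h \<in> carrier W" shows "shi_class h \<in> shi_parts W S"
proof -
  let ?Y = "cayley - \<Union> (elementary_walls W S)"
  have v: "vertex h \<in> ?Y"
    using vertex_in_complement[of "{r \<in> reflections W S. elementary r}" h] h by (auto simp: elementary_walls_eq)
  have "vertex h \<in> connected_component_set ?Y (vertex h)" using v by simp
  then have "{g \<in> carrier W. vertex g \<in> connected_component_set ?Y (vertex h)} = shi_class h"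
    using shi_part_eq[OF component_intro[OF v] h] by blast
  then show ?thesis unfolding shi_parts_def using component_intro[OF v] by blast
qed

section \<open>The weak order\<close>

text \<open>
  The vertices of the edge path that starts at \<open>g\<close> and is spelled by a word.
\<close>

fun path_vertices :: "'a \<Rightarrow> 'a list \<Rightarrow> 'a list" where
  "path_vertices g [] = [g]"
| "path_vertices g (s # u) = g # path_vertices (g \<otimes> s) u"

lemma path_vertices_simps [simp]: "path_vertices g u \<noteq> []" "hd (path_vertices g u) = g" "length (path_vertices g u) = Suc (length u)"
  by (induction g u rule: path_vertices.induct) auto

lemma edge_path_path_vertices:
  "g \<in> carrier W \<Longrightarrow> set u \<subseteq> S \<Longrightarrow> edge_path W S g (g \<otimes> wprod u) (path_vertices g u)"
proof (induction g u rule: path_vertices.induct)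
  case (2 g s u)
  then have "edge_path W S (g \<otimes> s) (g \<otimes> s \<otimes> wprod u) (path_vertices (g \<otimes> s) u)" by simp
  then show ?case using 2 by (auto simp: edge_path_def m_assoc successively_Cons)
qed (simp add: edge_path_def)

lemma edge_pathE:
  "edge_path W S g h p \<Longrightarrow> \<exists>u. set u \<subseteq> S \<and> p = path_vertices g u \<and> h = g \<otimes> wprod u \<and> g \<in> carrier W"
proof (induction p arbitrary: g)
  case Nil
  then show ?case by (simp add: edge_path_def)
next
  case (Cons a p)
  have a: "a = g" "g \<in> carrier W" using Cons.prems by (auto simp: edge_path_def)
  show ?case
  proof (cases p)
    case Nil
    then show ?thesis using Cons.prems a by (intro exI[of _ "[]"]) (auto simp: edge_path_def)
  next
    case (Cons b p')
    then obtain s where s: "s \<in> S" "b = g \<otimes> s" using Cons.prems a by (auto simp: edge_path_def)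
    have "edge_path W S b h p" using Cons.prems Cons by (auto simp: edge_path_def)
    then obtain u where u: "set u \<subseteq> S" "p = path_vertices b u" "h = b \<otimes> wprod u" using Cons.IH by blast
    then show ?thesis using s a by (intro exI[of _ "s # u"]) (auto simp: m_assoc)
  qed
qed

lemma set_path_vertices:
  "g \<in> carrier W \<Longrightarrow> set u \<subseteq> S \<Longrightarrow> x \<in> set (path_vertices g u) \<longleftrightarrow> (\<exists>v w. u = v @ w \<and> x = g \<otimes> wprod v)"
proof (induction g u rule: path_vertices.induct)
  case (2 g s u)
  have "x \<in> set (path_vertices (g \<otimes> s) u) \<longleftrightarrow> (\<exists>v w. u = v @ w \<and> x = g \<otimes> s \<otimes> wprod v)" using 2 by simp
  also have "\<dots> \<longleftrightarrow> (\<exists>v w. u = v @ w \<and> x = g \<otimes> wprod (s # v))"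
  proof -
    have "g \<otimes> s \<otimes> wprod v = g \<otimes> wprod (s # v)" if "u = v @ w" for v w
      using that 2 by (simp add: m_assoc)
    then show ?thesis by (metis (no_types, lifting))
  qed
  finally have e: "x \<in> set (path_vertices g (s # u)) \<longleftrightarrow> x = g \<or> (\<exists>v w. u = v @ w \<and> x = g \<otimes> wprod (s # v))"
    by simp
  show ?case unfolding e
  proof (intro iffI; elim disjE exE conjE)
    assume "x = g"
    then show "\<exists>v w. s # u = v @ w \<and> x = g \<otimes> wprod v" 
      using 2 by (intro exI[of _ "[]"] exI[of _ "s # u"]) simp
  next
    fix v w assume "u = v @ w" "x = g \<otimes> wprod (s # v)"
    then show "\<exists>v w. s # u = v @ w \<and> x = g \<otimes> wprod v" 
      by (intro exI[of _ "s # v"] exI[of _ w]) simp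
  next
    fix v w assume vw: "s # u = v @ w" "x = g \<otimes> wprod v"
    show "x = g \<or> (\<exists>v w. u = v @ w \<and> x = g \<otimes> wprod (s # v))"
    proof (cases v)
      case Nil
      then show ?thesis using vw 2 by simp
    next
      case (Cons a v')
      then show ?thesis using vw by (intro disjI2 exI[of _ v'] exI[of _ w]) simp
    qed
  qed
qed auto

lemma geodesic_path_vertices:
  assumes "set u \<subseteq> S"
  shows "geodesic W S \<one> (wprod u) (path_vertices \<one> u) \<longleftrightarrow> length u = len (wprod u)"
proof
  assume g: "geodesic W S \<one> (wprod u) (path_vertices \<one> u)"
  have "wprod u \<in> carrier W" using assms by simp
  then obtain v where v: "set v \<subseteq> S" "wprod v = wprod u" "length v = len (wprod u)"
    using reduced_word by metis
  have "edge_path W S \<one> (wprod u) (path_vertices \<one> v)" using edge_path_path_vertices[OF one_closed v(1)] v assms by simp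
  then have "length (path_vertices \<one> u) \<le> length (path_vertices \<one> v)" using g unfolding geodesic_def by blast
  then show "length u = len (wprod u)" using v len_le_length[OF assms] by simp
next
  assume l: "length u = len (wprod u)"
  show "geodesic W S \<one> (wprod u) (path_vertices \<one> u)" unfolding geodesic_def
  proof (intro conjI allI impI)
    show "edge_path W S \<one> (wprod u) (path_vertices \<one> u)" using edge_path_path_vertices[OF one_closed assms] assms by simp
    fix p assume "edge_path W S \<one> (wprod u) p"
    then obtain v where v: "set v \<subseteq> S" "p = path_vertices \<one> v" "wprod u = \<one> \<otimes> wprod v" using edge_pathE by blast
    then show "length (path_vertices \<one> u) \<le> length p" using l len_le_length[OF v(1)] by simp
  qed
qed

lemma weak_order_le:
  assumes h: "h \<in> carrier W"
  shows "g \<sqsubseteq>\<^bsub>weak_order W S\<^esub> h \<longleftrightarrow> g \<in> carrier W \<and> inversions g \<subseteq> inversions h"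
proof
  assume "g \<sqsubseteq>\<^bsub>weak_order W S\<^esub> h"
  then obtain p where p: "geodesic W S \<one> h p" "g \<in> set p" by (auto simp: weak_order_def)
  then obtain u where u: "set u \<subseteq> S" "p = path_vertices \<one> u" "h = wprod u"
    using edge_pathE[of \<one> h p] by (auto simp: geodesic_def)
  have "length u = len h" using geodesic_path_vertices[OF u(1)] p u by simp
  then have r: "set (crossings u) = inversions (wprod u)" using reduced_iff[OF u(1)] u by simp
  obtain v w where vw: "u = v @ w" "g = wprod v" using p(2) u set_path_vertices[OF one_closed u(1), of g] by auto
  have "v = take (length v) u" using vw by simp
  then show "g \<in> carrier W \<and> inversions g \<subseteq> inversions h"
    using inversions_prefix[OF u(1) r, of "length v"] u vw by auto
next
  assume g: "g \<in> carrier W \<and> inversions g \<subseteq> inversions h"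
  then have gc: "g \<in> carrier W" by simp
  obtain u where u: "set u \<subseteq> S" "wprod u = g" "length u = len g" using reduced_word[OF gc] by metis
  have "inv g \<otimes> h \<in> carrier W" using gc h by simp
  then obtain v where v: "set v \<subseteq> S" "wprod v = inv g \<otimes> h" "length v = len (inv g \<otimes> h)" 
    using reduced_word by metis
  have e: "wprod (u @ v) = h" using u v gc h by (simp add: m_assoc[symmetric])
  have "length (u @ v) = len h" using len_mult_of_subset[OF gc h] g u v by simp
  then have "geodesic W S \<one> h (path_vertices \<one> (u @ v))" using geodesic_path_vertices[of "u @ v"] u v e by simp
  moreover have "g \<in> set (path_vertices \<one> (u @ v))" using set_path_vertices[OF one_closed, of "u @ v" g] u v gc by auto
  ultimately show "g \<sqsubseteq>\<^bsub>weak_order W S\<^esub> h" by (auto simp: weak_order_def)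
qed

lemma carrier_weak_order [simp]: "carrier (weak_order W S) = carrier W"
  by (simp add: weak_order_def)

section \<open>The two voracious projections\<close>

lemma low_elements_iff: "m \<in> low_elements W S \<longleftrightarrow> m \<in> carrier W \<and> is_gate m m"
proof
  assume "m \<in> low_elements W S"
  then obtain C where C: "C \<in> components (cayley - \<Union> (elementary_walls W S))" 
    and l: "least (weak_order W S) m {g \<in> carrier W. vertex g \<in> C}"
    unfolding low_elements_def shi_parts_def by blast
  then have m: "m \<in> carrier W" "vertex m \<in> C" by (auto simp: least_def)
  have "{g \<in> carrier W. vertex g \<in> C} = shi_class m" by (rule shi_part_eq[OF C m])
  then show "m \<in> carrier W \<and> is_gate m m"
    using l m weak_order_le shi_class_carrier by (auto simp: least_def is_gate_def)
next
  assume m: "m \<in> carrier W \<and> is_gate m m"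
  then have "least (weak_order W S) m (shi_class m)"
    using shi_class_carrier weak_order_le by (auto simp: least_def is_gate_def)
  then show "m \<in> low_elements W S" unfolding low_elements_def using shi_part_exists m by blast
qed

lemma garside_proj_gate:
  assumes h: "h \<in> carrier W" and m: "is_gate h m"
  shows "garside_proj W S (low_elements W S) h = m"
proof -
  let ?A = "{b \<in> low_elements W S. b \<sqsubseteq>\<^bsub>weak_order W S\<^esub> h}"
  have mp: "m \<in> shi_class h" "\<And>g. g \<in> shi_class h \<Longrightarrow> inversions m \<subseteq> inversions g" using m by (auto simp: is_gate_def)
  have mc: "m \<in> carrier W" using mp shi_class_carrier by blast
  have "is_gate m m" using m shi_class_eq[OF mp(1)] mp by (simp add: is_gate_def)
  then have mA: "m \<in> ?A" using mc low_elements_iff weak_order_le[OF h] mp(2)[OF shi_class_self[OF h]] by blast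
  have A: "b \<in> carrier W \<and> inversions b \<subseteq> inversions m" if "b \<in> ?A" for b
    using that low_elements_iff weak_order_le[OF h] gate_mono[OF _ _ h _ m] by blast
  have up: "u \<in> Upper (weak_order W S) ?A \<longleftrightarrow> u \<in> carrier W \<and> inversions m \<subseteq> inversions u" for u
  proof
    assume "u \<in> Upper (weak_order W S) ?A"
    then show "u \<in> carrier W \<and> inversions m \<subseteq> inversions u"
      using mA mc weak_order_le[of u m] by (auto simp: Upper_def)
  next
    assume "u \<in> carrier W \<and> inversions m \<subseteq> inversions u"
    then show "u \<in> Upper (weak_order W S) ?A"
      using A weak_order_le[of u] by (fastforce simp: Upper_def)
  qed
  have "least (weak_order W S) x (Upper (weak_order W S) ?A) \<longleftrightarrow> x = m" for x
  proof
    assume l: "least (weak_order W S) x (Upper (weak_order W S) ?A)"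
    then have "x \<in> carrier W" "inversions m \<subseteq> inversions x" using up[of x] by (auto simp: least_def)
    moreover have "x \<sqsubseteq>\<^bsub>weak_order W S\<^esub> m" using l up[of m] mc by (auto simp: least_def)
    ultimately show "x = m" using weak_order_le[OF mc] inversions_inj[of x m] mc by auto
  next
    assume "x = m"
    then show "least (weak_order W S) x (Upper (weak_order W S) ?A)"
      using up mc weak_order_le by (auto simp: least_def)
  qed
  then show ?thesis unfolding garside_proj_def sup_def by simp
qed

text \<open>
  Translation by \<open>g\<^sup>-\<^sup>1\<close> turns the candidates into the elements below \<open>g\<^sup>-\<^sup>1\<close> that belong to the
  part of \<open>g\<^sup>-\<^sup>1\<close>.
\<close>

lemma op_candidates_iff:
  assumes g: "g \<in> carrier W"
  shows "p \<in> op_candidates W S g \<longleftrightarrow> p \<in> carrier W \<and> inv g \<otimes> p \<in> shi_class (inv g)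
    \<and> inversions (inv g \<otimes> p) \<subseteq> inversions (inv g)"
proof (cases "p \<in> carrier W")
  case p: True
  define h where "h = inv g"
  define q where "q = inv g \<otimes> p"
  have hq: "h \<in> carrier W" "q \<in> carrier W" using g p by (auto simp: h_def q_def)
  have bij: "cj (inv g) ` reflections W S = reflections W S"
    by (rule cj_reflections_image[OF inv_closed[OF g]])
  have gr: "r \<in> inversions g \<longleftrightarrow> cj (inv g) r \<in> inversions h" if "r \<in> reflections W S" for r
    using that g inversions_inv[OF g, of "cj (inv g) r"] by (simp add: h_def)
  have pr: "r \<in> inversions p \<longleftrightarrow> (cj (inv g) r \<in> inversions q) \<noteq> (cj (inv g) r \<in> inversions h)"
    if "r \<in> reflections W S" for r
    using that g p inversions_diff[OF g p, of "cj (inv g) r"] gr[OF that] by (auto simp: q_def)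
  have walls: "(\<forall>V\<in>op_walls W S g. \<not> separates W S V {vertex p} {vertex \<one>}) \<longleftrightarrow>
      (\<forall>r\<in>reflections W S. r \<in> inversions g \<longrightarrow> elementary (cj (inv g) r) \<longrightarrow> r \<notin> inversions p)"
    unfolding op_walls_def walls_def
    using separates_vertices[OF _ _ one_closed] close_to_0_iff[OF _ g] g p by auto
  have "p \<in> op_candidates W S g \<longleftrightarrow> inversions p \<subseteq> inversions g \<and>
      (\<forall>r\<in>reflections W S. r \<in> inversions g \<longrightarrow> elementary (cj (inv g) r) \<longrightarrow> r \<notin> inversions p)"
    unfolding op_candidates_def using p walls weak_order_le[OF g, of p] by simp
  also have "\<dots> \<longleftrightarrow> (\<forall>r\<in>reflections W S. cj (inv g) r \<in> inversions q \<longrightarrow> cj (inv g) r \<in> inversions h) \<and>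
      (\<forall>r\<in>reflections W S. cj (inv g) r \<in> inversions h \<longrightarrow> elementary (cj (inv g) r) \<longrightarrow> cj (inv g) r \<in> inversions q)"
    using gr pr inversions_reflections[of p] by blast
  also have "\<dots> \<longleftrightarrow> (\<forall>r\<in>cj (inv g) ` reflections W S. r \<in> inversions q \<longrightarrow> r \<in> inversions h) \<and>
      (\<forall>r\<in>cj (inv g) ` reflections W S. r \<in> inversions h \<longrightarrow> elementary r \<longrightarrow> r \<in> inversions q)"
    by blast
  also have "\<dots> \<longleftrightarrow> q \<in> shi_class h \<and> inversions q \<subseteq> inversions h"
    unfolding bij shi_class_def using inversions_reflections[of q] hq by blast
  finally show ?thesis using p by (simp add: h_def q_def)
qed (simp add: op_candidates_def)

lemma op_voracious_proj_gate:
  assumes g: "g \<in> carrier W" and m: "is_gate (inv g) m"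
  shows "op_voracious_proj W S g = g \<otimes> m"
proof -
  have mp: "m \<in> shi_class (inv g)" "\<And>k. k \<in> shi_class (inv g) \<Longrightarrow> inversions m \<subseteq> inversions k" 
    using m by (auto simp: is_gate_def)
  have mc: "m \<in> carrier W" using mp shi_class_carrier by blast
  have inv_gm: "inv g \<otimes> (g \<otimes> m) = m" using g mc by (simp add: m_assoc[symmetric])
  have cand: "g \<otimes> m \<in> op_candidates W S g"
    using op_candidates_iff[OF g, of "g \<otimes> m"] g mc inv_gm mp shi_class_self[of "inv g"] by simp
  have gr: "greatest (weak_order W S) (g \<otimes> m) (op_candidates W S g)"
    unfolding greatest_def
  proof (intro conjI ballI cand)
    show "op_candidates W S g \<subseteq> carrier (weak_order W S)" by (auto simp: op_candidates_def)
    fix p assume "p \<in> op_candidates W S g"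
    then have p: "p \<in> carrier W" "inv g \<otimes> p \<in> shi_class (inv g)" "inversions (inv g \<otimes> p) \<subseteq> inversions (inv g)"
      using op_candidates_iff[OF g] by auto
    have sub: "inversions m \<subseteq> inversions (inv g \<otimes> p)" using mp(2) p(2) by blast
    have "inversions p \<subseteq> inversions (g \<otimes> m)"
    proof
      fix r assume r: "r \<in> inversions p"
      then have rc: "r \<in> carrier W" using inversions_carrier by blast
      have e: "r \<in> inversions (g \<otimes> k) \<longleftrightarrow> (cj (inv g) r \<in> inversions (inv g)) \<noteq> (cj (inv g) r \<in> inversions k)"
        if "k \<in> carrier W" for k
        using inversions_mult[OF g that rc] inversions_inv[OF g, of "cj (inv g) r"] g rc by simp
      have "g \<otimes> (inv g \<otimes> p) = p" using g p by (simp add: m_assoc[symmetric])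
      then show "r \<in> inversions (g \<otimes> m)" using r e[of "inv g \<otimes> p"] e[OF mc] g p sub by auto
    qed
    then show "p \<sqsubseteq>\<^bsub>weak_order W S\<^esub> g \<otimes> m" using weak_order_le[of "g \<otimes> m" p] g mc p by simp
  qed
  show ?thesis unfolding op_voracious_proj_def
  proof (rule the_equality, rule gr)
    fix p assume p: "greatest (weak_order W S) p (op_candidates W S g)"
    then have pc: "p \<in> carrier W" by (auto simp: greatest_def op_candidates_def)
    have "g \<otimes> m \<sqsubseteq>\<^bsub>weak_order W S\<^esub> p" "p \<sqsubseteq>\<^bsub>weak_order W S\<^esub> g \<otimes> m"
      using p gr unfolding greatest_def by blast+
    then show "p = g \<otimes> m"
      using weak_order_le[OF pc] weak_order_le[of "g \<otimes> m"] inversions_inj[OF pc, of "g \<otimes> m"] g mc by auto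
  qed
qed

end

theorem proposition4p3:
  fixes W :: "('a, 'b) monoid_scheme" and S :: "'a set"
  assumes "coxeter_system W S"
    and "finite S"
    and "g \<in> carrier W"
  shows "op_voracious_proj W S g = voracious_proj W S (low_elements W S) g"
proof -
  interpret coxeter_finite_rank W S
    using assms(1,2) by (intro coxeter_finite_rank.intro coxeter_finite_rank_axioms.intro)
  have "inv\<^bsub>W\<^esub> g \<in> carrier W" using assms(3) by simp
  moreover from this obtain m where m: "is_gate (inv\<^bsub>W\<^esub> g) m" using gate_exists by blast
  ultimately show ?thesis
    using op_voracious_proj_gate[OF assms(3) m] garside_proj_gate[OF _ m] by (simp add: voracious_proj_def)
qed

end
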